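(* Let $\mathcal{N}$ be a species of non-trivial 01-networks having non-adjacent poles. Then the edge index series of the species $E(\mathcal{N})$ of parallel compositions are $$W^+_{E(\mathcal{N})}(\mathbf{a};\mathbf{b};\mathbf{c})=\exp\Big(\sum_{m\ge1}\frac{W^+_{\mathcal{N},m}}{m}\Big),\qquad W^-_{E(\mathcal{N})}(\mathbf{a};\mathbf{b};\mathbf{c})=\exp\Big(\sum_{m\ \mathrm{even}}\frac{W^+_{\mathcal{N},m}}{m}+\sum_{m\ \mathrm{odd}}\frac{W^-_{\mathcal{N},m}}{m}\Big).$$ Moreover, $$W^+_{E_2(\mathcal{N})}=\tfrac12\big((W^+_{\mathcal{N}})^2+W^+_{\mathcal{N},2}\big),\qquad W^-_{E_2(\mathcal{N})}=\tfrac12\big((W^-_{\mathcal{N}})^2+W^+_{\mathcal{N},2}\big).$$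
   Context: All graphs are finite and simple. A 01-network is a connected graph $N$ with two distinguished vertices $0,1$ (poles) such that $N\cup01$ is 2-connected; its underlying set $U$ is its set of internal vertices. Network isomorphisms/automorphisms preserve the poles; $\tau$ exchanges poles and $N$ is $\tau$-symmetric if $\tau\cdot N\cong N$. Parallel composition: for a finite set of disjoint non-trivial networks with non-adjacent poles, the network obtained from the union of the graphs by merging all $0$-poles into one and all $1$-poles into one, the partition of the internal vertices among the component networks being part of the structure; the empty set gives the trivial network (two poles, no edges). $E(\mathcal{N})$ is the species of all parallel compositions of finite sets of networks in $\mathcal{N}$, and $E_2(\mathcal{N})$ of those of exactly two networks. Edge index series: for a graph $G$ and automorphism $\sigma$, an edge cycle of length $l$ of the induced edge permutation is cylindrical if $\sigma^l$ fixes both endpoints of its edges and Möbius if $\sigma^l$ swaps them; $w(G,\sigma)=\prod_k a_k^{\sigma_k}b_k^{\mathrm{cyl}_k}c_k^{\mathrm{m\ddot{o}b}_k}$ ($\sigma_k$ = number of vertex $k$-cycles; $\mathrm{cyl}_k,\mathrm{m\ddot{o}b}_k$ = numbers of cylindrical/Möbius edge cycles of length $k$). For a network $N$ with internal set $U$ and graph $\hat N$ on $U\cup\{0,1\}$, $\mathrm{Aut}^{\pm}(N)$ is the set of permutations $\sigma$ of $U$ with $(0)(1)\sigma$ (for $+$), resp. $(0\,1)\sigma$ (for $-$), an automorphism of $\hat N$, with weights $w(\hat N,(0)(1)\sigma)/a_1^2$, resp. $w(\hat N,(0\,1)\sigma)/a_2$. $W^+_{\mathcal{N}}$ is the sum over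 isomorphism class representatives $N\in\mathcal{N}$ of $\frac{1}{|\mathrm{Aut}^+(N)|}\sum_{\sigma\in\mathrm{Aut}^+(N)}w(N,\sigma)$, and $W^-_{\mathcal{N}}$ the analogous sum with $\mathrm{Aut}^-$ over representatives of $\tau$-symmetric networks of $\mathcal{N}$. For a series $f$, $f_m=f(a_m,a_{2m},\dots;b_m,b_{2m},\dots;c_m,c_{2m},\dots)$, and $W^{\pm}_{\mathcal{N},m}=(W^{\pm}_{\mathcal{N}})_m$.
   Formalization: The two W^- identities are stated for species closed under exchanging the poles (N in the species implies τ·N in it); without this they fail, e.g. for the species of all copies of one network N with τ·N not isomorphic to N. The W^+ identities need no such assumption. *)

theory Defs
  imports Complex_Main "HOL-Library.Multiset" "HOL-Combinatorics.Permutations" "HOL-Combinatorics.Orbits"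
begin

section \<open>Formal power series in arbitrarily many commuting variables\<close>

text \<open>
  A monomial is the multiset of its variables, so that the product of monomials is the sum of
  multisets; a series is an arbitrary family of rational coefficients indexed by the monomials.
\<close>

typedef 'x mseries = "UNIV :: ('x multiset \<Rightarrow> rat) set"
  morphisms coeff MSeries by simp

lemma coeff_MSeries [simp]: "coeff (MSeries f) = f"
  by (simp add: MSeries_inverse)

lemma mseries_eqI: "(\<And>M. coeff f M = coeff g M) \<Longrightarrow> f = g"
  by (simp add: coeff_inject[symmetric] ext)

lemma finite_submultisets: "finite {p. p \<subseteq># (M :: 'x multiset)}"
proof (rule finite_subset)
  show "{p. p \<subseteq># M} \<subseteq> mset ` {xs. set xs \<subseteq> set_mset M \<and> length xs \<le> size M}"
  proof
    fix p assume "p \<in> {p. p \<subseteq># M}"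
    then have p: "p \<subseteq># M" by simp
    obtain xs where xs: "mset xs = p" using ex_mset by blast
    have "set xs \<subseteq> set_mset M"
      using p xs set_mset_mono by fastforce
    moreover have "length xs \<le> size M"
      using p xs size_mset_mono by fastforce
    ultimately show "p \<in> mset ` {xs. set xs \<subseteq> set_mset M \<and> length xs \<le> size M}"
      using xs by blast
  qed
  show "finite (mset ` {xs. set xs \<subseteq> set_mset M \<and> length xs \<le> size M})"
    by (intro finite_imageI finite_lists_length_le) simp
qed

definition splits :: "'x multiset \<Rightarrow> ('x multiset \<times> 'x multiset) set" where
  "splits M = {(p, q). p + q = M}"

lemma finite_splits [simp]: "finite (splits M)"
proof (rule finite_subset)
  show "splits M \<subseteq> {p. p \<subseteq># M} \<times> {p. p \<subseteq># M}"
    by (auto simp: splits_def)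
qed (intro finite_cartesian_product finite_submultisets)

instantiation mseries :: (type) comm_ring_1
begin

definition zero_mseries :: "'a mseries" where
  "0 = MSeries (\<lambda>M. 0)"

definition one_mseries :: "'a mseries" where
  "1 = MSeries (\<lambda>M. if M = {#} then 1 else 0)"

definition plus_mseries :: "'a mseries \<Rightarrow> 'a mseries \<Rightarrow> 'a mseries" where
  "f + g = MSeries (\<lambda>M. coeff f M + coeff g M)"

definition minus_mseries :: "'a mseries \<Rightarrow> 'a mseries \<Rightarrow> 'a mseries" where
  "f - g = MSeries (\<lambda>M. coeff f M - coeff g M)"

definition uminus_mseries :: "'a mseries \<Rightarrow> 'a mseries" where
  "- f = MSeries (\<lambda>M. - coeff f M)"

definition times_mseries :: "'a mseries \<Rightarrow> 'a mseries \<Rightarrow> 'a mseries" where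
  "f * g = MSeries (\<lambda>M. \<Sum>(p, q)\<in>splits M. coeff f p * coeff g q)"

instance
proof
  fix f g h :: "'a mseries"
  show "f + g + h = f + (g + h)" "f + g = g + f" "0 + f = f" "- f + f = 0" "f - g = f + - g"
    by (rule mseries_eqI; simp add: plus_mseries_def zero_mseries_def uminus_mseries_def
          minus_mseries_def)+
  show "(0 :: 'a mseries) \<noteq> 1"
  proof
    assume "(0 :: 'a mseries) = 1"
    then have "coeff (0 :: 'a mseries) {#} = coeff 1 {#}" by simp
    then show False by (simp add: zero_mseries_def one_mseries_def)
  qed
  show "(f + g) * h = f * h + g * h"
    by (rule mseries_eqI)
      (simp add: plus_mseries_def times_mseries_def distrib_right case_prod_unfold sum.distrib)
  show "f * g = g * f"
  proof (rule mseries_eqI)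
    fix M :: "'a multiset"
    show "coeff (f * g) M = coeff (g * f) M"
      unfolding times_mseries_def coeff_MSeries
      by (rule sum.reindex_bij_witness[where i = "\<lambda>(p, q). (q, p)" and j = "\<lambda>(p, q). (q, p)"])
        (auto simp: splits_def add.commute mult.commute)
  qed
  show "1 * f = f"
  proof (rule mseries_eqI)
    fix M :: "'a multiset"
    have "coeff (1 * f) M = (\<Sum>(p, q)\<in>splits M. if p = {#} then coeff f q else 0)"
      unfolding times_mseries_def one_mseries_def coeff_MSeries
      by (rule sum.cong) auto
    also have "\<dots> = (\<Sum>(p, q)\<in>{({#} :: 'a multiset, M)}. coeff f q)"
      by (rule sum.mono_neutral_cong_right[OF finite_splits])
        (auto simp: splits_def split: if_splits)
    finally show "coeff (1 * f) M = coeff f M" by simp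
  qed
  show "f * g * h = f * (g * h)"
  proof (rule mseries_eqI)
    fix M :: "'a multiset"
    have "coeff (f * g * h) M =
        (\<Sum>x\<in>splits M. \<Sum>y\<in>splits (fst x). coeff f (fst y) * coeff g (snd y) * coeff h (snd x))"
      by (simp add: times_mseries_def case_prod_unfold sum_distrib_right)
    also have "\<dots> = (\<Sum>(x, y)\<in>(SIGMA x:splits M. splits (fst x)).
        coeff f (fst y) * coeff g (snd y) * coeff h (snd x))"
      by (rule sum.Sigma) auto
    also have "\<dots> = (\<Sum>(x, y)\<in>(SIGMA x:splits M. splits (snd x)).
        coeff f (fst x) * (coeff g (fst y) * coeff h (snd y)))"
      by (rule sum.reindex_bij_witness[where
            j = "\<lambda>((p, q), (r, s)). ((r, s + q), (s, q))" and
            i = "\<lambda>((p, q), (r, s)). ((p + r, s), (p, r))"])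
        (auto simp: splits_def add.assoc mult.assoc)
    also have "\<dots> =
        (\<Sum>x\<in>splits M. \<Sum>y\<in>splits (snd x). coeff f (fst x) * (coeff g (fst y) * coeff h (snd y)))"
      by (rule sum.Sigma[symmetric]) auto
    also have "\<dots> = coeff (f * (g * h)) M"
      by (simp add: times_mseries_def case_prod_unfold sum_distrib_left)
    finally show "coeff (f * g * h) M = coeff (f * (g * h)) M" .
  qed
qed

end

definition monomial :: "rat \<Rightarrow> 'x multiset \<Rightarrow> 'x mseries" where
  "monomial c M = MSeries (\<lambda>M'. if M' = M then c else 0)"

definition scale :: "rat \<Rightarrow> 'x mseries \<Rightarrow> 'x mseries" where
  "scale c f = MSeries (\<lambda>M. c * coeff f M)"

text \<open>
  The formal sum of a family of series, of which each monomial occurs in only finitely many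
  members. All families to which it is applied below have this property: there are finitely many
  isomorphism classes of networks on a given number of vertices, and the exponential is only taken
  of series without constant term.
\<close>

definition formal_sum :: "('i \<Rightarrow> 'x mseries) \<Rightarrow> 'i set \<Rightarrow> 'x mseries" where
  "formal_sum F I = MSeries (\<lambda>M. \<Sum>i | i \<in> I \<and> coeff (F i) M \<noteq> 0. coeff (F i) M)"

definition series_exp :: "'x mseries \<Rightarrow> 'x mseries" where
  "series_exp f = formal_sum (\<lambda>k. scale (1 / fact k) (f ^ k)) (UNIV :: nat set)"


section \<open>The edge index variables\<close>

datatype ivar = a nat | b nat | c nat
hide_const (open) a b c

fun index_times :: "nat \<Rightarrow> ivar \<Rightarrow> ivar" where
  "index_times m (ivar.a k) = ivar.a (m * k)"
| "index_times m (ivar.b k) = ivar.b (m * k)"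
| "index_times m (ivar.c k) = ivar.c (m * k)"

text \<open>For \<open>m \<ge> 1\<close> this is the series \<open>f\<^sub>m\<close>.\<close>

definition dilate :: "nat \<Rightarrow> ivar mseries \<Rightarrow> ivar mseries" where
  "dilate m f = formal_sum (\<lambda>M. monomial (coeff f M) (image_mset (index_times m) M)) UNIV"


section \<open>Graphs\<close>

datatype 'v graph = Graph (verts: "'v set") (edges: "'v set set")

definition simple_graph :: "'v graph \<Rightarrow> bool" where
  "simple_graph G \<longleftrightarrow> finite (verts G) \<and> (\<forall>e\<in>edges G. e \<subseteq> verts G \<and> card e = 2)"

definition connected_graph :: "'v graph \<Rightarrow> bool" where
  "connected_graph G \<longleftrightarrow>
     verts G \<noteq> {} \<and> (\<forall>u\<in>verts G. \<forall>v\<in>verts G. (u, v) \<in> {(x, y). {x, y} \<in> edges G}\<^sup>*)"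

definition delete_vertex :: "'v graph \<Rightarrow> 'v \<Rightarrow> 'v graph" where
  "delete_vertex G v = Graph (verts G - {v}) {e \<in> edges G. v \<notin> e}"

definition add_edge :: "'v graph \<Rightarrow> 'v set \<Rightarrow> 'v graph" where
  "add_edge G e = Graph (verts G) (insert e (edges G))"

definition two_connected :: "'v graph \<Rightarrow> bool" where
  "two_connected G \<longleftrightarrow>
     2 \<le> card (verts G) \<and> connected_graph G \<and> (\<forall>v\<in>verts G. connected_graph (delete_vertex G v))"

definition graph_image :: "('v \<Rightarrow> 'w) \<Rightarrow> 'v graph \<Rightarrow> 'w graph" where
  "graph_image f G = Graph (f ` verts G) ((`) f ` edges G)"

text \<open>
  The edge cycles of \<open>\<sigma>\<close> are the orbits of the induced permutation \<open>e \<mapsto> \<sigma> ` e\<close> of the edges.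
  Since an edge is a set of two vertices, the condition in \<open>moebius\<close> says that the endpoints are
  swapped.
\<close>

definition vertex_cycles :: "'v graph \<Rightarrow> ('v \<Rightarrow> 'v) \<Rightarrow> 'v set set" where
  "vertex_cycles G \<sigma> = orbit \<sigma> ` verts G"

definition edge_cycles :: "'v graph \<Rightarrow> ('v \<Rightarrow> 'v) \<Rightarrow> 'v set set set" where
  "edge_cycles G \<sigma> = orbit ((`) \<sigma>) ` edges G"

definition cylindrical :: "('v \<Rightarrow> 'v) \<Rightarrow> 'v set set \<Rightarrow> bool" where
  "cylindrical \<sigma> C \<longleftrightarrow> (\<forall>e\<in>C. \<forall>v\<in>e. (\<sigma> ^^ card C) v = v)"

definition moebius :: "('v \<Rightarrow> 'v) \<Rightarrow> 'v set set \<Rightarrow> bool" where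
  "moebius \<sigma> C \<longleftrightarrow> (\<forall>u v. {u, v} \<in> C \<longrightarrow> (\<sigma> ^^ card C) u = v \<and> (\<sigma> ^^ card C) v = u)"

text \<open>The exponents of the weight are gathered by running over the cycles one by one.\<close>

definition weight :: "'v graph \<Rightarrow> ('v \<Rightarrow> 'v) \<Rightarrow> ivar multiset" where
  "weight G \<sigma> =
     image_mset (\<lambda>C. ivar.a (card C)) (mset_set (vertex_cycles G \<sigma>)) +
     image_mset (\<lambda>C. ivar.b (card C)) (mset_set {C \<in> edge_cycles G \<sigma>. cylindrical \<sigma> C}) +
     image_mset (\<lambda>C. ivar.c (card C)) (mset_set {C \<in> edge_cycles G \<sigma>. moebius \<sigma> C})"


section \<open>Networks\<close>

datatype 'a vertex = Pole0 | Pole1 | Internal 'a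

text \<open>
  The internal vertices are labelled by natural numbers, so that every finite network is
  isomorphic to one of this type. For a map \<open>f\<close> of labels, \<open>map_vertex f\<close> is its extension fixing
  the two poles.
\<close>

type_synonym network = "nat vertex graph"

definition internals :: "network \<Rightarrow> nat set" where
  "internals N = {x. Internal x \<in> verts N}"

definition is_network :: "network \<Rightarrow> bool" where
  "is_network N \<longleftrightarrow>
     simple_graph N \<and> Pole0 \<in> verts N \<and> Pole1 \<in> verts N \<and>
     connected_graph N \<and> two_connected (add_edge N {Pole0, Pole1})"

definition trivial_network :: network where
  "trivial_network = Graph {Pole0, Pole1} {}"

definition adjacent_poles :: "network \<Rightarrow> bool" where
  "adjacent_poles N \<longleftrightarrow> {Pole0, Pole1} \<in> edges N"

fun swap_poles :: "'a vertex \<Rightarrow> 'a vertex" where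
  "swap_poles Pole0 = Pole1"
| "swap_poles Pole1 = Pole0"
| "swap_poles (Internal x) = Internal x"

text \<open>A species of networks: a class of networks closed under (pole-preserving) isomorphism.\<close>

definition network_species :: "network set \<Rightarrow> bool" where
  "network_species \<N> \<longleftrightarrow>
     (\<forall>N\<in>\<N>. is_network N) \<and>
     (\<forall>N\<in>\<N>. \<forall>f. inj_on f (internals N) \<longrightarrow> graph_image (map_vertex f) N \<in> \<N>)"

text \<open>
  Closure under exchanging the poles is needed for the identities for \<open>W\<^sup>-\<close>: if \<open>N\<close> belongs to the
  species but \<open>\<tau> \<cdot> N\<close> does not, then \<open>N\<close> still contributes to \<open>W\<^sup>+\<^sub>2\<close> although no
  \<open>\<tau>\<close>-symmetric parallel composition over the species has \<open>N\<close> as a component.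
\<close>

definition tau_closed :: "network set \<Rightarrow> bool" where
  "tau_closed \<N> \<longleftrightarrow> (\<forall>N\<in>\<N>. graph_image swap_poles N \<in> \<N>)"


section \<open>Networks with blocks and their edge index series\<close>

text \<open>
  A network together with a set of blocks of internal vertices, which isomorphisms have to respect.
  A network without additional structure is one with no blocks, see \<open>plain\<close> below.
\<close>

type_synonym bnetwork = "network \<times> nat set set"

definition relabel :: "(nat \<Rightarrow> nat) \<Rightarrow> bnetwork \<Rightarrow> bnetwork" where
  "relabel f = (\<lambda>(G, P). (graph_image (map_vertex f) G, (`) f ` P))"

definition tau :: "bnetwork \<Rightarrow> bnetwork" where
  "tau = (\<lambda>(G, P). (graph_image swap_poles G, P))"

definition isomorphic :: "bnetwork \<Rightarrow> bnetwork \<Rightarrow> bool" where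
  "isomorphic N N' \<longleftrightarrow>
     (\<exists>f. bij_betw f (internals (fst N)) (internals (fst N')) \<and> relabel f N = N')"

definition tau_symmetric :: "bnetwork \<Rightarrow> bool" where
  "tau_symmetric N \<longleftrightarrow> isomorphic (tau N) N"

definition Aut_plus :: "bnetwork \<Rightarrow> (nat \<Rightarrow> nat) set" where
  "Aut_plus N = {\<sigma>. \<sigma> permutes internals (fst N) \<and> relabel \<sigma> N = N}"

definition Aut_minus :: "bnetwork \<Rightarrow> (nat \<Rightarrow> nat) set" where
  "Aut_minus N = {\<sigma>. \<sigma> permutes internals (fst N) \<and> tau (relabel \<sigma> N) = N}"

text \<open>
  The poles contribute the factor \<open>a\<^sub>1\<^sup>2\<close>, respectively \<open>a\<^sub>2\<close>, which is divided out; so the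
  differences of multisets are exact.
\<close>

definition weight_plus :: "bnetwork \<Rightarrow> (nat \<Rightarrow> nat) \<Rightarrow> ivar multiset" where
  "weight_plus N \<sigma> = weight (fst N) (map_vertex \<sigma>) - {#ivar.a 1, ivar.a 1#}"

definition weight_minus :: "bnetwork \<Rightarrow> (nat \<Rightarrow> nat) \<Rightarrow> ivar multiset" where
  "weight_minus N \<sigma> = weight (fst N) (swap_poles \<circ> map_vertex \<sigma>) - {#ivar.a 2#}"

definition iso_classes :: "bnetwork set \<Rightarrow> bnetwork set set" where
  "iso_classes S = S // {(N, N'). N \<in> S \<and> N' \<in> S \<and> isomorphic N N'}"

definition representatives :: "bnetwork set \<Rightarrow> bnetwork set" where
  "representatives S = (\<lambda>C. SOME N. N \<in> C) ` iso_classes S"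

definition W_plus :: "bnetwork set \<Rightarrow> ivar mseries" where
  "W_plus S = formal_sum
     (\<lambda>N. scale (1 / of_nat (card (Aut_plus N))) (\<Sum>\<sigma>\<in>Aut_plus N. monomial 1 (weight_plus N \<sigma>)))
     (representatives S)"

text \<open>For a \<open>\<tau>\<close>-symmetric network the sets \<open>Aut_plus\<close> and \<open>Aut_minus\<close> have the same cardinality.\<close>

definition W_minus :: "bnetwork set \<Rightarrow> ivar mseries" where
  "W_minus S = formal_sum
     (\<lambda>N. scale (1 / of_nat (card (Aut_minus N))) (\<Sum>\<sigma>\<in>Aut_minus N. monomial 1 (weight_minus N \<sigma>)))
     (representatives {N \<in> S. tau_symmetric N})"

definition plain :: "network set \<Rightarrow> bnetwork set" where
  "plain \<N> = (\<lambda>N. (N, {})) ` \<N>"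


section \<open>Parallel composition\<close>

text \<open>
  All networks share the vertices \<open>Pole0\<close> and \<open>Pole1\<close>, so taking the union of the graphs merges
  the poles.
\<close>

definition parallel :: "network set \<Rightarrow> bnetwork" where
  "parallel X =
     (Graph ({Pole0, Pole1} \<union> \<Union> (verts ` X)) (\<Union> (edges ` X)), internals ` X)"

definition composable :: "network set \<Rightarrow> bool" where
  "composable X \<longleftrightarrow> finite X \<and> pairwise (\<lambda>M N. internals M \<inter> internals N = {}) X"

definition E :: "network set \<Rightarrow> bnetwork set" where
  "E \<N> = {parallel X | X. X \<subseteq> \<N> \<and> composable X}"

definition E2 :: "network set \<Rightarrow> bnetwork set" where
  "E2 \<N> = {parallel X | X. X \<subseteq> \<N> \<and> composable X \<and> card X = 2}"

end

theory Submission
  imports Defs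
begin

text \<open>
  By the orbit-stabilizer theorem, an edge index series is the exponential generating series of the
  pairs of a labelled network and an automorphism. An automorphism of a parallel composition
  permutes its components, so that such a pair is a set of disjoint pairs in which the automorphism
  permutes the components transitively; hence the series is the exponential of the series \<open>C\<close> of
  the latter. If a cycle has \<open>m\<close> components, distinguish one of them, \<open>N\<close>. The \<open>m\<close>-th power of the
  automorphism restricts to an automorphism of \<open>N\<close>, which exchanges the poles iff the given one
  does and \<open>m\<close> is odd; every vertex or edge cycle of this restriction is stretched by the factor
  \<open>m\<close>, and cylindrical and Moebius cycles stay so. Since the bijections between consecutive
  components are arbitrary, \<open>C\<close> is the sum of the \<open>W\<^sup>\<plusminus>\<^sub>m / m\<close>. A composition of two components consists
  of two cycles of length one or of one cycle of length two.
\<close>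


section \<open>Series and labelled enumeration\<close>

text \<open>All components share the poles, so weights become additive over components only when the
  cycles of the poles are removed. Edges at a pole remain; each belongs to a single component,
  because the poles are non-adjacent and every edge therefore has an internal endpoint. Being
  non-trivial, every component has an internal vertex; hence disjoint label sets make components
  distinct and bound their number, which keeps all sums finite on a given label set. The
  normalization by factorials absorbs the cycles exactly. With n = m k labels, the k labels of the
  distinguished component are chosen in binomial(n, k) ways, they carry k! [M'] W pairs of weight
  M', and the bijections to the other blocks contribute (n - k)!; the product is n! [M'] W.
  Distinguishing a component multiplies a count by m, and distinguishing one of k cycles multiplies
  it by k: these are the sources of 1/m and of the 1/k! in the exponential. If an automorphism
  exchanges the poles, its odd powers carry N to copies of its mirror image; this is where closure
  under exchanging the poles enters for W-.\<close>

lemma coeff_plus: "coeff (f + g) M = coeff f M + coeff g M"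
  by (simp add: plus_mseries_def)

lemma coeff_scale: "coeff (scale r f) M = r * coeff f M"
  by (simp add: scale_def)

lemma coeff_one: "coeff 1 M = (if M = {#} then 1 else 0)"
  by (simp add: one_mseries_def)

lemma coeff_monomial: "coeff (monomial r M) M' = (if M' = M then r else 0)"
  by (simp add: monomial_def)

lemma coeff_times: "coeff (f * g) M = (\<Sum>(p, q)\<in>splits M. coeff f p * coeff g q)"
  by (simp add: times_mseries_def)

lemma coeff_sum: "coeff (\<Sum>i\<in>I. f i) M = (\<Sum>i\<in>I. coeff (f i) M)"
  by (induction I rule: infinite_finite_induct) (simp_all add: coeff_plus zero_mseries_def)

text \<open>\<open>formal_sum\<close> runs over exactly the nonzero terms, a set that depends on the
  monomial; any finite index set containing them gives the same sum and is easier to name.\<close>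

lemma coeff_formal_sum_finite:
  assumes "finite A" "A \<subseteq> I" "\<And>i. i \<in> I \<Longrightarrow> i \<notin> A \<Longrightarrow> coeff (F i) M = 0"
  shows "coeff (formal_sum F I) M = (\<Sum>i\<in>A. coeff (F i) M)"
  unfolding formal_sum_def coeff_MSeries
  by (rule sum.mono_neutral_left) (use assms in auto)

lemma formal_sum_cong:
  "(\<And>i. i \<in> I \<Longrightarrow> F i = G i) \<Longrightarrow> formal_sum F I = formal_sum G I"
  by (rule mseries_eqI) (auto simp: formal_sum_def intro!: sum.cong)

lemma scale_scale: "scale r (scale s f) = scale (r * s) f"
  by (rule mseries_eqI) (simp add: coeff_scale)

lemma scale_times: "f * scale r g = scale r (f * g)"
  by (rule mseries_eqI)
    (simp add: coeff_scale coeff_times sum_distrib_left case_prod_unfold mult.left_commute)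

lemma scale_plus: "scale r (f + g) = scale r f + scale r g"
  by (rule mseries_eqI) (simp add: coeff_scale coeff_plus distrib_left)

lemma scale_one: "scale 1 f = f"
  by (rule mseries_eqI) (simp add: coeff_scale)

lemma inj_index_times: "1 \<le> m \<Longrightarrow> inj (index_times m)"
proof (rule injI)
  fix x y assume "1 \<le> m" "index_times m x = index_times m y"
  then show "x = y" by (cases x; cases y) auto
qed

text \<open>For m \<ge> 1 the substitution of variables is injective on monomials, so a single
  monomial of \<open>f\<close> is sent to the given one.\<close>

lemma coeff_dilate_image:
  assumes "1 \<le> m"
  shows "coeff (dilate m f) (image_mset (index_times m) M) = coeff f M"
proof -
  have "image_mset (index_times m) M = image_mset (index_times m) M' \<longleftrightarrow> M = M'" for M'
    using multiset.inj_map[OF inj_index_times[OF assms]] by (auto dest: injD)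
  then show ?thesis unfolding dilate_def
    by (subst coeff_formal_sum_finite[where A = "{M}"]) (auto simp: coeff_monomial)
qed

lemma coeff_dilate_not_image:
  assumes "M \<notin> range (image_mset (index_times m))"
  shows "coeff (dilate m f) M = 0"
  unfolding dilate_def
  by (subst coeff_formal_sum_finite[where A = "{}"]) (use assms in \<open>auto simp: coeff_monomial\<close>)

lemma dilate_1: "dilate 1 f = f"
proof (rule mseries_eqI)
  fix M
  have "index_times 1 v = v" for v by (cases v) auto
  then have "index_times 1 = id" by auto
  then show "coeff (dilate 1 f) M = coeff f M"
    using coeff_dilate_image[of 1 f M] by simp
qed

text \<open>The number of internal vertices, as recorded by the weight of an automorphism.\<close>

definition deg :: "ivar multiset \<Rightarrow> nat" where
  "deg M = (\<Sum>v\<in>#M. case v of ivar.a k \<Rightarrow> k | _ \<Rightarrow> 0)"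

lemma deg_plus [simp]: "deg (M + N) = deg M + deg N"
  by (simp add: deg_def)

lemma deg_empty [simp]: "deg {#} = 0"
  by (simp add: deg_def)

lemma deg_image_index_times: "deg (image_mset (index_times m) M) = m * deg M"
proof (induction M)
  case (add v M)
  then show ?case by (cases v) (auto simp: deg_def distrib_left)
qed simp

text \<open>
  The number of structures of weight \<open>M\<close> on a label set \<open>U\<close> depends on \<open>card U\<close> only, and \<open>f\<close> is the
  exponential generating series of these numbers. The number of labels needs no variable of
  its own, since \<open>deg\<close> recovers it from the weight.
\<close>

definition enumerates ::
    "(nat set \<Rightarrow> 's set) \<Rightarrow> ('s \<Rightarrow> ivar multiset) \<Rightarrow> ivar mseries \<Rightarrow> bool" where
  "enumerates F w f \<longleftrightarrow> (\<forall>U. finite U \<longrightarrow> finite (F U) \<and>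
     (\<forall>M. of_nat (card {s \<in> F U. w s = M}) =
        (if card U = deg M then fact (card U) * coeff f M else 0)))"

text \<open>Once every structure on U has degree \<open>card U\<close>, the counts for all other
  degrees are zero and only the matching case needs a computation.\<close>

lemma enumeratesI:
  assumes "\<And>U. finite U \<Longrightarrow> finite (F U)"
    and "\<And>U s. finite U \<Longrightarrow> s \<in> F U \<Longrightarrow> deg (w s) = card U"
    and "\<And>U M. finite U \<Longrightarrow> card U = deg M \<Longrightarrow>
      of_nat (card {s \<in> F U. w s = M}) = (fact (card U) * coeff f M)"
  shows "enumerates F w f"
  unfolding enumerates_def
proof (intro allI impI conjI)
  fix U :: "nat set" and M assume U: "finite U"
  show "finite (F U)" using assms(1) U .
  show "of_nat (card {s \<in> F U. w s = M}) =
        (if card U = deg M then fact (card U) * coeff f M else 0)"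
  proof (cases "card U = deg M")
    case False
    then have "{s \<in> F U. w s = M} = {}" using assms(2)[OF U] by fastforce
    then have "card {s \<in> F U. w s = M} = 0" by (metis card.empty)
    then show ?thesis using False by simp
  qed (use assms(3)[OF U] in simp)
qed

lemma enumerates_finite: "enumerates F w f \<Longrightarrow> finite U \<Longrightarrow> finite (F U)"
  by (simp add: enumerates_def)

lemma enumerates_card:
  "enumerates F w f \<Longrightarrow> finite U \<Longrightarrow> of_nat (card {s \<in> F U. w s = M}) =
     (if card U = deg M then fact (card U) * coeff f M else 0)"
  by (simp add: enumerates_def)

text \<open>A structure of the wrong degree would belong to a set whose cardinality the definition
  declares to be zero.\<close>

lemma enumerates_deg:
  assumes "enumerates F w f" "finite U" "s \<in> F U"
  shows "deg (w s) = card U"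
proof (rule ccontr)
  assume "deg (w s) \<noteq> card U"
  then have "card {t \<in> F U. w t = w s} = 0"
    using enumerates_card[OF assms(1,2), of "w s"] by (simp split: if_splits)
  then show False using assms enumerates_finite[OF assms(1,2)] by auto
qed

text \<open>Counting on a label set of size \<open>deg M\<close> determines the coefficient of M.
  Identities between series are thus obtained by enumerating the same structures in two
  ways.\<close>

lemma enumerates_unique:
  assumes "enumerates F w f" "enumerates F w g"
  shows "f = g"
proof (rule mseries_eqI)
  fix M
  show "coeff f M = coeff g M"
    using enumerates_card[OF assms(1), of "{..<deg M}" M]
      enumerates_card[OF assms(2), of "{..<deg M}" M] by simp
qed

lemma enumerates_bij:
  assumes "enumerates G w' f"
    and "\<And>U. finite U \<Longrightarrow> bij_betw j (F U) (G U)"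
    and "\<And>U s. finite U \<Longrightarrow> s \<in> F U \<Longrightarrow> w' (j s) = w s"
  shows "enumerates F w f"
  unfolding enumerates_def
proof (intro allI impI conjI)
  fix U :: "nat set" and M assume U: "finite U"
  show "finite (F U)"
    using enumerates_finite[OF assms(1) U] bij_betw_finite[OF assms(2)[OF U]] by simp
  have "bij_betw j {s \<in> F U. w s = M} {s \<in> G U. w' s = M}"
    by (rule bij_betw_Collect[OF assms(2)[OF U]]) (simp add: assms(3)[OF U])
  then have "card {s \<in> F U. w s = M} = card {s \<in> G U. w' s = M}"
    by (rule bij_betw_same_card)
  then show "of_nat (card {s \<in> F U. w s = M}) =
      (if card U = deg M then fact (card U) * coeff f M else 0)"
    using enumerates_card[OF assms(1) U] by simp
qed

section \<open>Sums, products and marking of labelled structures\<close>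

lemma enumerates_formal_sum:
  assumes "\<And>i. i \<in> I \<Longrightarrow> enumerates (F i) w (f i)"
    and "\<And>U. finite U \<Longrightarrow> finite {i \<in> I. F i U \<noteq> {}}"
    and "\<And>U i j. finite U \<Longrightarrow> i \<in> I \<Longrightarrow> j \<in> I \<Longrightarrow> i \<noteq> j \<Longrightarrow> F i U \<inter> F j U = {}"
  shows "enumerates (\<lambda>U. \<Union>i\<in>I. F i U) w (formal_sum f I)"
proof (rule enumeratesI)
  fix U :: "nat set" assume U: "finite U"
  have eq: "(\<Union>i\<in>I. F i U) = (\<Union>i\<in>{i \<in> I. F i U \<noteq> {}}. F i U)" by auto
  show "finite (\<Union>i\<in>I. F i U)" unfolding eq
    by (rule finite_UN_I) (use assms(2)[OF U] enumerates_finite[OF assms(1) U] in auto)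
  fix s assume "s \<in> (\<Union>i\<in>I. F i U)"
  then show "deg (w s) = card U" using enumerates_deg[OF assms(1) U] by auto
next
  fix U :: "nat set" and M assume U: "finite U" and M: "card U = deg M"
  let ?A = "{i \<in> I. F i U \<noteq> {}}"
  have eq: "{s \<in> \<Union>i\<in>I. F i U. w s = M} = (\<Union>i\<in>?A. {s \<in> F i U. w s = M})" by auto
  \<comment> \<open>An index without structures on U has count zero there; as
    \<open>card U = deg M\<close>, this forces its coefficient to vanish, and the formal sum reduces
    to the finite set \<open>?A\<close>.\<close>
  have 0: "coeff (f i) M = 0" if "i \<in> I" "i \<notin> ?A" for i
    using enumerates_card[OF assms(1)[OF that(1)] U, of M] that M by simp
  have "card {s \<in> \<Union>i\<in>I. F i U. w s = M} = (\<Sum>i\<in>?A. card {s \<in> F i U. w s = M})"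
    unfolding eq using assms(2)[OF U] enumerates_finite[OF assms(1) U] assms(3)[OF U]
    by (intro card_UN_disjoint ballI impI) (simp_all add: disjoint_iff, metis)
  then have "of_nat (card {s \<in> \<Union>i\<in>I. F i U. w s = M})
      = (\<Sum>i\<in>?A. of_nat (card {s \<in> F i U. w s = M}) :: rat)" by simp
  also have "\<dots> = (\<Sum>i\<in>?A. fact (card U) * coeff (f i) M)"
    by (rule sum.cong) (use enumerates_card[OF assms(1) U] M in auto)
  also have "\<dots> = fact (card U) * coeff (formal_sum f I) M"
    by (subst coeff_formal_sum_finite[where A = ?A])
      (use assms(2)[OF U] 0 in \<open>auto simp: sum_distrib_left\<close>)
  finally show "of_nat (card {s \<in> \<Union>i\<in>I. F i U. w s = M}) = (fact (card U) * coeff (formal_sum f I) M)" .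
qed

lemma enumerates_plus:
  assumes F: "enumerates F w f" and G: "enumerates G w g"
    and disj: "\<And>U. finite U \<Longrightarrow> F U \<inter> G U = {}"
  shows "enumerates (\<lambda>U. F U \<union> G U) w (f + g)"
proof (rule enumeratesI)
  fix U :: "nat set" assume U: "finite U"
  show "finite (F U \<union> G U)" using enumerates_finite[OF F U] enumerates_finite[OF G U] by simp
  fix s assume "s \<in> F U \<union> G U"
  then show "deg (w s) = card U" using enumerates_deg[OF F U] enumerates_deg[OF G U] by auto
next
  fix U :: "nat set" and M assume U: "finite U" and M: "card U = deg M"
  have "{s \<in> F U \<union> G U. w s = M} = {s \<in> F U. w s = M} \<union> {s \<in> G U. w s = M}" by auto
  also have "card \<dots> = card {s \<in> F U. w s = M} + card {s \<in> G U. w s = M}"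
    by (rule card_Un_disjoint)
      (use enumerates_finite[OF F U] enumerates_finite[OF G U] disj[OF U] in auto)
  finally show "of_nat (card {s \<in> F U \<union> G U. w s = M}) = (fact (card U) * coeff (f + g) M)"
    using enumerates_card[OF F U, of M] enumerates_card[OF G U, of M] M
    by (simp add: coeff_plus distrib_left)
qed

text \<open>The product rule for exponential generating series: the choice of the labels V of the
  first factor yields the binomial coefficient that turns the two factorials into the factorial of
  \<open>card U\<close>.\<close>

lemma enumerates_times:
  assumes F: "enumerates F u f" and G: "enumerates G v g"
  shows "enumerates (\<lambda>U. {(V, s, t). V \<subseteq> U \<and> s \<in> F V \<and> t \<in> G (U - V)})
    (\<lambda>(V, s, t). u s + v t) (f * g)"
proof (rule enumeratesI)
  fix U :: "nat set" assume U: "finite U"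
  have eq: "{(V, s, t). V \<subseteq> U \<and> s \<in> F V \<and> t \<in> G (U - V)} = (SIGMA V:Pow U. F V \<times> G (U - V))"
    by auto
  show "finite {(V, s, t). V \<subseteq> U \<and> s \<in> F V \<and> t \<in> G (U - V)}" unfolding eq
    by (intro finite_SigmaI finite_cartesian_product)
      (use U enumerates_finite[OF F finite_subset[OF _ U]] enumerates_finite[OF G] in auto)
  fix x assume "x \<in> {(V, s, t). V \<subseteq> U \<and> s \<in> F V \<and> t \<in> G (U - V)}"
  then obtain V s t where x: "x = (V, s, t)" "V \<subseteq> U" "s \<in> F V" "t \<in> G (U - V)" by auto
  then have "deg (u s) = card V" "deg (v t) = card (U - V)"
    using enumerates_deg[OF F finite_subset[OF _ U]] enumerates_deg[OF G, of "U - V"] U by auto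
  then show "deg (case x of (V, s, t) \<Rightarrow> u s + v t) = card U"
    using x U by (simp add: card_Diff_subset card_mono finite_subset)
next
  fix U :: "nat set" and M assume U: "finite U" and M: "card U = deg M"
  have fin: "finite V" if "V \<in> Pow U" for V using that U finite_subset by auto
  have eq: "{x \<in> {(V, s, t). V \<subseteq> U \<and> s \<in> F V \<and> t \<in> G (U - V)}. (case x of (V, s, t) \<Rightarrow> u s + v t) = M}
      = (SIGMA V:Pow U. \<Union>(p, q)\<in>splits M. {s \<in> F V. u s = p} \<times> {t \<in> G (U - V). v t = q})"
    by (auto simp: splits_def)
  have "card (\<Union>(p, q)\<in>splits M. {s \<in> F V. u s = p} \<times> {t \<in> G (U - V). v t = q})
      = (\<Sum>(p, q)\<in>splits M. card {s \<in> F V. u s = p} * card {t \<in> G (U - V). v t = q})"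
    if "V \<in> Pow U" for V
  proof (subst card_UN_disjoint)
    show "\<forall>i\<in>splits M. finite (case i of (p, q) \<Rightarrow> {s \<in> F V. u s = p} \<times> {t \<in> G (U - V). v t = q})"
      using enumerates_finite[OF F fin[OF that]] enumerates_finite[OF G, of "U - V"] U by auto
  qed (auto simp: case_prod_unfold card_cartesian_product)
  moreover have "finite (\<Union>(p, q)\<in>splits M. {s \<in> F V. u s = p} \<times> {t \<in> G (U - V). v t = q})"
    if "V \<in> Pow U" for V
    using that U enumerates_finite[OF F fin[OF that]] enumerates_finite[OF G, of "U - V"] by auto
  ultimately have "card {x \<in> {(V, s, t). V \<subseteq> U \<and> s \<in> F V \<and> t \<in> G (U - V)}.
        (case x of (V, s, t) \<Rightarrow> u s + v t) = M} =
      (\<Sum>V\<in>Pow U. \<Sum>(p, q)\<in>splits M. card {s \<in> F V. u s = p} * card {t \<in> G (U - V). v t = q})"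
    unfolding eq using U by (subst card_SigmaI) auto
  also have "\<dots> = (\<Sum>x\<in>splits M. \<Sum>V\<in>Pow U.
      card {s \<in> F V. u s = fst x} * card {t \<in> G (U - V). v t = snd x})"
    by (subst sum.swap) (simp add: case_prod_unfold)
  finally have "of_nat (card {x \<in> {(V, s, t). V \<subseteq> U \<and> s \<in> F V \<and> t \<in> G (U - V)}.
        (case x of (V, s, t) \<Rightarrow> u s + v t) = M}) = (\<Sum>x\<in>splits M. \<Sum>V\<in>Pow U.
      of_nat (card {s \<in> F V. u s = fst x}) * of_nat (card {t \<in> G (U - V). v t = snd x}) :: rat)"
    by simp
  also have "\<dots> = (\<Sum>x\<in>splits M. fact (card U) * (coeff f (fst x) * coeff g (snd x)))"
  proof (rule sum.cong[OF refl])
    fix x assume "x \<in> splits M"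
    \<comment> \<open>Degrees add over a splitting of M, so a set V of \<open>deg (fst x)\<close>
      labels leaves exactly as many as the second factor requires; every other V contributes
      zero.\<close>
    then have x: "deg (fst x) + deg (snd x) = card U" using M by (auto simp: splits_def)
    have "(\<Sum>V\<in>Pow U.
          of_nat (card {s \<in> F V. u s = fst x}) * of_nat (card {t \<in> G (U - V). v t = snd x}) :: rat)
        = (\<Sum>V\<in>Pow U. if card V = deg (fst x) then
            fact (deg (fst x)) * fact (deg (snd x)) * (coeff f (fst x) * coeff g (snd x)) else 0)"
    proof (rule sum.cong[OF refl])
      fix V assume V: "V \<in> Pow U"
      then have "card (U - V) = card U - card V" "card V \<le> card U"
        using U by (auto simp: card_Diff_subset fin card_mono)
      then have "card (U - V) = deg (snd x)" if "card V = deg (fst x)" using that x by simp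
      then show "(of_nat (card {s \<in> F V. u s = fst x}) * of_nat (card {t \<in> G (U - V). v t = snd x}) :: rat)
          = (if card V = deg (fst x) then
            fact (deg (fst x)) * fact (deg (snd x)) * (coeff f (fst x) * coeff g (snd x)) else 0)"
        using enumerates_card[OF F fin[OF V], of "fst x"]
          enumerates_card[OF G, of "U - V" "snd x"] U by simp
    qed
    also have "\<dots> = of_nat (card {V \<in> Pow U. card V = deg (fst x)}) *
        (fact (deg (fst x)) * fact (deg (snd x)) * (coeff f (fst x) * coeff g (snd x)))"
      using U by (simp add: sum.If_cases Int_def)
    also have "card {V \<in> Pow U. card V = deg (fst x)} = card U choose deg (fst x)"
      using n_subsets[OF U, of "deg (fst x)"] by (simp add: Pow_def)
    also have "of_nat (card U choose deg (fst x)) *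
        (fact (deg (fst x)) * fact (deg (snd x)) * (coeff f (fst x) * coeff g (snd x)))
        = fact (card U) * (coeff f (fst x) * coeff g (snd x))"
    proof -
      have "card U - deg (fst x) = deg (snd x)" "deg (fst x) \<le> card U" using x by auto
      then have "of_nat (card U choose deg (fst x)) * (fact (deg (fst x)) * fact (deg (snd x)))
          = (fact (card U) :: rat)"
        by (simp add: binomial_fact)
      then show ?thesis by (simp add: mult.assoc[symmetric])
    qed
    finally show "(\<Sum>V\<in>Pow U.
          of_nat (card {s \<in> F V. u s = fst x}) * of_nat (card {t \<in> G (U - V). v t = snd x}) :: rat)
        = fact (card U) * (coeff f (fst x) * coeff g (snd x))" .
  qed
  also have "\<dots> = fact (card U) * coeff (f * g) M"
    by (simp add: coeff_times sum_distrib_left case_prod_unfold)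
  finally show "of_nat (card {x \<in> {(V, s, t). V \<subseteq> U \<and> s \<in> F V \<and> t \<in> G (U - V)}.
      (case x of (V, s, t) \<Rightarrow> u s + v t) = M}) = (fact (card U) * coeff (f * g) M)" .
qed

text \<open>Each structure occurs once for each of its m marks, and the weight ignores the mark. The
  rule serves twice: for marking a component of a cycle and for marking a cycle of a
  composition.\<close>

lemma enumerates_marked:
  assumes en: "enumerates (\<lambda>U. SIGMA s:F U. A s) (w \<circ> fst) g"
    and A: "\<And>U s. finite U \<Longrightarrow> s \<in> F U \<Longrightarrow> card (A s) = m" and m: "1 \<le> m"
  shows "enumerates F w (scale (1 / of_nat m) g)"
proof (rule enumeratesI)
  fix U :: "nat set" assume U: "finite U"
  have ne: "A s \<noteq> {}" "finite (A s)" if "s \<in> F U" for s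
    using A[OF U that] m by (auto intro: card_ge_0_finite)
  then have "F U = fst ` (SIGMA s:F U. A s)" by force
  then show fin: "finite (F U)" using enumerates_finite[OF en U] by (metis finite_imageI)
  show "deg (w s) = card U" if s: "s \<in> F U" for s
  proof -
    obtain x where "x \<in> A s" using ne[OF s] by auto
    then show ?thesis using enumerates_deg[OF en U, of "(s, x)"] s by simp
  qed
  fix M assume M: "card U = deg M"
  have "{x \<in> (SIGMA s:F U. A s). (w \<circ> fst) x = M} = (SIGMA s:{s \<in> F U. w s = M}. A s)" by auto
  then have "card {x \<in> (SIGMA s:F U. A s). (w \<circ> fst) x = M} = (\<Sum>s\<in>{s \<in> F U. w s = M}. card (A s))"
    using fin ne(2) by (simp add: card_SigmaI)
  also have "\<dots> = m * card {s \<in> F U. w s = M}" using A[OF U] by simp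
  finally have "of_nat m * of_nat (card {s \<in> F U. w s = M}) = fact (card U) * coeff g M"
    using enumerates_card[OF en U, of M] M by (metis of_nat_mult)
  then show "of_nat (card {s \<in> F U. w s = M}) = fact (card U) * coeff (scale (1 / of_nat m) g) M"
    using m by (simp add: coeff_scale field_simps)
qed

section \<open>Orbits and weights\<close>

lemma funpow_intertwine:
  assumes "\<And>x. x \<in> S \<Longrightarrow> h x \<in> S" "\<And>x. x \<in> S \<Longrightarrow> k (g x) = g (h x)" "x \<in> S"
  shows "(k ^^ n) (g x) = g ((h ^^ n) x) \<and> (h ^^ n) x \<in> S"
  by (induction n) (use assms in auto)

lemma orbit_intertwine:
  assumes "\<And>x. x \<in> S \<Longrightarrow> h x \<in> S" "\<And>x. x \<in> S \<Longrightarrow> k (g x) = g (h x)" "x \<in> S"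
  shows "orbit k (g x) = g ` orbit h x"
  using funpow_intertwine[of S h k g x, OF assms] by (auto simp: orbit_altdef)

lemma orbit_cong_on:
  assumes "\<And>x. x \<in> S \<Longrightarrow> h x \<in> S" "\<And>x. x \<in> S \<Longrightarrow> k x = h x" "x \<in> S"
  shows "orbit k x = orbit h x"
  using orbit_intertwine[of S h k id x] assms by simp

lemma orbit_subset_closed:
  assumes "\<And>x. x \<in> S \<Longrightarrow> h x \<in> S" "x \<in> S"
  shows "orbit h x \<subseteq> S"
  using funpow_intertwine[of S h h id x] assms by (auto simp: orbit_altdef)

text \<open>A map of a finite set onto itself is injective. The restriction makes facts about
  permutations available for maps such as the image map on edges, which need not be a permutation of
  finite support.\<close>

lemma perm_restrict_permutes:
  assumes "finite S" "h ` S = S"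
  shows "perm_restrict h S permutes S"
proof (rule bij_imp_permutes)
  have "inj_on h S" using assms by (simp add: eq_card_imp_inj_on)
  then show "bij_betw (perm_restrict h S) S S"
    using assms by (auto simp: bij_betw_def inj_on_def perm_restrict_def)
qed (simp add: perm_restrict_def)

lemma orbit_perm_restrict:
  assumes "h ` S = S" "x \<in> S"
  shows "orbit (perm_restrict h S) x = orbit h x"
  by (rule orbit_cong_on[of S]) (use assms in \<open>auto simp: perm_restrict_def\<close>)

text \<open>\<open>orbit\<close> collects the images under positive powers only, so that a point
  lies in its own orbit is a statement about recurrence; it holds because \<open>h\<close> permutes
  the finite set S.\<close>

lemma self_in_orbit:
  assumes "finite S" "h ` S = S" "x \<in> S"
  shows "x \<in> orbit h x"
  using permutation_self_in_orbit[of "perm_restrict h S" x] perm_restrict_permutes[OF assms(1,2)]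
    orbit_perm_restrict[OF assms(2,3)] assms(1) by (auto simp: permutation_permutes)

lemma orbit_eq_of_mem:
  assumes "finite S" "h ` S = S" "x \<in> S" "y \<in> orbit h x"
  shows "orbit h y = orbit h x"
  using self_in_orbit[OF assms(1-3)] assms(4) by (meson cyclic_on_alldef cyclic_on_orbit' cyclic_on_def orbit_cyclic_eq3)

lemma mem_orbit_funpow:
  assumes "finite S" "h ` S = S" "x \<in> S"
  shows "(h ^^ n) x \<in> orbit h x"
  using self_in_orbit[OF assms] by (rule funpow_in_orbit)

lemma orbit_image_self:
  assumes "x \<in> orbit h x"
  shows "h ` orbit h x = orbit h x"
proof
  show "h ` orbit h x \<subseteq> orbit h x" by (auto intro: orbit.intros)
  show "orbit h x \<subseteq> h ` orbit h x"
  proof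
    fix y assume "y \<in> orbit h x"
    then show "y \<in> h ` orbit h x"
      by cases (use assms in auto)
  qed
qed

lemma orbits_disjoint:
  assumes "finite S" "h ` S = S" "x \<in> S" "y \<in> S" "orbit h x \<noteq> orbit h y"
  shows "orbit h x \<inter> orbit h y = {}"
  using orbit_eq_of_mem[OF assms(1,2)] assms by blast

lemma Union_orbits:
  assumes "finite S" "h ` S = S"
  shows "\<Union> (orbit h ` S) = S"
  using self_in_orbit[OF assms] orbit_subset_closed[of S h] assms by blast

lemma sum_card_orbits:
  assumes "finite S" "h ` S = S"
  shows "(\<Sum>C\<in>orbit h ` S. card C) = card S"
proof -
  have "card (\<Union> (orbit h ` S)) = (\<Sum>C\<in>orbit h ` S. card C)"
  proof (rule card_Union_disjoint)
    show "pairwise disjnt (orbit h ` S)"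
      using orbits_disjoint[OF assms] by (auto simp: pairwise_def disjnt_def)
    show "finite C" if "C \<in> orbit h ` S" for C
      using that Union_orbits[OF assms] assms(1) by (auto intro: finite_subset)
  qed
  then show ?thesis by (simp add: Union_orbits[OF assms])
qed

text \<open>The length of the cycle is \<open>funpow_dist1 h x x\<close>, the least positive
  exponent that returns x to itself, and it is identified with the cardinality of the orbit.\<close>

lemma orbit_cycle:
  assumes "x \<in> orbit h x" "card (orbit h x) = m"
  shows "orbit h x = (\<lambda>i. (h ^^ i) x) ` {..<m}" "inj_on (\<lambda>i. (h ^^ i) x) {..<m}" "(h ^^ m) x = x"
proof -
  let ?d = "funpow_dist1 h x x"
  have 1: "orbit h x = (\<lambda>i. (h ^^ i) x) ` {0..<?d}" by (rule orbit_conv_funpow_dist1[OF assms(1)])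
  have 2: "inj_on (\<lambda>i. (h ^^ i) x) {0..<?d}" by (rule inj_on_funpow_dist1[OF assms(1)])
  have "m = ?d" using assms(2) card_image[OF 2] 1 by simp
  then show "orbit h x = (\<lambda>i. (h ^^ i) x) ` {..<m}" "inj_on (\<lambda>i. (h ^^ i) x) {..<m}" "(h ^^ m) x = x"
    using 1 2 funpow_dist1_prop[OF assms(1)] by (auto simp: atLeast0LessThan)
qed

lemma orbit_of_cycle:
  assumes "(h ^^ m) x = x" "1 \<le> m"
  shows "orbit h x = (\<lambda>i. (h ^^ i) x) ` {..<m}"
proof
  show "orbit h x \<subseteq> (\<lambda>i. (h ^^ i) x) ` {..<m}"
  proof
    fix y assume "y \<in> orbit h x"
    then obtain n where "y = (h ^^ n) x" by (auto simp: orbit_altdef)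
    then have "y = (h ^^ (n mod m)) x" using funpow_mod_eq[OF assms(1)] by simp
    moreover have "n mod m < m" using assms(2) by simp
    ultimately show "y \<in> (\<lambda>i. (h ^^ i) x) ` {..<m}" by blast
  qed
  show "(\<lambda>i. (h ^^ i) x) ` {..<m} \<subseteq> orbit h x"
  proof (rule image_subsetI)
    fix i
    \<comment> \<open>The exponent 0 does not occur in an orbit; adding one full turn makes every
      exponent positive.\<close>
    have "(h ^^ i) x = (h ^^ (i + m)) x" by (simp add: funpow_add assms(1))
    moreover have "0 < i + m" using assms(2) by simp
    ultimately show "(h ^^ i) x \<in> orbit h x" unfolding orbit_altdef by blast
  qed
qed

section \<open>Weights as products over cycles\<close>

text \<open>Each of the three factors of a weight has this shape; an injective map between sets of
  cycles carries one factor to another, possibly with changed variables and a translated condition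
  on the type of the cycle.\<close>

lemma image_mset_reindex:
  assumes "inj_on j X" "finite X" "\<And>C. C \<in> X \<Longrightarrow> f (j C) = f' C" "\<And>C. C \<in> X \<Longrightarrow> Q (j C) \<longleftrightarrow> Q' C"
  shows "image_mset f (mset_set {C \<in> j ` X. Q C}) = image_mset f' (mset_set {C \<in> X. Q' C})"
proof -
  have "{C \<in> j ` X. Q C} = j ` {C \<in> X. Q' C}" using assms(4) by auto
  moreover have "inj_on j {C \<in> X. Q' C}" using assms(1) by (rule inj_on_subset) auto
  ultimately have "mset_set {C \<in> j ` X. Q C} = image_mset j (mset_set {C \<in> X. Q' C})"
    by (simp add: image_mset_mset_set)
  then show ?thesis using assms(2,3)
    by (auto simp: multiset.map_comp intro!: image_mset_cong)
qed

text \<open>The edges in \<open>D\<close> may have endpoints outside \<open>V\<close>, so that the poles can be left out.\<close>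

definition wt :: "'v set \<Rightarrow> 'v set set \<Rightarrow> ('v \<Rightarrow> 'v) \<Rightarrow> ivar multiset" where
  "wt V D h =
     image_mset (\<lambda>C. ivar.a (card C)) (mset_set {C \<in> orbit h ` V. True}) +
     image_mset (\<lambda>C. ivar.b (card C)) (mset_set {C \<in> orbit ((`) h) ` D. cylindrical h C}) +
     image_mset (\<lambda>C. ivar.c (card C)) (mset_set {C \<in> orbit ((`) h) ` D. moebius h C})"

lemma weight_eq_wt: "weight G h = wt (verts G) (edges G) h"
  by (simp add: weight_def wt_def vertex_cycles_def edge_cycles_def)

lemma deg_wt:
  assumes "finite V" "h ` V = V"
  shows "deg (wt V D h) = card V"
proof -
  have "deg (image_mset (\<lambda>C. ivar.a (card C)) (mset_set X)) = (\<Sum>C\<in>X. card C)" for X :: "'a set set"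
    by (simp add: deg_def image_mset.compositionality o_def sum_unfold_sum_mset)
  moreover have "deg (image_mset (\<lambda>C. ivar.b (card C)) X) = 0" for X :: "'a set set multiset"
    by (simp add: deg_def image_mset.compositionality o_def)
  moreover have "deg (image_mset (\<lambda>C. ivar.c (card C)) X) = 0" for X :: "'a set set multiset"
    by (simp add: deg_def image_mset.compositionality o_def)
  ultimately show ?thesis by (simp add: wt_def sum_card_orbits[OF assms])
qed

lemma doubleton_imageD:
  assumes "inj g" "{u, v} = g ` e"
  obtains x y where "e = {x, y}" "u = g x" "v = g y"
proof -
  obtain x y where xy: "x \<in> e" "y \<in> e" "u = g x" "v = g y" using assms(2) by blast
  then have "g ` e = g ` {x, y}" using assms(2) by auto
  then have "e = {x, y}" using assms(1) by (metis inj_image_eq_iff)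
  then show ?thesis using xy that by blast
qed

text \<open>An injective \<open>g\<close> that intertwines the two maps sends cycles to cycles of
  the same length, and the fixing or swapping of endpoints is visible on both sides. The equation is
  required only on V and on the endpoints of D, so that \<open>g = id\<close> compares two maps that
  agree there, and a relabelling \<open>g\<close> gives invariance under isomorphism.\<close>

lemma wt_intertwine:
  assumes V: "finite V" "\<And>x. x \<in> V \<Longrightarrow> h x \<in> V"
    and D: "finite D" "\<And>e. e \<in> D \<Longrightarrow> h ` e \<in> D"
    and g: "inj g" "\<And>x. x \<in> V \<union> \<Union> D \<Longrightarrow> k (g x) = g (h x)"
  shows "wt (g ` V) ((`) g ` D) k = wt V D h"
proof -
  have A: "h x \<in> V \<union> \<Union> D" if "x \<in> V \<union> \<Union> D" for x
    using that V D by blast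
  have pow: "(k ^^ n) (g x) = g ((h ^^ n) x)" if "x \<in> V \<union> \<Union> D" for n x
    using funpow_intertwine[of "V \<union> \<Union> D" h k g x] A g that by blast
  have oV: "orbit k ` g ` V = (`) g ` orbit h ` V"
    using orbit_intertwine[of V h k g] V g by (force simp: image_iff)
  have comm: "k ` g ` e = g ` h ` e" if "e \<in> D" for e
    using g that by (force simp: image_iff)
  have oD: "orbit ((`) k) ` (`) g ` D = (`) ((`) g) ` orbit ((`) h) ` D"
    unfolding image_image
    by (rule image_cong[OF refl], rule orbit_intertwine[of D]) (use D comm in auto)
  have inj2: "inj ((`) g)" and inj3: "inj ((`) ((`) g))"
    using g by (auto simp: inj_def inj_image_eq_iff)
  have card2: "card (g ` C) = card C" for C
    using g by (auto intro: card_image inj_on_subset)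
  have card3: "card ((`) g ` C) = card C" for C
    using inj2 by (auto intro: card_image inj_on_subset)
  have CD: "C \<subseteq> D" if "C \<in> orbit ((`) h) ` D" for C
    using that orbit_subset_closed[of D "(`) h"] D by blast
  have cyl: "cylindrical k ((`) g ` C) \<longleftrightarrow> cylindrical h C" if "C \<in> orbit ((`) h) ` D" for C
  proof -
    have "(k ^^ card C) (g v) = g v \<longleftrightarrow> (h ^^ card C) v = v" if "e \<in> C" "v \<in> e" for e v
    proof -
      have "v \<in> V \<union> \<Union> D" using that CD[OF \<open>C \<in> orbit ((`) h) ` D\<close>] by auto
      then show ?thesis using pow g(1) by (simp add: inj_eq)
    qed
    then show ?thesis unfolding cylindrical_def card3 by auto
  qed
  have moe: "moebius k ((`) g ` C) \<longleftrightarrow> moebius h C" if "C \<in> orbit ((`) h) ` D" for C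
  proof
    assume L: "moebius k ((`) g ` C)"
    show "moebius h C" unfolding moebius_def
    proof (intro allI impI)
      fix u v assume uv: "{u, v} \<in> C"
      then have "{g u, g v} \<in> (`) g ` C" by (metis image_empty image_eqI image_insert)
      then have "(k ^^ card C) (g u) = g v \<and> (k ^^ card C) (g v) = g u"
        using L card3 by (metis moebius_def)
      moreover have "u \<in> V \<union> \<Union> D" "v \<in> V \<union> \<Union> D" using uv CD[OF that] by auto
      ultimately show "(h ^^ card C) u = v \<and> (h ^^ card C) v = u"
        using pow g(1) by (simp add: inj_eq)
    qed
  next
    assume R: "moebius h C"
    show "moebius k ((`) g ` C)" unfolding moebius_def card3
    proof (intro allI impI)
      fix u v assume "{u, v} \<in> (`) g ` C"
      then obtain e where e: "e \<in> C" "{u, v} = g ` e" by auto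
      obtain x y where xy: "e = {x, y}" "u = g x" "v = g y" using doubleton_imageD[OF g(1) e(2)] .
      then have "(h ^^ card C) x = y \<and> (h ^^ card C) y = x" using R e by (simp add: moebius_def)
      moreover have "x \<in> V \<union> \<Union> D" "y \<in> V \<union> \<Union> D" using e xy CD[OF that] by auto
      ultimately show "(k ^^ card C) u = v \<and> (k ^^ card C) v = u" using xy pow by simp
    qed
  qed
  have "inj_on ((`) g) X" "inj_on ((`) ((`) g)) Y" for X Y
    using inj2 inj3 by (auto intro: inj_on_subset)
  then show ?thesis unfolding wt_def oV oD
    by (intro arg_cong2[where f = "(+)"] image_mset_reindex)
      (use V D card2 card3 cyl moe in auto)
qed

lemma wt_cong:
  assumes "finite V" "\<And>x. x \<in> V \<Longrightarrow> h x \<in> V" "finite D" "\<And>e. e \<in> D \<Longrightarrow> h ` e \<in> D"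
    and "\<And>x. x \<in> V \<union> \<Union> D \<Longrightarrow> k x = h x"
  shows "wt V D k = wt V D h"
  using wt_intertwine[of V h D id k] assms by simp

lemma orbits_Un_disjoint:
  assumes "h ` A \<subseteq> A" "h ` B \<subseteq> B" "A \<inter> B = {}"
  shows "orbit h ` A \<inter> orbit h ` B = {}"
proof -
  have "C \<subseteq> A \<and> C \<subseteq> B \<and> C \<noteq> {}" if "C \<in> orbit h ` A \<inter> orbit h ` B" for C
    using that orbit_subset_closed[of A h] orbit_subset_closed[of B h] assms orbit_nonempty[of h]
    by blast
  then show ?thesis using assms(3) by blast
qed

text \<open>Invariant disjoint sets have no orbit in common. Disjointness is asked of the edges and
  not of their endpoints, since edges of different components may meet in a pole.\<close>

lemma wt_Un:
  assumes "finite V" "finite V'" "finite D" "finite D'"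
    and "h ` V \<subseteq> V" "h ` V' \<subseteq> V'" "(`) h ` D \<subseteq> D" "(`) h ` D' \<subseteq> D'"
    and "V \<inter> V' = {}" "D \<inter> D' = {}"
  shows "wt (V \<union> V') (D \<union> D') h = wt V D h + wt V' D' h"
proof -
  have *: "image_mset f (mset_set {C \<in> k ` (A \<union> B). Q C}) =
      image_mset f (mset_set {C \<in> k ` A. Q C}) + image_mset f (mset_set {C \<in> k ` B. Q C})"
    if "finite A" "finite B" "k ` A \<inter> k ` B = {}" for f Q A B and k :: "'b \<Rightarrow> 'c"
  proof -
    have "{C \<in> k ` (A \<union> B). Q C} = {C \<in> k ` A. Q C} \<union> {C \<in> k ` B. Q C}" by auto
    then show ?thesis using that by (simp add: mset_set_Union disjoint_iff)
  qed
  show ?thesis unfolding wt_def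
      *[OF assms(1,2) orbits_Un_disjoint[OF assms(5,6,9)]]
      *[OF assms(3,4) orbits_Un_disjoint[OF assms(7,8,10)]]
    by simp
qed

section \<open>Weights of maps that permute blocks cyclically\<close>

lemma image_funpow: "((`) h ^^ n) = (`) (h ^^ n)" for h :: "'a \<Rightarrow> 'a"
  by (induction n) (auto simp: image_comp o_def fun_eq_iff)

text \<open>
  The function \<open>h\<close> permutes \<open>m\<close> disjoint blocks cyclically, the first of which is \<open>S\<close>.
\<close>

definition cyclic_blocks :: "('a \<Rightarrow> 'a) \<Rightarrow> nat \<Rightarrow> 'a set \<Rightarrow> bool" where
  "cyclic_blocks h m S \<longleftrightarrow> 1 \<le> m \<and> finite S \<and> (h ^^ m) ` S = S \<and>
     (\<forall>i<m. \<forall>j<m. i \<noteq> j \<longrightarrow> (h ^^ i) ` S \<inter> (h ^^ j) ` S = {})"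

definition spread :: "('a \<Rightarrow> 'a) \<Rightarrow> nat \<Rightarrow> 'a set \<Rightarrow> 'a set" where
  "spread h m C = (\<Union>i<m. (h ^^ i) ` C)"

lemma subset_spread: "1 \<le> m \<Longrightarrow> C \<subseteq> spread h m C"
  unfolding spread_def using UN_upper[of 0 "{..<m}" "\<lambda>i. (h ^^ i) ` C"] by simp

text \<open>The map sends each block to the next, and the last one back to S because the m-th power
  preserves S.\<close>

lemma spread_closed:
  assumes "1 \<le> m" "(h ^^ m) ` S = S"
  shows "h ` spread h m S = spread h m S"
proof -
  have "h ` spread h m S = (\<Union>i<m. (h ^^ Suc i) ` S)"
    by (simp add: spread_def image_UN image_comp o_def)
  also have "\<dots> = spread h m S"
  proof
    show "(\<Union>i<m. (h ^^ Suc i) ` S) \<subseteq> spread h m S"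
    proof
      fix x assume "x \<in> (\<Union>i<m. (h ^^ Suc i) ` S)"
      then obtain i where i: "i < m" "x \<in> (h ^^ Suc i) ` S" by blast
      show "x \<in> spread h m S"
      proof (cases "Suc i = m")
        case True
        then have "x \<in> S" using i assms by simp
        then show ?thesis using subset_spread[OF assms(1), of S h] by auto
      next
        case False
        then show ?thesis using i unfolding spread_def by (metis UN_I lessThan_iff Suc_lessI)
      qed
    qed
    show "spread h m S \<subseteq> (\<Union>i<m. (h ^^ Suc i) ` S)"
    proof
      fix x assume "x \<in> spread h m S"
      then obtain i where i: "i < m" "x \<in> (h ^^ i) ` S" by (auto simp: spread_def)
      show "x \<in> (\<Union>i<m. (h ^^ Suc i) ` S)"
      proof (cases i)
        case 0
        then have "x \<in> (h ^^ Suc (m - 1)) ` S" using i assms by simp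
        moreover have "m - 1 < m" using assms by simp
        ultimately show ?thesis by blast
      next
        case (Suc j)
        then show ?thesis using i by (metis UN_I lessThan_iff Suc_lessD)
      qed
    qed
  qed
  finally show ?thesis .
qed

text \<open>Division of an exponent by m with remainder: the quotient moves x within S by powers of
  \<open>h ^^ m\<close>, the remainder selects the block.\<close>

lemma orbit_spread:
  assumes h: "cyclic_blocks h m S" and x: "x \<in> S"
  shows "orbit h x = spread h m (orbit (h ^^ m) x)"
proof
  have self: "((h ^^ m) ^^ q) x \<in> orbit (h ^^ m) x" for q
    by (rule mem_orbit_funpow[of S]) (use h x in \<open>auto simp: cyclic_blocks_def\<close>)
  show "orbit h x \<subseteq> spread h m (orbit (h ^^ m) x)"
  proof
    fix y assume "y \<in> orbit h x"
    then obtain n where n: "y = (h ^^ n) x" by (auto simp: orbit_altdef)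
    have "y = (h ^^ (n mod m + m * (n div m))) x" using n by simp
    also have "\<dots> = (h ^^ (n mod m)) (((h ^^ m) ^^ (n div m)) x)"
      unfolding funpow_add funpow_mult by simp
    finally have "y \<in> (h ^^ (n mod m)) ` orbit (h ^^ m) x" using self by blast
    moreover have "n mod m < m" using h by (simp add: cyclic_blocks_def)
    ultimately show "y \<in> spread h m (orbit (h ^^ m) x)" unfolding spread_def by blast
  qed
  show "spread h m (orbit (h ^^ m) x) \<subseteq> orbit h x"
  proof
    fix y assume "y \<in> spread h m (orbit (h ^^ m) x)"
    then obtain i q where i: "q > 0" "y = (h ^^ i) (((h ^^ m) ^^ q) x)"
      by (auto simp: spread_def orbit_altdef)
    then have "y = (h ^^ (i + m * q)) x" "i + m * q > 0"
      using h unfolding funpow_add funpow_mult by (simp_all add: cyclic_blocks_def)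
    then show "y \<in> orbit h x" unfolding orbit_altdef by blast
  qed
qed

lemma finite_spread: "finite C \<Longrightarrow> finite (spread h m C)"
  by (simp add: spread_def)

text \<open>Every point of the union of the blocks lies in the orbit of a point of S, so the orbits
  of \<open>h\<close> are already represented in the first block.\<close>

lemma orbits_spread:
  assumes h: "cyclic_blocks h m S"
  shows "orbit h ` spread h m S = spread h m ` (orbit (h ^^ m) ` S)"
proof -
  have m: "1 \<le> m" "finite S" "(h ^^ m) ` S = S" using h by (auto simp: cyclic_blocks_def)
  note sub = subset_spread[OF m(1), of S h]
  note cl = spread_closed[OF m(1,3)] and fin = finite_spread[OF m(2)]
  have "orbit h ` spread h m S = orbit h ` S"
  proof
    show "orbit h ` spread h m S \<subseteq> orbit h ` S"
    proof
      fix C assume "C \<in> orbit h ` spread h m S"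
      then obtain i x where C: "x \<in> S" "C = orbit h ((h ^^ i) x)" by (auto simp: spread_def)
      then have x: "x \<in> spread h m S" using sub by auto
      have "C = orbit h x" unfolding C
        by (rule orbit_eq_of_mem[OF fin cl x mem_orbit_funpow[OF fin cl x]])
      then show "C \<in> orbit h ` S" using C by auto
    qed
  qed (use sub in auto)
  also have "\<dots> = spread h m ` (orbit (h ^^ m) ` S)"
    using orbit_spread[OF h] by (force simp: image_iff)
  finally show ?thesis .
qed

text \<open>The later blocks are disjoint from S, so intersecting with S recovers C; hence distinct
  cycles in S spread to distinct cycles.\<close>

lemma spread_Int:
  assumes h: "cyclic_blocks h m S" and "C \<subseteq> S"
  shows "spread h m C \<inter> S = C"
proof
  have m: "1 \<le> m" using h by (auto simp: cyclic_blocks_def)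
  show "C \<subseteq> spread h m C \<inter> S" using subset_spread[OF m, of C h] assms by auto
  show "spread h m C \<inter> S \<subseteq> C"
  proof
    fix x assume x: "x \<in> spread h m C \<inter> S"
    then obtain i where i: "i < m" "x \<in> (h ^^ i) ` C" by (auto simp: spread_def)
    have "i = 0"
    proof (rule ccontr)
      assume "i \<noteq> 0"
      moreover have "0 < m" using m by simp
      ultimately have "(h ^^ i) ` S \<inter> (h ^^ 0) ` S = {}"
        using h i unfolding cyclic_blocks_def by blast
      then show False using x i assms(2) by auto
    qed
    then show "x \<in> C" using i by simp
  qed
qed

text \<open>Since \<open>h ^^ m\<close> maps the finite set S onto itself, it is injective on S, and
  so are the smaller powers through which it factors. The m copies of C therefore have equal
  size.\<close>

lemma card_spread:
  assumes h: "cyclic_blocks h m S" and "C \<subseteq> S"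
  shows "card (spread h m C) = m * card C"
proof -
  have S: "finite S" "(h ^^ m) ` S = S" using h by (auto simp: cyclic_blocks_def)
  then have inj: "inj_on (h ^^ m) S" by (simp add: eq_card_imp_inj_on)
  have inj': "inj_on (h ^^ i) C" if "i < m" for i
  proof -
    have "h ^^ m = (h ^^ (m - i)) \<circ> (h ^^ i)" using that by (simp add: funpow_add[symmetric])
    then have "inj_on (h ^^ i) S" using inj by (metis inj_on_imageI2)
    then show ?thesis using assms(2) by (rule inj_on_subset)
  qed
  have "card (spread h m C) = (\<Sum>i<m. card ((h ^^ i) ` C))"
    unfolding spread_def
  proof (rule card_UN_disjoint)
    show "\<forall>i\<in>{..<m}. finite ((h ^^ i) ` C)" using finite_subset[OF assms(2) S(1)] by simp
    show "\<forall>i\<in>{..<m}. \<forall>j\<in>{..<m}. i \<noteq> j \<longrightarrow> (h ^^ i) ` C \<inter> (h ^^ j) ` C = {}"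
    proof (intro ballI impI)
      fix i j assume "i \<in> {..<m}" "j \<in> {..<m}" "i \<noteq> j"
      then have "(h ^^ i) ` S \<inter> (h ^^ j) ` S = {}" using h by (simp add: cyclic_blocks_def)
      then show "(h ^^ i) ` C \<inter> (h ^^ j) ` C = {}" using assms(2) by blast
    qed
  qed simp
  also have "\<dots> = m * card C" by (simp add: card_image inj')
  finally show ?thesis .
qed

text \<open>A cycle C of the m-th power spreads to a cycle of length \<open>m * card C\<close>,
  which accounts for the change of variables. Its return map is the power \<open>m * card C\<close>
  of \<open>h\<close>, which restricts on C to the return map of the m-th power; so both have the
  same type.\<close>

lemma wt_spread:
  assumes h: "inj h" and V: "cyclic_blocks h m V" and D: "cyclic_blocks ((`) h) m D"
  shows "wt (spread h m V) (spread ((`) h) m D) h = image_mset (index_times m) (wt V D (h ^^ m))"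
proof -
  have sub: "C \<subseteq> S" if "cyclic_blocks k m S" "C \<in> orbit (k ^^ m) ` S" for k :: "'b \<Rightarrow> 'b" and C S
    using that orbit_subset_closed[of S "k ^^ m"] by (auto simp: cyclic_blocks_def)
  have inj: "inj_on (spread k m) (orbit (k ^^ m) ` S)" if "cyclic_blocks k m S" for k :: "'b \<Rightarrow> 'b" and S
    using spread_Int[OF that] sub[OF that] by (metis inj_onI)
  have card: "card (spread k m C) = m * card C"
    if "cyclic_blocks k m S" "C \<in> orbit (k ^^ m) ` S" for k :: "'b \<Rightarrow> 'b" and C S
    using card_spread[OF that(1) sub[OF that]] .
  have m: "1 \<le> m" "finite V" "finite D" using V D by (auto simp: cyclic_blocks_def)
  \<comment> \<open>Powers of \<open>h\<close> commute; this transfers the test of the endpoints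
    from block i to the first block.\<close>
  have comm: "(h ^^ (m * n)) ((h ^^ i) v) = (h ^^ i) (((h ^^ m) ^^ n) v)" for i n v
    unfolding funpow_mult by (metis add.commute comp_apply funpow_add)
  have cyl: "cylindrical h (spread ((`) h) m C) \<longleftrightarrow> cylindrical (h ^^ m) C"
    if "C \<in> orbit ((`) h ^^ m) ` D" for C
  proof
    assume "cylindrical h (spread ((`) h) m C)"
    then show "cylindrical (h ^^ m) C"
      using subset_spread[OF m(1), of C "(`) h"]
      unfolding cylindrical_def card[OF D that] funpow_mult by blast
  next
    assume R: "cylindrical (h ^^ m) C"
    show "cylindrical h (spread ((`) h) m C)"
      unfolding cylindrical_def card[OF D that]
    proof (intro ballI)
      fix e v assume "e \<in> spread ((`) h) m C" "v \<in> e"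
      then obtain i x e0 where "v = (h ^^ i) x" "x \<in> e0" "e0 \<in> C"
        by (auto simp: spread_def image_funpow)
      then show "(h ^^ (m * card C)) v = v"
        using R by (simp add: comm cylindrical_def)
    qed
  qed
  have moe: "moebius h (spread ((`) h) m C) \<longleftrightarrow> moebius (h ^^ m) C"
    if "C \<in> orbit ((`) h ^^ m) ` D" for C
  proof
    assume "moebius h (spread ((`) h) m C)"
    then show "moebius (h ^^ m) C"
      using subset_spread[OF m(1), of C "(`) h"]
      unfolding moebius_def card[OF D that] funpow_mult by blast
  next
    assume R: "moebius (h ^^ m) C"
    show "moebius h (spread ((`) h) m C)"
      unfolding moebius_def card[OF D that]
    proof (intro allI impI)
      fix u v assume "{u, v} \<in> spread ((`) h) m C"
      then obtain i e where e: "{u, v} = (h ^^ i) ` e" "e \<in> C"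
        by (auto simp: spread_def image_funpow)
      obtain x y where xy: "e = {x, y}" "u = (h ^^ i) x" "v = (h ^^ i) y"
        using doubleton_imageD[OF inj_fn[OF h] e(1)] .
      then show "(h ^^ (m * card C)) u = v \<and> (h ^^ (m * card C)) v = u"
        using R e by (simp add: comm moebius_def)
    qed
  qed
  have "wt (spread h m V) (spread ((`) h) m D) h =
      image_mset (\<lambda>C. index_times m (ivar.a (card C))) (mset_set {C \<in> orbit (h ^^ m) ` V. True}) +
      image_mset (\<lambda>C. index_times m (ivar.b (card C)))
        (mset_set {C \<in> orbit ((`) h ^^ m) ` D. cylindrical (h ^^ m) C}) +
      image_mset (\<lambda>C. index_times m (ivar.c (card C)))
        (mset_set {C \<in> orbit ((`) h ^^ m) ` D. moebius (h ^^ m) C})"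
    unfolding wt_def orbits_spread[OF V] orbits_spread[OF D]
    by (intro arg_cong2[where f = "(+)"] image_mset_reindex inj[OF V] inj[OF D])
      (use m card[OF V] card[OF D] cyl moe in auto)
  then show ?thesis
    by (simp only: wt_def image_mset_union image_mset.compositionality o_def image_funpow)
qed

section \<open>Labelled networks and their automorphisms\<close>

text \<open>The flag \<open>e\<close> allows to treat \<open>W\<^sup>+\<close> and \<open>W\<^sup>-\<close> simultaneously.\<close>

definition ext :: "bool \<Rightarrow> (nat \<Rightarrow> nat) \<Rightarrow> nat vertex \<Rightarrow> nat vertex" where
  "ext e f v = (if e then swap_poles (map_vertex f v) else map_vertex f v)"

lemma ext_simps [simp]:
  "ext e f Pole0 = (if e then Pole1 else Pole0)"
  "ext e f Pole1 = (if e then Pole0 else Pole1)"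
  "ext e f (Internal x) = Internal (f x)"
  by (simp_all add: ext_def)

lemma ext_ext: "ext e f (ext e' f' v) = ext (e \<noteq> e') (f \<circ> f') v"
  by (cases v) auto

lemma ext_False_id: "ext False id v = v" "ext False (\<lambda>x. x) v = v"
  by (cases v; simp)+

lemma inj_ext:
  assumes "inj f"
  shows "inj (ext e f)"
proof (rule injI)
  fix u v assume "ext e f u = ext e f v"
  then show "u = v" using assms by (cases u; cases v) (auto simp: inj_eq split: if_splits)
qed

text \<open>Exchanges of the poles cancel in pairs, so only the parity of n matters. This is the
  origin of the flag \<open>e \<and> odd m\<close> for cycles of length m.\<close>

lemma ext_funpow: "ext e f ^^ n = ext (e \<and> odd n) (f ^^ n)"
proof (induction n)
  case 0
  show ?case by (auto simp: ext_False_id fun_eq_iff)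
next
  case (Suc n)
  have "(e \<noteq> (e \<and> odd n)) = (e \<and> odd (Suc n))" by auto
  then show ?case unfolding funpow.simps Suc.IH by (simp add: ext_ext fun_eq_iff o_def)
qed

definition act :: "bool \<Rightarrow> (nat \<Rightarrow> nat) \<Rightarrow> network \<Rightarrow> network" where
  "act e f G = graph_image (ext e f) G"

lemma verts_act: "verts (act e f G) = ext e f ` verts G"
  and edges_act: "edges (act e f G) = (`) (ext e f) ` edges G"
  by (simp_all add: act_def graph_image_def)

lemma act_act: "act e f (act e' f' G) = act (e \<noteq> e') (f \<circ> f') G"
  by (simp add: act_def graph_image_def image_image ext_ext)

lemma act_id: "act False id G = G"
  by (simp add: act_def graph_image_def ext_False_id)

lemma act_funpow: "(act e f ^^ n) G = act (e \<and> odd n) (f ^^ n) G"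
proof (induction n)
  case 0
  show ?case by (simp add: act_id[unfolded id_def])
next
  case (Suc n)
  have "(e \<noteq> (e \<and> odd n)) = (e \<and> odd (Suc n))" by auto
  then show ?case unfolding funpow.simps comp_apply Suc.IH by (simp add: act_act o_def)
qed

lemma internals_act: "internals (act e f G) = f ` internals G"
proof -
  have "Internal y \<in> ext e f ` verts G \<longleftrightarrow> y \<in> f ` internals G" for y
  proof
    assume "Internal y \<in> ext e f ` verts G"
    then obtain v where "v \<in> verts G" "Internal y = ext e f v" by auto
    then show "y \<in> f ` internals G" by (cases v) (auto simp: internals_def split: if_splits)
  qed (force simp: internals_def image_iff)
  then show ?thesis by (auto simp: internals_def verts_act)
qed

section \<open>Well-formed networks and the action of relabellings\<close>

text \<open>Connectedness is left out on purpose: the empty parallel composition consists of two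
  isolated poles and does not satisfy \<open>is_network\<close>, yet it has to be counted.\<close>

definition wf_network :: "network \<Rightarrow> bool" where
  "wf_network G \<longleftrightarrow> finite (verts G) \<and> Pole0 \<in> verts G \<and> Pole1 \<in> verts G \<and>
     (\<forall>d\<in>edges G. d \<subseteq> verts G)"

lemma is_network_wf: "is_network G \<Longrightarrow> wf_network G"
  by (simp add: is_network_def wf_network_def simple_graph_def)

lemma verts_eq:
  assumes "wf_network G"
  shows "verts G = {Pole0, Pole1} \<union> Internal ` internals G"
proof -
  have "v \<in> verts G \<longleftrightarrow> v \<in> {Pole0, Pole1} \<union> Internal ` internals G" for v
    using assms by (cases v) (auto simp: wf_network_def internals_def)
  then show ?thesis by blast
qed

lemma finite_internals: "wf_network G \<Longrightarrow> finite (internals G)"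
  using finite_vimageI[of "verts G" Internal]
  by (auto simp: wf_network_def internals_def vimage_def inj_def)

lemma finite_edges: "wf_network G \<Longrightarrow> finite (edges G)"
  by (rule finite_subset[of _ "Pow (verts G)"]) (auto simp: wf_network_def)

lemma ext_cong:
  assumes "wf_network G" "\<And>x. x \<in> internals G \<Longrightarrow> f x = f' x" "v \<in> verts G"
  shows "ext e f v = ext e f' v"
  using assms by (cases v) (auto simp: internals_def)

lemma act_cong:
  assumes "wf_network G" "\<And>x. x \<in> internals G \<Longrightarrow> f x = f' x"
  shows "act e f G = act e f' G"
proof -
  have eq: "ext e f ` d = ext e f' ` d" if "d \<subseteq> verts G" for d
    by (rule image_cong[OF refl], rule ext_cong[OF assms]) (use that in auto)
  have "(`) (ext e f) ` edges G = (`) (ext e f') ` edges G"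
    by (rule image_cong[OF refl], rule eq) (use assms(1) in \<open>simp add: wf_network_def\<close>)
  then show ?thesis using eq[OF subset_refl] by (simp add: act_def graph_image_def)
qed

lemma wf_act:
  assumes "wf_network G"
  shows "wf_network (act e f G)"
proof -
  have "ext e f Pole0 \<in> ext e f ` verts G" "ext e f Pole1 \<in> ext e f ` verts G"
    using assms unfolding wf_network_def by blast+
  then have "Pole0 \<in> ext e f ` verts G" "Pole1 \<in> ext e f ` verts G" by (auto split: if_splits)
  moreover have "\<forall>d\<in>(`) (ext e f) ` edges G. d \<subseteq> ext e f ` verts G"
    using assms unfolding wf_network_def by blast
  ultimately show ?thesis using assms by (simp add: wf_network_def verts_act edges_act)
qed

definition bact :: "bool \<Rightarrow> (nat \<Rightarrow> nat) \<Rightarrow> bnetwork \<Rightarrow> bnetwork" where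
  "bact e f N = (act e f (fst N), (`) f ` snd N)"

definition wf_bnetwork :: "bnetwork \<Rightarrow> bool" where
  "wf_bnetwork N \<longleftrightarrow> wf_network (fst N) \<and> (\<forall>B\<in>snd N. B \<subseteq> internals (fst N))"

abbreviation support :: "bnetwork \<Rightarrow> nat set" where
  "support N \<equiv> internals (fst N)"

lemma relabel_eq_bact: "relabel f N = bact False f N"
proof -
  have "ext False f = map_vertex f" by (auto simp: ext_def fun_eq_iff)
  then show ?thesis by (simp add: relabel_def bact_def act_def case_prod_unfold)
qed

lemma tau_eq_bact: "tau N = bact True id N"
proof -
  have "ext True id v = swap_poles v" for v by (cases v) auto
  then have "ext True id = swap_poles" by auto
  then show ?thesis by (simp add: tau_def bact_def act_def case_prod_unfold)
qed

lemma bact_bact: "bact e f (bact e' f' N) = bact (e \<noteq> e') (f \<circ> f') N"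
  by (simp add: bact_def act_act image_image image_comp)

lemma bact_id: "bact False id N = N"
  by (simp add: bact_def act_id)

lemma support_bact: "support (bact e f N) = f ` support N"
  by (simp add: bact_def internals_act)

lemma wf_bact: "wf_bnetwork N \<Longrightarrow> wf_bnetwork (bact e f N)"
  by (auto simp: wf_bnetwork_def bact_def wf_act internals_act)

lemma bact_cong:
  assumes "wf_bnetwork N" "\<And>x. x \<in> support N \<Longrightarrow> f x = f' x"
  shows "bact e f N = bact e f' N"
proof -
  have "f ` B = f' ` B" if "B \<in> snd N" for B
    using assms that by (intro image_cong) (auto simp: wf_bnetwork_def)
  then show ?thesis using act_cong[of "fst N" f f'] assms
    by (auto simp: bact_def wf_bnetwork_def intro!: image_cong)
qed

lemma finite_bnetworks:
  assumes "finite U"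
  shows "finite {N. wf_bnetwork N \<and> support N = U}"
proof (rule finite_subset)
  let ?V = "{Pole0, Pole1} \<union> Internal ` U"
  show "{N. wf_bnetwork N \<and> support N = U} \<subseteq> Graph ?V ` Pow (Pow ?V) \<times> Pow (Pow U)"
  proof
    fix N assume "N \<in> {N. wf_bnetwork N \<and> support N = U}"
    then have N: "wf_network (fst N)" "\<forall>B\<in>snd N. B \<subseteq> U" "support N = U"
      by (auto simp: wf_bnetwork_def)
    have V: "verts (fst N) = ?V" using verts_eq[OF N(1)] N(3) by simp
    then have "edges (fst N) \<in> Pow (Pow ?V)" using N(1) by (auto simp: wf_network_def)
    moreover have "fst N = Graph ?V (edges (fst N))" using V by (metis graph.collapse)
    ultimately have "fst N \<in> Graph ?V ` Pow (Pow ?V)" by (metis image_eqI)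
    then show "N \<in> Graph ?V ` Pow (Pow ?V) \<times> Pow (Pow U)" using N(2) by (cases N) auto
  qed
  show "finite (Graph ?V ` Pow (Pow ?V) \<times> Pow (Pow U))" using assms by simp
qed

text \<open>As A and its image have equal finite size, so have the two differences between them; the
  part of the image outside A is sent back onto the part of A outside the image, and all other
  points stay fixed.\<close>

lemma inj_on_extend_bij:
  fixes f :: "'a \<Rightarrow> 'a"
  assumes "finite A" "inj_on f A"
  obtains g where "bij g" "\<And>x. x \<in> A \<Longrightarrow> g x = f x"
proof -
  let ?B = "f ` A"
  have "card (?B - A) = card (A - ?B)"
    using assms card_image[OF assms(2)]
    by (simp add: card_Diff_subset_Int Int_commute)
  then obtain k where k: "bij_betw k (?B - A) (A - ?B)"
    using assms by (metis bij_betw_iff_card finite_Diff finite_imageI)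
  define g where "g x = (if x \<in> A then f x else if x \<in> ?B then k x else x)" for x
  have "bij_betw g A ?B" using assms(2) by (auto simp: bij_betw_def inj_on_def g_def)
  moreover have "bij_betw g (?B - A) (A - ?B)"
    using k by (subst bij_betw_cong[of _ _ k]) (auto simp: g_def)
  moreover have "bij_betw g (- (A \<union> ?B)) (- (A \<union> ?B))"
    by (subst bij_betw_cong[of _ _ id]) (auto simp: g_def)
  ultimately have "bij_betw g (A \<union> (?B - A) \<union> - (A \<union> ?B)) (?B \<union> (A - ?B) \<union> - (A \<union> ?B))"
    by (intro bij_betw_combine) auto
  moreover have "A \<union> (?B - A) \<union> - (A \<union> ?B) = UNIV" "?B \<union> (A - ?B) \<union> - (A \<union> ?B) = UNIV" by auto
  ultimately have "bij g" by simp
  then show ?thesis using that by (simp add: g_def)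
qed

text \<open>Bijections of all labels can be composed and inverted without keeping track of domains;
  the values outside the support are immaterial for the relabelled network.\<close>

lemma isomorphic_iff:
  assumes "wf_bnetwork N"
  shows "isomorphic N N' \<longleftrightarrow> (\<exists>f. bij f \<and> bact False f N = N')"
proof
  assume "isomorphic N N'"
  then obtain f where f: "bij_betw f (support N) (support N')" "bact False f N = N'"
    by (auto simp: isomorphic_def relabel_eq_bact)
  obtain g where g: "bij g" "\<And>x. x \<in> support N \<Longrightarrow> g x = f x"
    using inj_on_extend_bij[of "support N" f] f(1) finite_internals[of "fst N"] assms
    by (auto simp: bij_betw_def wf_bnetwork_def)
  then show "\<exists>f. bij f \<and> bact False f N = N'"
    using bact_cong[OF assms, of g f] f(2) by auto
next
  assume "\<exists>f. bij f \<and> bact False f N = N'"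
  then obtain f where f: "bij f" "bact False f N = N'" by auto
  then have "support N' = f ` support N" using support_bact[of False f N] by simp
  moreover have "inj_on f (support N)" using f(1) by (auto simp: bij_def intro: inj_on_subset)
  ultimately show "isomorphic N N'"
    using f(2) by (auto simp: isomorphic_def relabel_eq_bact bij_betw_def intro!: exI[of _ f])
qed

section \<open>Automorphisms and weights without the poles\<close>

definition Aut :: "bool \<Rightarrow> bnetwork \<Rightarrow> (nat \<Rightarrow> nat) set" where
  "Aut e N = {\<sigma>. \<sigma> permutes support N \<and> bact e \<sigma> N = N}"

lemma Aut_plus_eq: "Aut_plus N = Aut False N"
  by (simp add: Aut_plus_def Aut_def relabel_eq_bact)

lemma Aut_minus_eq: "Aut_minus N = Aut True N"
  by (simp add: Aut_minus_def Aut_def relabel_eq_bact tau_eq_bact bact_bact)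

lemma finite_Aut: "wf_bnetwork N \<Longrightarrow> finite (Aut e N)"
  by (rule finite_subset[OF _ finite_permutations[of "support N"]])
    (auto simp: Aut_def wf_bnetwork_def finite_internals)

lemma id_in_Aut: "id \<in> Aut False N"
  by (simp add: Aut_def bact_id permutes_id)

lemma Aut_compose: "\<sigma> \<in> Aut e N \<Longrightarrow> \<rho> \<in> Aut e' N \<Longrightarrow> \<sigma> \<circ> \<rho> \<in> Aut (e \<noteq> e') N"
  unfolding Aut_def using permutes_compose bact_bact[of e \<sigma> e' \<rho> N] by auto

lemma Aut_inv:
  assumes "\<sigma> \<in> Aut e N"
  shows "inv \<sigma> \<in> Aut e N"
proof -
  have s: "\<sigma> permutes support N" "bact e \<sigma> N = N" using assms by (auto simp: Aut_def)
  then have "bact e (inv \<sigma>) N = bact e (inv \<sigma>) (bact e \<sigma> N)" by simp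
  also have "\<dots> = N" unfolding bact_bact using permutes_inv_o(2)[OF s(1)] bact_id by simp
  finally show ?thesis using permutes_inv[OF s(1)] by (simp add: Aut_def)
qed

text \<open>If nonempty, \<open>Aut e N\<close> is a coset of the group \<open>Aut False N\<close>:
  composition with a fixed element and with its inverse passes between them.\<close>

lemma card_Aut:
  assumes "Aut e N \<noteq> {}"
  shows "card (Aut e N) = card (Aut False N)"
proof -
  obtain \<beta> where \<beta>: "\<beta> \<in> Aut e N" using assms by auto
  then have p: "\<beta> permutes support N" by (simp add: Aut_def)
  have "bij_betw (\<lambda>\<alpha>. \<beta> \<circ> \<alpha>) (Aut False N) (Aut e N)"
  proof (rule bij_betw_byWitness[where f' = "\<lambda>\<gamma>. inv \<beta> \<circ> \<gamma>"])
    show "\<forall>\<alpha>\<in>Aut False N. inv \<beta> \<circ> (\<beta> \<circ> \<alpha>) = \<alpha>" "\<forall>\<gamma>\<in>Aut e N. \<beta> \<circ> (inv \<beta> \<circ> \<gamma>) = \<gamma>"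
      by (simp_all add: o_assoc permutes_inv_o[OF p])
    show "(\<circ>) \<beta> ` Aut False N \<subseteq> Aut e N" using Aut_compose[OF \<beta>, of _ False] by auto
    show "(\<circ>) (inv \<beta>) ` Aut e N \<subseteq> Aut False N" using Aut_compose[OF Aut_inv[OF \<beta>], of _ e] by auto
  qed
  then show ?thesis using bij_betw_same_card by fastforce
qed

text \<open>An isomorphism from the mirror image of N to N, cut down to a permutation of the
  support, is the same as an automorphism that exchanges the poles.\<close>

lemma tau_symmetric_iff:
  assumes "wf_bnetwork N"
  shows "tau_symmetric N \<longleftrightarrow> Aut True N \<noteq> {}"
proof
  assume "tau_symmetric N"
  then obtain f where f: "bij_betw f (support N) (support N)" "bact True f N = N"
    using support_bact[of True id N]
    by (auto simp: tau_symmetric_def isomorphic_def relabel_eq_bact tau_eq_bact bact_bact)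
  have fin: "finite (support N)" using assms by (simp add: wf_bnetwork_def finite_internals)
  have "perm_restrict f (support N) permutes support N"
    using perm_restrict_permutes[OF fin] f(1) by (simp add: bij_betw_def)
  moreover have "bact True (perm_restrict f (support N)) N = bact True f N"
    by (rule bact_cong[OF assms]) (simp add: perm_restrict_def)
  ultimately show "Aut True N \<noteq> {}" using f(2) by (auto simp: Aut_def)
next
  assume "Aut True N \<noteq> {}"
  then obtain \<sigma> where s: "\<sigma> permutes support N" "bact True \<sigma> N = N" by (auto simp: Aut_def)
  then show "tau_symmetric N"
    using support_bact[of True id N] permutes_imp_bij[OF s(1)]
    by (auto simp: tau_symmetric_def isomorphic_def relabel_eq_bact tau_eq_bact bact_bact
        intro!: exI[of _ \<sigma>])
qed

text \<open>The division by the factor of the poles is built in: only cycles of internal vertices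
  are listed, while all edges stay. This avoids differences of multisets in the counting.\<close>

definition pole_free_weight :: "bool \<Rightarrow> bnetwork \<Rightarrow> (nat \<Rightarrow> nat) \<Rightarrow> ivar multiset" where
  "pole_free_weight e N \<sigma> = wt (Internal ` support N) (edges (fst N)) (ext e \<sigma>)"

lemma Aut_edges:
  assumes "\<sigma> \<in> Aut e N"
  shows "(`) (ext e \<sigma>) ` edges (fst N) = edges (fst N)"
proof -
  have "act e \<sigma> (fst N) = fst N" using assms by (auto simp: Aut_def bact_def prod_eq_iff)
  then show ?thesis using edges_act by metis
qed

lemma Aut_Internal:
  assumes "\<sigma> \<in> Aut e N"
  shows "ext e \<sigma> ` Internal ` support N = Internal ` support N"
  using assms permutes_image[of \<sigma> "support N"] by (force simp: Aut_def image_iff set_eq_iff)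

text \<open>The poles form an invariant set to which no edges are assigned, so they split off as a
  factor: a single 2-cycle if they are exchanged, two fixed points otherwise.\<close>

lemma weight_eq_pole_free_weight:
  assumes N: "wf_bnetwork N" and s: "\<sigma> \<in> Aut e N"
  shows "weight (fst N) (ext e \<sigma>) =
    (if e then {#ivar.a 2#} else {#ivar.a 1, ivar.a 1#}) + pole_free_weight e N \<sigma>"
proof -
  have wf: "wf_network (fst N)" using N by (simp add: wf_bnetwork_def)
  let ?h = "ext e \<sigma>" and ?P = "{Pole0, Pole1} :: nat vertex set"
  have "weight (fst N) ?h = wt (?P \<union> Internal ` support N) ({} \<union> edges (fst N)) ?h"
    unfolding weight_eq_wt using verts_eq[OF wf] by simp
  also have "\<dots> = wt ?P {} ?h + pole_free_weight e N \<sigma>"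
    unfolding pole_free_weight_def
    by (rule wt_Un)
      (use finite_internals[OF wf] finite_edges[OF wf] Aut_edges[OF s] Aut_Internal[OF s] in auto)
  also have "wt ?P {} ?h = (if e then {#ivar.a 2#} else {#ivar.a 1, ivar.a 1#})"
  proof (cases e)
    case True
    have P: "?h x \<in> ?P" if "x \<in> ?P" for x using that True by auto
    have "orbit ?h Pole0 \<subseteq> ?P" "orbit ?h Pole1 \<subseteq> ?P"
      by (rule orbit_subset_closed[of ?P ?h, OF P]; simp)+
    moreover have "Pole1 \<in> orbit ?h Pole0" "Pole0 \<in> orbit ?h Pole1"
      using orbit.base[of ?h Pole0] orbit.base[of ?h Pole1] True by auto
    moreover from this have "Pole0 \<in> orbit ?h Pole0" "Pole1 \<in> orbit ?h Pole1"
      using orbit.step[of Pole1 ?h Pole0] orbit.step[of Pole0 ?h Pole1] True by auto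
    ultimately have "orbit ?h Pole0 = ?P" "orbit ?h Pole1 = ?P" by auto
    then show ?thesis using True by (simp add: wt_def)
  next
    case False
    then have "orbit ?h Pole0 = {Pole0}" "orbit ?h Pole1 = {Pole1}"
      by (simp_all add: orbit_eq_singleton_iff)
    then have "{C \<in> orbit ?h ` ?P. True} = {{Pole0}, {Pole1}}" by auto
    then show ?thesis using False unfolding wt_def by simp
  qed
  finally show ?thesis .
qed

lemma weight_plus_eq:
  assumes "wf_bnetwork N" "\<sigma> \<in> Aut False N"
  shows "weight_plus N \<sigma> = pole_free_weight False N \<sigma>"
proof -
  have "map_vertex \<sigma> = ext False \<sigma>" by (auto simp: ext_def fun_eq_iff)
  then show ?thesis using weight_eq_pole_free_weight[OF assms] by (simp add: weight_plus_def)
qed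

lemma weight_minus_eq:
  assumes "wf_bnetwork N" "\<sigma> \<in> Aut True N"
  shows "weight_minus N \<sigma> = pole_free_weight True N \<sigma>"
proof -
  have "swap_poles \<circ> map_vertex \<sigma> = ext True \<sigma>" by (auto simp: ext_def fun_eq_iff)
  then show ?thesis using weight_eq_pole_free_weight[OF assms] by (simp add: weight_minus_def)
qed

lemma deg_pole_free_weight:
  assumes "wf_bnetwork N" "\<sigma> \<in> Aut e N"
  shows "deg (pole_free_weight e N \<sigma>) = card (support N)"
  unfolding pole_free_weight_def using assms Aut_Internal[OF assms(2)]
  by (subst deg_wt) (auto simp: finite_internals wf_bnetwork_def card_image inj_on_def)

text \<open>Relabelling by f conjugates automorphisms. The extension of f to the vertices
  intertwines the old and the new automorphism, so the weight is unchanged.\<close>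

lemma Aut_conjugate:
  assumes N: "wf_bnetwork N" and f: "bij f" and s: "\<sigma> \<in> Aut e N"
  shows "f \<circ> \<sigma> \<circ> inv f \<in> Aut e (bact False f N)"
    and "pole_free_weight e (bact False f N) (f \<circ> \<sigma> \<circ> inv f) = pole_free_weight e N \<sigma>"
proof -
  have sp: "\<sigma> permutes support N" and sN: "bact e \<sigma> N = N" using s by (auto simp: Aut_def)
  have inv: "inv f (f x) = x" "f (inv f x) = x" for x
    using f by (auto simp: bij_def surj_f_inv_f)
  have "f \<circ> \<sigma> \<circ> inv f permutes f ` support N"
  proof -
    have "bij (f \<circ> \<sigma> \<circ> inv f)" using f permutes_bij[OF sp] by (simp add: bij_comp bij_imp_bij_inv)
    moreover have "(f \<circ> \<sigma> \<circ> inv f) x = x" if "x \<notin> f ` support N" for x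
    proof -
      have "inv f x \<notin> support N" using that inv by (metis image_eqI)
      then show ?thesis using permutes_not_in[OF sp] inv by simp
    qed
    ultimately show ?thesis by (simp add: permutes_def bij_iff)
  qed
  moreover have "bact e (f \<circ> \<sigma> \<circ> inv f) (bact False f N) = bact False f (bact e \<sigma> N)"
    unfolding bact_bact using inv by (simp add: o_def)
  ultimately show "f \<circ> \<sigma> \<circ> inv f \<in> Aut e (bact False f N)"
    using sN by (simp add: Aut_def support_bact)
  have wf: "wf_network (fst N)" using N by (simp add: wf_bnetwork_def)
  have comm: "ext e (f \<circ> \<sigma> \<circ> inv f) (ext False f v) = ext False f (ext e \<sigma> v)" for v
    unfolding ext_ext by (simp add: o_def inv)
  have I: "Internal ` f ` support N = ext False f ` Internal ` support N" by (auto simp: image_image)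
  have "wt (ext False f ` Internal ` support N) ((`) (ext False f) ` edges (fst N)) (ext e (f \<circ> \<sigma> \<circ> inv f))
      = wt (Internal ` support N) (edges (fst N)) (ext e \<sigma>)"
  proof (rule wt_intertwine)
    show "finite (Internal ` support N)" "finite (edges (fst N))"
      using finite_internals[OF wf] finite_edges[OF wf] by simp_all
    show "ext e \<sigma> v \<in> Internal ` support N" if "v \<in> Internal ` support N" for v
      using that Aut_Internal[OF s] by blast
    show "ext e \<sigma> ` d \<in> edges (fst N)" if "d \<in> edges (fst N)" for d
      using that Aut_edges[OF s] by blast
  qed (use inj_ext[OF bij_is_inj[OF f]] comm in auto)
  then show "pole_free_weight e (bact False f N) (f \<circ> \<sigma> \<circ> inv f) = pole_free_weight e N \<sigma>"
    by (simp add: pole_free_weight_def bact_def edges_act internals_act I)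
qed

lemma Aut_conjugate_bij:
  assumes N: "wf_bnetwork N" and f: "bij f"
  shows "bij_betw (\<lambda>\<sigma>. f \<circ> \<sigma> \<circ> inv f) (Aut e N) (Aut e (bact False f N))"
proof (rule bij_betw_byWitness[where f' = "\<lambda>\<sigma>. inv f \<circ> \<sigma> \<circ> f"])
  have inv: "inv f (f x) = x" "f (inv f x) = x" for x
    using f by (auto simp: bij_def surj_f_inv_f)
  show "\<forall>\<sigma>\<in>Aut e N. inv f \<circ> (f \<circ> \<sigma> \<circ> inv f) \<circ> f = \<sigma>"
    "\<forall>\<sigma>\<in>Aut e (bact False f N). f \<circ> (inv f \<circ> \<sigma> \<circ> f) \<circ> inv f = \<sigma>"
    by (simp_all add: fun_eq_iff inv)
  show "(\<lambda>\<sigma>. f \<circ> \<sigma> \<circ> inv f) ` Aut e N \<subseteq> Aut e (bact False f N)"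
    using Aut_conjugate(1)[OF N f] by auto
  have N': "bact False (inv f) (bact False f N) = N"
    unfolding bact_bact using inv bact_id by (simp add: o_def id_def)
  have f': "inv (inv f) = f" using f by (simp add: inv_inv_eq)
  show "(\<lambda>\<sigma>. inv f \<circ> \<sigma> \<circ> f) ` Aut e (bact False f N) \<subseteq> Aut e N"
    using Aut_conjugate(1)[OF wf_bact[OF N, of False f] bij_imp_bij_inv[OF f]] unfolding N' f' by auto
qed

lemma card_Aut_bact:
  assumes "wf_bnetwork N" "bij f"
  shows "card (Aut e (bact False f N)) = card (Aut e N)"
  using bij_betw_same_card[OF Aut_conjugate_bij[OF assms]] by simp

lemma card_Aut_weight_bact:
  assumes "wf_bnetwork N" "bij f"
  shows "card {\<sigma> \<in> Aut e (bact False f N). pole_free_weight e (bact False f N) \<sigma> = M}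
    = card {\<sigma> \<in> Aut e N. pole_free_weight e N \<sigma> = M}"
proof -
  let ?c = "\<lambda>\<sigma>. f \<circ> \<sigma> \<circ> inv f"
  have "{\<sigma> \<in> Aut e (bact False f N). pole_free_weight e (bact False f N) \<sigma> = M}
      = ?c ` {\<sigma> \<in> Aut e N. pole_free_weight e N \<sigma> = M}"
    unfolding bij_betw_imp_surj_on[OF Aut_conjugate_bij[OF assms], symmetric]
    using Aut_conjugate(2)[OF assms] by auto
  moreover have "inj_on ?c {\<sigma> \<in> Aut e N. pole_free_weight e N \<sigma> = M}"
    by (rule inj_on_subset[OF bij_betw_imp_inj_on[OF Aut_conjugate_bij[OF assms, of e]]]) auto
  ultimately show ?thesis by (simp add: card_image)
qed

lemma Aut_nonempty_bact:
  assumes "wf_bnetwork N" "bij f"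
  shows "Aut e (bact False f N) \<noteq> {} \<longleftrightarrow> Aut e N \<noteq> {}"
  using bij_betw_imp_surj_on[OF Aut_conjugate_bij[OF assms, of e]] by auto

section \<open>Isomorphism classes and their labelled members\<close>

text \<open>The permutations of the support map onto the copies of N with the same support, and the
  permutations producing a given copy form a coset of \<open>Aut False N\<close>.\<close>

lemma orbit_stabilizer:
  assumes N: "wf_bnetwork N"
  shows "card {N'. isomorphic N N' \<and> support N' = support N} * card (Aut False N)
    = fact (card (support N))"
proof -
  let ?U = "support N" and ?h = "\<lambda>\<pi>. bact False \<pi> N"
  let ?P = "{\<pi>. \<pi> permutes ?U}"
  have fin: "finite ?U" using N by (simp add: wf_bnetwork_def finite_internals)
  have img: "?h ` ?P = {N'. isomorphic N N' \<and> support N' = ?U}"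
  proof
    show "?h ` ?P \<subseteq> {N'. isomorphic N N' \<and> support N' = ?U}"
    proof (rule image_subsetI)
      fix p assume "p \<in> ?P"
      then have p: "p permutes ?U" by simp
      show "?h p \<in> {N'. isomorphic N N' \<and> support N' = ?U}"
        unfolding isomorphic_iff[OF N] support_bact 
          mem_Collect_eq using permutes_bij[OF p] permutes_image[OF p] by blast
    qed
    show "{N'. isomorphic N N' \<and> support N' = ?U} \<subseteq> ?h ` ?P"
    proof
      fix N' assume "N' \<in> {N'. isomorphic N N' \<and> support N' = ?U}"
      then obtain f where f: "bij f" "bact False f N = N'" "f ` ?U = ?U"
        using isomorphic_iff[OF N, of N'] support_bact[of False _ N] by auto
      have "bact False (perm_restrict f ?U) N = N'"
        using bact_cong[OF N, of "perm_restrict f ?U" f] f by (simp add: perm_restrict_def)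
      then show "N' \<in> ?h ` ?P" using perm_restrict_permutes[OF fin f(3)] by auto
    qed
  qed
  have fiber: "card {\<pi> \<in> ?P. ?h \<pi> = N'} = card (Aut False N)" if N': "N' \<in> ?h ` ?P" for N'
  proof -
    obtain p where p: "p permutes ?U" "N' = ?h p" using N' by auto
    have "bij_betw (\<lambda>\<alpha>. p \<circ> \<alpha>) (Aut False N) {\<pi> \<in> ?P. ?h \<pi> = N'}"
    proof (rule bij_betw_byWitness[where f' = "\<lambda>\<gamma>. inv p \<circ> \<gamma>"])
      show "\<forall>\<alpha>\<in>Aut False N. inv p \<circ> (p \<circ> \<alpha>) = \<alpha>" "\<forall>\<gamma>\<in>{\<pi> \<in> ?P. ?h \<pi> = N'}. p \<circ> (inv p \<circ> \<gamma>) = \<gamma>"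
        by (simp_all add: o_assoc permutes_inv_o[OF p(1)])
      show "(\<circ>) p ` Aut False N \<subseteq> {\<pi> \<in> ?P. ?h \<pi> = N'}"
      proof (clarsimp simp: Aut_def p)
        fix \<alpha> assume a: "\<alpha> permutes ?U" "?h \<alpha> = N"
        have "?h (p \<circ> \<alpha>) = bact False p (?h \<alpha>)" by (simp add: bact_bact)
        then show "p \<circ> \<alpha> permutes ?U \<and> ?h (p \<circ> \<alpha>) = ?h p"
          using a permutes_compose[OF a(1) p(1)] by simp
      qed
      show "(\<circ>) (inv p) ` {\<pi> \<in> ?P. ?h \<pi> = N'} \<subseteq> Aut False N"
      proof (clarsimp simp: Aut_def p)
        fix \<gamma> assume c: "\<gamma> permutes ?U" "?h \<gamma> = ?h p"
        have "?h (inv p \<circ> \<gamma>) = bact False (inv p) (?h \<gamma>)" by (simp add: bact_bact)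
        also have "\<dots> = bact False (inv p \<circ> p) N" by (simp add: bact_bact c)
        also have "\<dots> = N" by (simp add: permutes_inv_o[OF p(1)] bact_id)
        finally show "inv p \<circ> \<gamma> permutes ?U \<and> ?h (inv p \<circ> \<gamma>) = N"
          using permutes_compose[OF c(1) permutes_inv[OF p(1)]] by simp
      qed
    qed
    then show ?thesis using bij_betw_same_card by fastforce
  qed
  have finP: "finite ?P" using finite_permutations[OF fin] .
  have "card ?P = (\<Sum>N'\<in>?h ` ?P. \<Sum>\<pi>\<in>{\<pi> \<in> ?P. ?h \<pi> = N'}. 1)"
    unfolding card_eq_sum by (rule sum.image_gen[OF finP])
  also have "\<dots> = (\<Sum>N'\<in>?h ` ?P. card (Aut False N))" by (rule sum.cong) (use fiber in auto)
  also have "\<dots> = card (?h ` ?P) * card (Aut False N)" by simp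
  finally show ?thesis using card_permutations[OF refl fin] by (simp add: img)
qed

definition closed_class :: "bnetwork set \<Rightarrow> bool" where
  "closed_class S \<longleftrightarrow> (\<forall>N\<in>S. wf_bnetwork N \<and> (\<forall>f. bij f \<longrightarrow> bact False f N \<in> S))"

text \<open>The choice is made from the isomorphism class written as a set, exactly as in
  \<open>representatives\<close>; it therefore depends on the class only.\<close>

definition representative :: "bnetwork set \<Rightarrow> bnetwork \<Rightarrow> bnetwork" where
  "representative S N = (SOME N'. N' \<in> {N'. N' \<in> S \<and> isomorphic N N'})"

lemma representatives_eq: "representatives S = representative S ` S"
proof -
  have "{(N, N'). N \<in> S \<and> N' \<in> S \<and> isomorphic N N'} `` {N} = {N'. N' \<in> S \<and> isomorphic N N'}"
    if "N \<in> S" for N using that by auto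
  then have "iso_classes S = (\<lambda>N. {N'. N' \<in> S \<and> isomorphic N N'}) ` S"
    unfolding iso_classes_def quotient_def by auto
  then show ?thesis unfolding representatives_def by (simp add: image_image representative_def)
qed

lemma isomorphic_refl: "wf_bnetwork N \<Longrightarrow> isomorphic N N"
  using isomorphic_iff[of N N] bact_id bij_id by blast

lemma isomorphic_sym:
  assumes "wf_bnetwork N" "isomorphic N N'"
  shows "isomorphic N' N"
proof -
  obtain f where f: "bij f" "N' = bact False f N"
    using assms(2) isomorphic_iff[OF assms(1), of N'] by auto
  have "bact False (inv f) N' = N" using f by (simp add: bact_bact bij_is_inj bact_id)
  moreover have "wf_bnetwork N'" using wf_bact[OF assms(1)] f(2) by simp
  ultimately show ?thesis
    using isomorphic_iff[of N' N] bij_imp_bij_inv[OF f(1)] by auto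
qed

lemma isomorphic_trans:
  assumes "wf_bnetwork N" "isomorphic N N'" "isomorphic N' N''"
  shows "isomorphic N N''"
proof -
  obtain f where f: "bij f" "N' = bact False f N"
    using assms(2) isomorphic_iff[OF assms(1), of N'] by auto
  have "wf_bnetwork N'" using wf_bact[OF assms(1)] f(2) by simp
  then obtain g where g: "bij g" "N'' = bact False g N'"
    using assms(3) isomorphic_iff[of N' N''] by auto
  have "N'' = bact False (g \<circ> f) N" using f g by (simp add: bact_bact)
  then show ?thesis using isomorphic_iff[OF assms(1), of N''] bij_comp[OF f(1) g(1)] by auto
qed

lemma representative:
  assumes "closed_class S" "N \<in> S"
  shows "representative S N \<in> S" "isomorphic N (representative S N)"
proof -
  have "representative S N \<in> {N'. N' \<in> S \<and> isomorphic N N'}"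
    unfolding representative_def
    by (rule someI[of _ N]) (use assms isomorphic_refl in \<open>auto simp: closed_class_def\<close>)
  then show "representative S N \<in> S" "isomorphic N (representative S N)" by auto
qed

lemma representative_eq_iff:
  assumes "closed_class S" "N \<in> S" "N' \<in> S"
  shows "representative S N = representative S N' \<longleftrightarrow> isomorphic N N'"
proof
  have wf: "wf_bnetwork N" "wf_bnetwork N'" using assms by (auto simp: closed_class_def)
  show "isomorphic N N'" if "representative S N = representative S N'"
    using that representative[OF assms(1)] assms wf isomorphic_sym isomorphic_trans by metis
  assume iso: "isomorphic N N'"
  then have "isomorphic N N'' \<longleftrightarrow> isomorphic N' N''" for N''
    using isomorphic_trans isomorphic_sym wf by blast
  then show "representative S N = representative S N'" by (simp add: representative_def)
qed

text \<open>One definition covers both series: \<open>Aut False N\<close> always contains the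
  identity, while nonemptiness of \<open>Aut True N\<close> expresses \<tau>-symmetry.\<close>

definition W :: "bool \<Rightarrow> bnetwork set \<Rightarrow> ivar mseries" where
  "W e S = formal_sum
     (\<lambda>N. scale (1 / of_nat (card (Aut e N)))
       (\<Sum>\<sigma>\<in>Aut e N. monomial 1 (pole_free_weight e N \<sigma>)))
     (representatives {N \<in> S. Aut e N \<noteq> {}})"

lemma closed_class_Aut_nonempty:
  assumes "closed_class S"
  shows "closed_class {N \<in> S. Aut e N \<noteq> {}}"
  using assms Aut_nonempty_bact unfolding closed_class_def by blast

lemma W_plus_eq:
  assumes "closed_class S"
  shows "W_plus S = W False S"
proof -
  have S: "{N \<in> S. Aut False N \<noteq> {}} = S" using id_in_Aut by blast
  show ?thesis unfolding W_plus_def W_def S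
  proof (rule formal_sum_cong)
    fix N assume "N \<in> representatives S"
    then have "wf_bnetwork N"
      using assms representative by (auto simp: representatives_eq closed_class_def)
    then show "scale (1 / of_nat (card (Aut_plus N))) (\<Sum>\<sigma>\<in>Aut_plus N. monomial 1 (weight_plus N \<sigma>))
        = scale (1 / of_nat (card (Aut False N)))
            (\<Sum>\<sigma>\<in>Aut False N. monomial 1 (pole_free_weight False N \<sigma>))"
      by (simp add: Aut_plus_eq weight_plus_eq cong: sum.cong)
  qed
qed

lemma W_minus_eq:
  assumes "closed_class S"
  shows "W_minus S = W True S"
proof -
  have S: "{N \<in> S. tau_symmetric N} = {N \<in> S. Aut True N \<noteq> {}}"
    using assms tau_symmetric_iff by (auto simp: closed_class_def)
  note cl = closed_class_Aut_nonempty[OF assms, of True]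
  show ?thesis unfolding W_minus_def W_def S
  proof (rule formal_sum_cong)
    fix N assume "N \<in> representatives {N \<in> S. Aut True N \<noteq> {}}"
    then have "N \<in> {N \<in> S. Aut True N \<noteq> {}}"
      using representative(1)[OF cl] unfolding representatives_eq by blast
    then have "wf_bnetwork N" using assms by (auto simp: closed_class_def)
    then show "scale (1 / of_nat (card (Aut_minus N))) (\<Sum>\<sigma>\<in>Aut_minus N. monomial 1 (weight_minus N \<sigma>))
        = scale (1 / of_nat (card (Aut True N)))
            (\<Sum>\<sigma>\<in>Aut True N. monomial 1 (pole_free_weight True N \<sigma>))"
      by (simp add: Aut_minus_eq weight_minus_eq cong: sum.cong)
  qed
qed

definition pairs :: "bool \<Rightarrow> bnetwork set \<Rightarrow> nat set \<Rightarrow> (bnetwork \<times> (nat \<Rightarrow> nat)) set" where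
  "pairs e S U = {(N, \<sigma>). N \<in> S \<and> support N = U \<and> \<sigma> \<in> Aut e N}"

lemma coeff_W_summand:
  assumes "wf_bnetwork N"
  shows "coeff (scale r (\<Sum>\<sigma>\<in>Aut e N. monomial 1 (pole_free_weight e N \<sigma>))) M
    = r * of_nat (card {\<sigma> \<in> Aut e N. pole_free_weight e N \<sigma> = M})"
proof -
  have "(\<Sum>\<sigma>\<in>Aut e N. coeff (monomial 1 (pole_free_weight e N \<sigma>)) M)
      = (\<Sum>\<sigma>\<in>Aut e N. if pole_free_weight e N \<sigma> = M then 1 else 0)"
    by (rule sum.cong) (auto simp: coeff_monomial)
  also have "\<dots> = of_nat (card {\<sigma> \<in> Aut e N. pole_free_weight e N \<sigma> = M})"
    using finite_Aut[OF assms] by (simp add: sum.If_cases Int_def)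
  finally show ?thesis by (simp add: coeff_scale coeff_sum)
qed

text \<open>Each isomorphism class has \<open>n! / |Aut\<^sup>+(N)|\<close> members on a given set of \<open>n\<close> labels.\<close>

theorem enumerates_pairs:
  assumes S: "closed_class S"
  shows "enumerates (pairs e S) (\<lambda>(N, \<sigma>). pole_free_weight e N \<sigma>) (W e S)"
proof (rule enumeratesI)
  have wf: "wf_bnetwork N" if "N \<in> S" for N using S that by (simp add: closed_class_def)
  have fin: "finite {N \<in> S. support N = U}" if "finite U" for U
    by (rule finite_subset[OF _ finite_bnetworks[OF that]]) (use wf in auto)
  have eq: "pairs e S U = (SIGMA N:{N \<in> S. support N = U}. Aut e N)" for U
    by (auto simp: pairs_def)
  fix U :: "nat set" assume U: "finite U"
  show "finite (pairs e S U)" unfolding eq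
    by (rule finite_SigmaI[OF fin[OF U]]) (use finite_Aut wf in auto)
  show "deg (case s of (N, \<sigma>) \<Rightarrow> pole_free_weight e N \<sigma>) = card U" if "s \<in> pairs e S U" for s
    using that deg_pole_free_weight wf by (auto simp: pairs_def)
  fix M assume M: "card U = deg M"
  \<comment> \<open>These are the networks that occur in a pair, and also those among which
    \<open>W\<close> chooses its representatives.\<close>
  define T where "T = {N \<in> S. Aut e N \<noteq> {}}"
  define c where "c N = card {\<sigma> \<in> Aut e N. pole_free_weight e N \<sigma> = M}" for N
  define r where "r = representative T"
  have T: "closed_class T" unfolding T_def by (rule closed_class_Aut_nonempty[OF S])
  have wfT: "wf_bnetwork N" if "N \<in> T" for N using wf that by (simp add: T_def)
  let ?TU = "{N \<in> T. support N = U}"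
  have finT: "finite ?TU" by (rule finite_subset[OF _ fin[OF U]]) (auto simp: T_def)
  have "{s \<in> pairs e S U. (case s of (N, \<sigma>) \<Rightarrow> pole_free_weight e N \<sigma>) = M}
      = (SIGMA N:?TU. {\<sigma> \<in> Aut e N. pole_free_weight e N \<sigma> = M})"
    by (auto simp: pairs_def T_def)
  then have "card {s \<in> pairs e S U. (case s of (N, \<sigma>) \<Rightarrow> pole_free_weight e N \<sigma>) = M} = (\<Sum>N\<in>?TU. c N)"
    using finT finite_Aut wfT by (subst c_def, subst card_SigmaI[symmetric]) auto
  \<comment> \<open>The labelled networks on U are grouped by isomorphism class, each named by its
    representative, whose own label set may differ from U.\<close>
  also have "\<dots> = (\<Sum>R\<in>r ` ?TU. \<Sum>N\<in>{N \<in> ?TU. r N = R}. c N)"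
    by (rule sum.image_gen[OF finT])
  finally have "of_nat (card {s \<in> pairs e S U. (case s of (N, \<sigma>) \<Rightarrow> pole_free_weight e N \<sigma>) = M})
      = (\<Sum>R\<in>r ` ?TU. of_nat (\<Sum>N\<in>{N \<in> ?TU. r N = R}. c N) :: rat)" by simp
  also have "\<dots> = (\<Sum>R\<in>r ` ?TU. fact (card U) * (1 / of_nat (card (Aut e R)) * of_nat (c R)))"
  proof (rule sum.cong[OF refl])
    fix R assume "R \<in> r ` ?TU"
    then obtain N where N: "N \<in> T" "support N = U" "R = r N" by auto
    have R: "R \<in> T" "isomorphic N R" using representative[OF T N(1)] N(3) by (simp_all add: r_def)
    have inv: "c N' = c N" "card (Aut e N') = card (Aut e N)" if "isomorphic N N'" for N'
      using that isomorphic_iff[OF wfT[OF N(1)]] card_Aut_weight_bact[OF wfT[OF N(1)]]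
        card_Aut_bact[OF wfT[OF N(1)]] unfolding c_def by auto
    have mem: "N' \<in> T" if "isomorphic N N'" for N'
      using that isomorphic_iff[OF wfT[OF N(1)]] T N(1) by (auto simp: closed_class_def)
    have cls: "{N' \<in> ?TU. r N' = R} = {N'. isomorphic N N' \<and> support N' = support N}"
    proof (rule set_eqI)
      fix N'
      show "N' \<in> {N' \<in> ?TU. r N' = R} \<longleftrightarrow> N' \<in> {N'. isomorphic N N' \<and> support N' = support N}"
        using representative_eq_iff[OF T N(1), of N'] mem[of N'] N(2,3)
        by (auto simp: r_def eq_commute[of "representative T N'"])
    qed
    \<comment> \<open>Orbit and stabilizer involve the pole-preserving automorphisms, whereas
      \<open>W e\<close> divides by the number of elements of \<open>Aut e\<close>.\<close>
    have "card (Aut e N) = card (Aut False N)" using card_Aut N(1) by (simp add: T_def)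
    then have os: "card {N' \<in> ?TU. r N' = R} * card (Aut e R) = fact (card U)"
      using orbit_stabilizer[OF wfT[OF N(1)]] inv(2)[OF R(2)] N(2) unfolding cls by simp
    have "(\<Sum>N'\<in>{N' \<in> ?TU. r N' = R}. c N') = (\<Sum>N'\<in>{N' \<in> ?TU. r N' = R}. c R)"
    proof (rule sum.cong[OF refl])
      fix N' assume "N' \<in> {N' \<in> ?TU. r N' = R}"
      then have "isomorphic N N'" unfolding cls by simp
      then show "c N' = c R" using inv(1)[OF R(2)] inv(1) by simp
    qed
    then have 1: "(\<Sum>N'\<in>{N' \<in> ?TU. r N' = R}. c N') = card {N' \<in> ?TU. r N' = R} * c R" by simp
    have 2: "fact (card U) = (of_nat (card {N' \<in> ?TU. r N' = R}) * of_nat (card (Aut e R)) :: rat)"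
      using arg_cong[OF os, of "of_nat :: nat \<Rightarrow> rat"] by simp
    have "card (Aut e R) \<noteq> 0"
    proof
      assume "card (Aut e R) = 0"
      then have "fact (card U) = (0 :: nat)" unfolding os[symmetric] by simp
      then show False by simp
    qed
    then show "of_nat (\<Sum>N\<in>{N \<in> ?TU. r N = R}. c N)
        = fact (card U) * (1 / of_nat (card (Aut e R)) * of_nat (c R) :: rat)"
      unfolding 1 2 by simp
  qed
  also have "\<dots> = fact (card U) * (\<Sum>R\<in>r ` ?TU. 1 / of_nat (card (Aut e R)) * of_nat (c R))"
    by (simp only: sum_distrib_left)
  also have "(\<Sum>R\<in>r ` ?TU. 1 / of_nat (card (Aut e R)) * of_nat (c R)) = coeff (W e S) M"
  proof -
    let ?F = "\<lambda>N. scale (1 / of_nat (card (Aut e N))) (\<Sum>\<sigma>\<in>Aut e N. monomial 1 (pole_free_weight e N \<sigma>))"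
    have F: "coeff (?F R) M = 1 / of_nat (card (Aut e R)) * of_nat (c R)" if "R \<in> r ` T" for R
    proof -
      have "wf_bnetwork R" using that representative(1)[OF T] wfT unfolding r_def by blast
      then show ?thesis by (simp add: coeff_W_summand c_def)
    qed
    have "coeff (formal_sum ?F (representatives T)) M = (\<Sum>R\<in>r ` ?TU. coeff (?F R) M)"
    proof (rule coeff_formal_sum_finite)
      show "r ` ?TU \<subseteq> representatives T" by (auto simp: representatives_eq r_def)
      fix R assume "R \<in> representatives T" and R: "R \<notin> r ` ?TU"
      then have R': "R \<in> r ` T" by (simp add: representatives_eq r_def)
      have RT: "R \<in> T" "r R = R"
      proof -
        obtain N where N: "N \<in> T" "R = r N" using R' by auto
        show 1: "R \<in> T" using N representative(1)[OF T] by (simp add: r_def)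
        have "isomorphic N R" using N representative(2)[OF T] by (simp add: r_def)
        then show "r R = R" using representative_eq_iff[OF T N(1) 1] N by (simp add: r_def)
      qed
      \<comment> \<open>An automorphism of weight M would give R as many labels as U has. Relabelled
        to U, the network R would then be a member of its own class on U, so R would be among the
        representatives already summed.\<close>
      have "c R = 0"
      proof (rule ccontr)
        assume "c R \<noteq> 0"
        then obtain \<sigma> where "\<sigma> \<in> Aut e R" "pole_free_weight e R \<sigma> = M"
          unfolding c_def by (metis (mono_tags, lifting) Collect_empty_eq card.empty)
        then have "card (support R) = card U" using deg_pole_free_weight wfT[OF RT(1)] M by metis
        moreover have "finite (support R)"
          using wfT[OF RT(1)] by (simp add: wf_bnetwork_def finite_internals)
        ultimately obtain f where f: "bij_betw f (support R) U"
          using U finite_same_card_bij by blast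
        obtain g where g: "bij g" "\<And>x. x \<in> support R \<Longrightarrow> g x = f x"
          using inj_on_extend_bij[OF \<open>finite (support R)\<close> bij_betw_imp_inj_on[OF f]] by blast
        let ?N = "bact False g R"
        have N: "?N \<in> T" using T RT(1) g(1) by (simp add: closed_class_def)
        have "support ?N = f ` support R" unfolding support_bact using g(2) by (simp cong: image_cong)
        then have "support ?N = U" using bij_betw_imp_surj_on[OF f] by simp
        moreover have "r ?N = r R"
          using representative_eq_iff[OF T RT(1) N] isomorphic_iff[OF wfT[OF RT(1)]] g(1)
          by (auto simp: r_def)
        ultimately show False using R N RT(2) by force
      qed
      then show "coeff (?F R) M = 0" using F[OF R'] by simp
    qed (use finT in auto)
    also have "\<dots> = (\<Sum>R\<in>r ` ?TU. 1 / of_nat (card (Aut e R)) * of_nat (c R))"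
      by (rule sum.cong[OF refl], rule F) auto
    finally show ?thesis unfolding W_def T_def[symmetric] by simp
  qed
  finally show "of_nat (card {s \<in> pairs e S U. (case s of (N, \<sigma>) \<Rightarrow> pole_free_weight e N \<sigma>) = M})
      = (fact (card U) * coeff (W e S) M)" .
qed

section \<open>Permutations that shift blocks cyclically\<close>

text \<open>A fixed bijection between A and B turns bijections into permutations of A.
  Extensionality makes each bijection a single function.\<close>

lemma card_bijections:
  assumes "finite A" "finite B" "card A = card B"
  shows "card {f \<in> extensional A. bij_betw f A B} = fact (card A)"
proof -
  obtain b where b: "bij_betw b A B" using assms finite_same_card_bij by blast
  let ?F = "\<lambda>p. restrict (b \<circ> p) A" and ?G = "\<lambda>f. perm_restrict (inv_into A b \<circ> f) A"
  have ib: "inv_into A b (b x) = x" if "x \<in> A" for x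
    using bij_betw_inv_into_left[OF b that] .
  have bi: "b (inv_into A b y) = y" "inv_into A b y \<in> A" if "y \<in> B" for y
    using bij_betw_inv_into_right[OF b that] bij_betwE[OF bij_betw_inv_into[OF b]] that by auto
  have "bij_betw ?F {p. p permutes A} {f \<in> extensional A. bij_betw f A B}"
  proof (rule bij_betw_byWitness[where f' = ?G])
    show "\<forall>p\<in>{p. p permutes A}. ?G (?F p) = p"
    proof
      fix p assume "p \<in> {p. p permutes A}"
      then have p: "p permutes A" by simp
      then show "?G (?F p) = p"
        using ib permutes_in_image[OF p] permutes_not_in[OF p]
        by (auto simp: fun_eq_iff perm_restrict_def)
    qed
    show "\<forall>f\<in>{f \<in> extensional A. bij_betw f A B}. ?F (?G f) = f"
    proof
      fix f assume "f \<in> {f \<in> extensional A. bij_betw f A B}"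
      then have f: "f \<in> extensional A" "bij_betw f A B" by auto
      then show "?F (?G f) = f"
        using bi bij_betwE[OF f(2)]
        by (auto simp: fun_eq_iff perm_restrict_def extensional_def)
    qed
    show "?F ` {p. p permutes A} \<subseteq> {f \<in> extensional A. bij_betw f A B}"
    proof (rule image_subsetI)
      fix p assume "p \<in> {p. p permutes A}"
      then have "bij_betw (b \<circ> p) A B" using bij_betw_trans[OF permutes_imp_bij b] by simp
      then have "bij_betw (restrict (b \<circ> p) A) A B" by (subst bij_betw_cong[of _ _ "b \<circ> p"]) auto
      then show "?F p \<in> {f \<in> extensional A. bij_betw f A B}" by simp
    qed
    show "?G ` {f \<in> extensional A. bij_betw f A B} \<subseteq> {p. p permutes A}"
    proof (rule image_subsetI)
      fix f assume "f \<in> {f \<in> extensional A. bij_betw f A B}"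
      then have "bij_betw (inv_into A b \<circ> f) A A"
        using bij_betw_trans[OF _ bij_betw_inv_into[OF b], of f A] by blast
      then show "?G f \<in> {p. p permutes A}"
        using perm_restrict_permutes[OF assms(1)] by (simp add: bij_betw_def)
    qed
  qed
  then show ?thesis using bij_betw_same_card card_permutations[OF refl assms(1)] by fastforce
qed

text \<open>Here V stands for the labels of the distinguished component, \<rho> for its
  automorphism, and the members are the permutations that make it part of an m-cycle of components
  with label set U.\<close>

definition cyclic_extensions :: "nat \<Rightarrow> 'a set \<Rightarrow> 'a set \<Rightarrow> ('a \<Rightarrow> 'a) \<Rightarrow> ('a \<Rightarrow> 'a) set" where
  "cyclic_extensions m U V \<rho> =
     {\<sigma>. \<sigma> permutes U \<and> cyclic_blocks \<sigma> m V \<and> spread \<sigma> m V = U \<and> (\<forall>x\<in>V. (\<sigma> ^^ m) x = \<rho> x)}"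

text \<open>The pairs are coordinates on U: the second entry is the number of the block, the first
  the position within it, measured in the first block.\<close>

lemma cyclic_extension_bij:
  assumes s: "\<sigma> \<in> cyclic_extensions m U V \<rho>"
  shows "bij_betw (\<lambda>(x, i). (\<sigma> ^^ i) x) (V \<times> {..<m}) U"
proof -
  have p: "\<sigma> permutes U" and cb: "cyclic_blocks \<sigma> m V" and sp: "spread \<sigma> m V = U"
    using s by (auto simp: cyclic_extensions_def)
  have "inj_on (\<lambda>(x, i). (\<sigma> ^^ i) x) (V \<times> {..<m})"
  proof (rule inj_onI, clarify)
    fix x i y j assume xy: "x \<in> V" "y \<in> V" "i < m" "j < m" and eq: "(\<sigma> ^^ i) x = (\<sigma> ^^ j) y"
    have "i = j"
    proof (rule ccontr)
      assume "i \<noteq> j"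
      then have "(\<sigma> ^^ i) ` V \<inter> (\<sigma> ^^ j) ` V = {}" using cb xy unfolding cyclic_blocks_def by blast
      then show False using xy eq by (metis disjoint_iff image_eqI)
    qed
    moreover have "inj (\<sigma> ^^ i)" using permutes_inj[OF p] by (rule inj_fn)
    ultimately show "x = y \<and> i = j" using eq by (simp add: inj_eq)
  qed
  moreover have "(\<lambda>(x, i). (\<sigma> ^^ i) x) ` (V \<times> {..<m}) = U"
    unfolding sp[symmetric] spread_def by auto
  ultimately show ?thesis by (simp add: bij_betw_def)
qed

lemma cyclic_extension_step:
  assumes "\<sigma> \<in> cyclic_extensions m U V \<rho>" "x \<in> V" "i < m"
  shows "\<sigma> ((\<sigma> ^^ i) x) = (if Suc i < m then (\<sigma> ^^ Suc i) x else \<rho> x)"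
proof (cases "Suc i < m")
  case False
  then have "Suc i = m" using assms(3) by simp
  then have "\<sigma> ((\<sigma> ^^ i) x) = (\<sigma> ^^ m) x" by auto
  then show ?thesis using assms False by (simp add: cyclic_extensions_def)
qed simp

text \<open>An extension \<open>\<sigma>\<close> is determined by the bijections \<open>x \<mapsto> (\<sigma> ^^ i) x\<close> from \<open>V\<close> to the other blocks,
  and these are arbitrary.\<close>

lemma card_cyclic_extensions:
  assumes U: "finite U" and V: "V \<subseteq> U" "m * card V = card U" and m: "1 \<le> m" and r: "\<rho> permutes V"
  shows "card (cyclic_extensions m U V \<rho>) = fact (card U - card V)"
proof -
  \<comment> \<open>Block 0 is V itself with the identity as coordinate, so free choices remain only
    for the blocks 1 to m - 1, which fill U - V.\<close>
  let ?D = "V \<times> {1..<m}" and ?L = "cyclic_extensions m U V \<rho>"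
  let ?B = "{f \<in> extensional ?D. bij_betw f ?D (U - V)}"
  let ?F = "\<lambda>\<sigma>. restrict (\<lambda>(x, i). (\<sigma> ^^ i) x) ?D"
  have finV: "finite V" using V(1) U finite_subset by auto
  have split: "V \<times> {..<m} = V \<times> {0} \<union> ?D" "V \<times> {0} \<inter> ?D = {}" using m by auto
  have cardD: "card ?D = card U - card V"
    unfolding V(2)[symmetric] by (simp add: card_cartesian_product diff_mult_distrib2 mult.commute)
  have "bij_betw ?F ?L ?B"
  proof (rule bij_betwI')
    fix \<sigma> \<sigma>' assume s: "\<sigma> \<in> ?L" "\<sigma>' \<in> ?L"
    show "?F \<sigma> = ?F \<sigma>' \<longleftrightarrow> \<sigma> = \<sigma>'"
    proof
      assume eq: "?F \<sigma> = ?F \<sigma>'"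
      have pow: "(\<sigma> ^^ i) x = (\<sigma>' ^^ i) x" if "x \<in> V" "i < m" for x i
        using fun_cong[OF eq, of "(x, i)"] that by (cases "i = 0") auto
      show "\<sigma> = \<sigma>'"
      proof
        fix u
        show "\<sigma> u = \<sigma>' u"
        proof (cases "u \<in> U")
          case True
          then obtain x i where "x \<in> V" "i < m" "u = (\<sigma> ^^ i) x"
            using bij_betw_imp_surj_on[OF cyclic_extension_bij[OF s(1)]] by auto
          then show ?thesis
            using cyclic_extension_step[OF s(1)] cyclic_extension_step[OF s(2)] pow by metis
        next
          case False
          then show ?thesis
            using s permutes_not_in[of \<sigma> U u] permutes_not_in[of \<sigma>' U u]
            by (simp add: cyclic_extensions_def)
        qed
      qed
    qed simp
  next
    fix \<sigma> assume s: "\<sigma> \<in> ?L"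
    let ?f = "\<lambda>(x, i). (\<sigma> ^^ i) x"
    note b = cyclic_extension_bij[OF s]
    have "?f ` ?D = ?f ` (V \<times> {..<m}) - ?f ` (V \<times> {0})"
    proof -
      have "?D = V \<times> {..<m} - V \<times> {0}" by auto
      moreover have "V \<times> {0} \<subseteq> V \<times> {..<m}" using m by auto
      ultimately show ?thesis
        using inj_on_image_set_diff[OF bij_betw_imp_inj_on[OF b], of "V \<times> {..<m}" "V \<times> {0}"]
        by (simp only: Diff_subset)
    qed
    moreover have "?f ` (V \<times> {0}) = V" by (auto simp: image_iff)
    ultimately have "?f ` ?D = U - V" using bij_betw_imp_surj_on[OF b] by simp
    moreover have "inj_on ?f ?D" using bij_betw_imp_inj_on[OF b] by (rule inj_on_subset) auto
    ultimately have "bij_betw (restrict ?f ?D) ?D (U - V)"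
      by (subst bij_betw_cong[of _ _ ?f]) (auto simp: bij_betw_def)
    then show "?F \<sigma> \<in> ?B" by simp
  next
    fix \<beta> assume "\<beta> \<in> ?B"
    then have \<beta>: "\<beta> \<in> extensional ?D" "bij_betw \<beta> ?D (U - V)" by auto
    \<comment> \<open>Conversely, \<open>B\<close> completes \<beta> by the identity on block 0, and
      \<open>s\<close> shifts the coordinates, applying \<rho> when the last block returns to the
      first. Transported to U by \<open>B\<close>, the shift becomes the required \<sigma>.\<close>
    define B where "B = (\<lambda>(x, i). if i = 0 then x else \<beta> (x, i))"
    have "bij_betw B (V \<times> {0}) V" by (rule bij_betw_byWitness[where f' = "\<lambda>x. (x, 0)"]) (auto simp: B_def)
    moreover have "bij_betw B ?D (U - V)"
      using \<beta>(2) by (subst bij_betw_cong[of _ _ \<beta>]) (auto simp: B_def)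
    ultimately have "bij_betw B (V \<times> {0} \<union> ?D) (V \<union> (U - V))"
      by (rule bij_betw_combine) auto
    moreover have "V \<union> (U - V) = U" using V(1) by auto
    ultimately have B: "bij_betw B (V \<times> {..<m}) U" by (simp only: split(1))
    define s where "s = (\<lambda>(x, i). if Suc i < m then (x, Suc i) else (\<rho> x, 0))"
    have s_surj: "s ` (V \<times> {..<m}) = V \<times> {..<m}"
    proof
      show "s ` (V \<times> {..<m}) \<subseteq> V \<times> {..<m}"
      proof (rule image_subsetI)
        fix z assume "z \<in> V \<times> {..<m}"
        then obtain x i where z: "z = (x, i)" "x \<in> V" "i < m" by auto
        then have "\<rho> x \<in> V" using permutes_in_image[OF r, of x] by simp
        moreover have "0 < m" using m by simp
        ultimately show "s z \<in> V \<times> {..<m}" using z by (cases "Suc i < m") (simp_all add: s_def)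
      qed
      show "V \<times> {..<m} \<subseteq> s ` (V \<times> {..<m})"
      proof clarify
        fix x i assume x: "x \<in> V" "i < m"
        show "(x, i) \<in> s ` (V \<times> {..<m})"
        proof (cases i)
          case 0
          have "x \<in> \<rho> ` V" using permutes_image[OF r] x(1) by simp
          then obtain y where "y \<in> V" "\<rho> y = x" by auto
          then have "(x, i) = s (y, m - 1)" "(y, m - 1) \<in> V \<times> {..<m}"
            using 0 m by (auto simp: s_def)
          then show ?thesis by blast
        next
          case (Suc j)
          then have "(x, i) = s (x, j)" "(x, j) \<in> V \<times> {..<m}" using x by (auto simp: s_def)
          then show ?thesis by blast
        qed
      qed
    qed
    define \<sigma> where "\<sigma> = perm_restrict (\<lambda>u. B (s (inv_into (V \<times> {..<m}) B u))) U"
    have \<sigma>B: "\<sigma> (B z) = B (s z)" if "z \<in> V \<times> {..<m}" for z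
      using that bij_betwE[OF B] bij_betw_inv_into_left[OF B that] by (auto simp: \<sigma>_def perm_restrict_def)
    have \<sigma>0: "\<sigma> u = u" if "u \<notin> U" for u using that by (simp add: \<sigma>_def perm_restrict_def)
    have BU: "B ` (V \<times> {..<m}) = U" using bij_betw_imp_surj_on[OF B] .
    have "\<sigma> ` U = U"
    proof -
      have "\<sigma> ` U = (\<lambda>z. \<sigma> (B z)) ` (V \<times> {..<m})" by (simp add: BU[symmetric] image_image)
      also have "\<dots> = (\<lambda>z. B (s z)) ` (V \<times> {..<m})" by (rule image_cong) (simp_all add: \<sigma>B)
      also have "\<dots> = B ` s ` (V \<times> {..<m})" by (simp add: image_image)
      finally show ?thesis by (simp add: s_surj BU)
    qed
    then have "perm_restrict \<sigma> U permutes U" using perm_restrict_permutes[OF U] by simp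
    moreover have "perm_restrict \<sigma> U = \<sigma>" using \<sigma>0 by (auto simp: perm_restrict_def)
    ultimately have perm: "\<sigma> permutes U" by simp
    have pow: "(\<sigma> ^^ i) x = B (x, i)" if "x \<in> V" "i < m" for x i
      using that(2)
    proof (induction i)
      case 0
      show ?case by (simp add: B_def)
    next
      case (Suc i)
      then show ?case using \<sigma>B[of "(x, i)"] that(1) by (simp add: s_def)
    qed
    have powm: "(\<sigma> ^^ m) x = \<rho> x" if "x \<in> V" for x
    proof -
      have "(\<sigma> ^^ m) x = \<sigma> ((\<sigma> ^^ (m - 1)) x)" using m by (cases m) auto
      also have "\<dots> = B (s (x, m - 1))" using pow[OF that, of "m - 1"] \<sigma>B[of "(x, m - 1)"] that m by simp
      also have "\<dots> = \<rho> x" using m by (simp add: s_def B_def)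
      finally show ?thesis .
    qed
    have img: "(\<sigma> ^^ i) ` V = B ` (V \<times> {i})" if "i < m" for i
    proof -
      have "(\<sigma> ^^ i) ` V = (\<lambda>x. B (x, i)) ` V" by (rule image_cong) (simp_all add: pow that)
      also have "\<dots> = B ` (V \<times> {i})" by auto
      finally show ?thesis .
    qed
    have "cyclic_blocks \<sigma> m V"
      unfolding cyclic_blocks_def
    proof (intro conjI allI impI)
      show "(\<sigma> ^^ m) ` V = V" using image_cong[OF refl powm, of V "\<lambda>x. x"] permutes_image[OF r] by simp
      fix i j assume ij: "i < m" "j < m" "i \<noteq> j"
      have "B ` (V \<times> {i}) \<inter> B ` (V \<times> {j}) = B ` (V \<times> {i} \<inter> V \<times> {j})"
        by (rule inj_on_image_Int[OF bij_betw_imp_inj_on[OF B], symmetric]) (use ij in auto)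
      then show "(\<sigma> ^^ i) ` V \<inter> (\<sigma> ^^ j) ` V = {}" using ij by (auto simp: img)
    qed (use m finV in auto)
    moreover have "spread \<sigma> m V = U"
    proof -
      have "spread \<sigma> m V = (\<Union>i<m. B ` (V \<times> {i}))" unfolding spread_def using img by simp
      also have "\<dots> = B ` (V \<times> {..<m})" by auto
      finally show ?thesis by (simp add: BU)
    qed
    ultimately have "\<sigma> \<in> ?L" using perm powm by (simp add: cyclic_extensions_def)
    moreover have "\<beta> = ?F \<sigma>"
    proof
      fix z
      show "\<beta> z = ?F \<sigma> z"
      proof (cases "z \<in> ?D")
        case True
        then obtain x i where "z = (x, i)" "x \<in> V" "i < m" "i \<noteq> 0" by auto
        then show ?thesis using pow by (simp add: B_def)
      next
        case False
        then show ?thesis using extensional_arb[OF \<beta>(1)] by (simp only: restrict_def if_False)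
      qed
    qed
    ultimately show "\<exists>\<sigma>\<in>?L. \<beta> = ?F \<sigma>" by blast
  qed
  then have "card ?L = card ?B" by (rule bij_betw_same_card)
  also have "\<dots> = fact (card U - card V)"
    using card_bijections[of ?D "U - V"] cardD U V(1) finV by (simp add: card_Diff_subset)
  finally show ?thesis .
qed

section \<open>Automorphisms of parallel compositions\<close>

abbreviation labels :: "network set \<Rightarrow> nat set" where
  "labels X \<equiv> \<Union> (internals ` X)"

lemma support_parallel: "support (parallel X) = labels X"
  by (auto simp: parallel_def internals_def)

lemma edges_parallel: "edges (fst (parallel X)) = \<Union> (edges ` X)"
  by (simp add: parallel_def)

lemma labels_act: "labels (act e f ` X) = f ` labels X"
  by (simp add: image_UN internals_act)

lemma bact_parallel: "bact e f (parallel X) = parallel (act e f ` X)"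
proof -
  have "ext e f ` {Pole0, Pole1} = {Pole0, Pole1}" by auto
  then show ?thesis
    by (simp add: parallel_def bact_def act_def graph_image_def image_Un image_UN image_image
        internals_act[unfolded act_def graph_image_def] insert_commute)
qed

lemma composable_subset: "composable X \<Longrightarrow> Y \<subseteq> X \<Longrightarrow> composable Y"
  by (auto simp: composable_def pairwise_def intro: finite_subset)

lemma composable_act:
  assumes "composable X" "inj_on f (labels X)"
  shows "composable (act e' f ` X)"
  unfolding composable_def
proof
  show "finite (act e' f ` X)" using assms(1) by (simp add: composable_def)
  show "pairwise (\<lambda>M N. internals M \<inter> internals N = {}) (act e' f ` X)"
  proof (rule pairwiseI)
    fix M' N' assume "M' \<in> act e' f ` X" "N' \<in> act e' f ` X" and ne: "M' \<noteq> N'"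
    then obtain M N where MN: "M \<in> X" "N \<in> X" "M' = act e' f M" "N' = act e' f N" by auto
    then have "M \<noteq> N" using ne by auto
    then have "internals M \<inter> internals N = {}"
      using assms(1) MN by (simp add: composable_def pairwise_def)
    moreover have "f ` internals M \<inter> f ` internals N = f ` (internals M \<inter> internals N)"
      by (rule inj_on_image_Int[OF assms(2), symmetric]) (use MN in auto)
    ultimately show "internals M' \<inter> internals N' = {}" by (simp add: MN internals_act)
  qed
qed

lemma act_inj:
  assumes "inj f"
  shows "inj (act e' f)"
proof (rule injI)
  fix G H assume eq: "act e' f G = act e' f H"
  have i: "inv f \<circ> f = id" using assms by simp
  have "act e' (inv f) (act e' f G) = act e' (inv f) (act e' f H)" using eq by simp
  then show "G = H" by (simp add: act_act i act_id)
qed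

text \<open>Fixing the flag lets both series share every lemma below. Only when the poles are
  exchanged are components carried to mirror images, and then the species has to contain
  these.\<close>

locale parallel_species =
  fixes \<N> :: "network set" and e :: bool
  assumes species: "network_species \<N>"
    and nontrivial: "\<And>N. N \<in> \<N> \<Longrightarrow> N \<noteq> trivial_network"
    and nonadjacent: "\<And>N. N \<in> \<N> \<Longrightarrow> \<not> adjacent_poles N"
    and tau: "e \<Longrightarrow> tau_closed \<N>"
begin

lemma wf: "N \<in> \<N> \<Longrightarrow> wf_network N"
  using species is_network_wf by (simp add: network_species_def)

lemma act_closed:
  assumes "N \<in> \<N>" "inj_on f (internals N)" "e' \<Longrightarrow> e"
  shows "act e' f N \<in> \<N>"
proof -
  have "ext False f = map_vertex f" by (auto simp: ext_def fun_eq_iff)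
  then have 1: "act False f N \<in> \<N>"
    using species assms(1,2) by (simp add: network_species_def act_def)
  show ?thesis
  proof (cases e')
    case True
    have "ext True id v = swap_poles v" for v by (cases v) auto
    then have "ext True id = swap_poles" by auto
    then have "act True id (act False f N) \<in> \<N>"
      using tau assms(3) True 1 by (simp add: tau_closed_def act_def[of True id])
    then show ?thesis using True by (simp add: act_act)
  qed (use 1 in simp)
qed

text \<open>All vertices other than the internal ones are poles, and an edge has two endpoints, so
  the only exception would be an edge joining the poles.\<close>

lemma edge_internal:
  assumes "N \<in> \<N>" "d \<in> edges N"
  shows "\<exists>x\<in>internals N. Internal x \<in> d"
proof (rule ccontr)
  assume "\<not> ?thesis"
  moreover have "d \<subseteq> verts N" using assms(2) wf[OF assms(1)] by (simp add: wf_network_def)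
  ultimately have "d \<subseteq> {Pole0, Pole1}" unfolding verts_eq[OF wf[OF assms(1)]] by blast
  moreover have "card d = 2"
    using assms species by (simp add: network_species_def is_network_def simple_graph_def)
  ultimately have "d = {Pole0, Pole1}" by (intro card_subset_eq) auto
  then show False using nonadjacent[OF assms(1)] assms(2) by (simp add: adjacent_poles_def)
qed

text \<open>Without internal vertices there can be no edge either, which leaves only the trivial
  network. Thus components with disjoint label sets are distinct.\<close>

lemma internals_nonempty:
  assumes "N \<in> \<N>"
  shows "internals N \<noteq> {}"
proof
  assume "internals N = {}"
  then have "verts N = {Pole0, Pole1}" "edges N = {}"
    using verts_eq[OF wf[OF assms]] edge_internal[OF assms] by auto
  then show False using nontrivial[OF assms] by (metis trivial_network_def graph.collapse)
qed

lemma internals_inj: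
  assumes "X \<subseteq> \<N>" "composable X" "N \<in> X" "N' \<in> X" "x \<in> internals N" "x \<in> internals N'"
  shows "N = N'"
  using assms unfolding composable_def pairwise_def by blast

lemma edges_disjoint:
  assumes "N \<in> \<N>" "N' \<in> \<N>" "internals N \<inter> internals N' = {}"
  shows "edges N \<inter> edges N' = {}"
proof (rule ccontr)
  assume "\<not> ?thesis"
  then obtain d where d: "d \<in> edges N" "d \<in> edges N'" by auto
  then obtain x where "x \<in> internals N" "Internal x \<in> d" using edge_internal[OF assms(1)] by auto
  moreover have "x \<in> internals N'"
    using wf[OF assms(2)] d(2) \<open>Internal x \<in> d\<close> by (auto simp: wf_network_def internals_def)
  ultimately show False using assms(3) by auto
qed

lemma wf_parallel:
  assumes "X \<subseteq> \<N>" "composable X"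
  shows "wf_bnetwork (parallel X)"
proof -
  have "finite (verts (fst (parallel X)))"
    using assms wf by (auto simp: parallel_def composable_def wf_network_def)
  moreover have "d \<subseteq> verts (fst (parallel X))" if d: "d \<in> edges (fst (parallel X))" for d
  proof -
    obtain N where "N \<in> X" "d \<in> edges N" using d by (auto simp: parallel_def)
    then have "d \<subseteq> verts N" using assms(1) wf by (auto simp: wf_network_def)
    then show ?thesis using \<open>N \<in> X\<close> by (auto simp: parallel_def)
  qed
  moreover have "B \<subseteq> labels X" if "B \<in> snd (parallel X)" for B
    using that by (auto simp: parallel_def)
  ultimately show ?thesis
    unfolding wf_bnetwork_def wf_network_def support_parallel by (auto simp: parallel_def)
qed

lemma finite_labels: "X \<subseteq> \<N> \<Longrightarrow> composable X \<Longrightarrow> finite (labels X)"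
  using finite_internals wf by (auto simp: composable_def)

lemma act_subset:
  assumes "X \<subseteq> \<N>" "inj_on f (labels X)" "e' \<Longrightarrow> e"
  shows "act e' f ` X \<subseteq> \<N>"
proof (rule image_subsetI)
  fix N assume N: "N \<in> X"
  then have "inj_on f (internals N)" using assms(2) by (auto intro: inj_on_subset)
  then show "act e' f N \<in> \<N>" using act_closed assms N by blast
qed

text \<open>An internal endpoint decides to which component an edge belongs, so a component can be
  cut out of the union by means of its label set.\<close>

lemma edges_of_component:
  assumes "X \<subseteq> \<N>" "composable X" "N \<in> X"
  shows "edges N = {d \<in> edges (fst (parallel X)). \<exists>x\<in>internals N. Internal x \<in> d}"
proof
  show "edges N \<subseteq> {d \<in> edges (fst (parallel X)). \<exists>x\<in>internals N. Internal x \<in> d}"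
    using assms edge_internal by (auto simp: edges_parallel)
  show "{d \<in> edges (fst (parallel X)). \<exists>x\<in>internals N. Internal x \<in> d} \<subseteq> edges N"
  proof clarify
    fix d x assume d: "d \<in> edges (fst (parallel X))" and x: "x \<in> internals N" "Internal x \<in> d"
    then obtain N' where N': "N' \<in> X" "d \<in> edges N'" by (auto simp: edges_parallel)
    then have "x \<in> internals N'"
      using wf[of N'] assms(1) x by (auto simp: wf_network_def internals_def)
    then show "d \<in> edges N" using internals_inj[OF assms(1,2,3) N'(1) x(1)] N' by simp
  qed
qed

text \<open>The blocks provide the vertices of each component and the graph its edges, so a
  composition determines its set of components. The graph alone would not, as a component may itself
  be a parallel composition.\<close>

lemma parallel_eq_subset:
  assumes X: "X \<subseteq> \<N>" "composable X" and Y: "Y \<subseteq> \<N>" "composable Y"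
    and eq: "parallel X = parallel Y"
  shows "X \<subseteq> Y"
proof
  fix N assume N: "N \<in> X"
  then have "internals N \<in> snd (parallel Y)" unfolding eq[symmetric] by (simp add: parallel_def)
  then obtain N' where N': "N' \<in> Y" "internals N = internals N'" by (auto simp: parallel_def)
  have "edges N = edges N'"
    using edges_of_component[OF X N] edges_of_component[OF Y N'(1)] N'(2) eq by simp
  moreover have "verts N = verts N'"
    using verts_eq wf N N' X(1) Y(1) by (metis subsetD)
  ultimately have "N = N'" by (metis graph.collapse)
  then show "N \<in> Y" using N' by simp
qed

lemma closed_class_plain: "closed_class (plain \<N>)"
  unfolding closed_class_def
proof (intro ballI conjI allI impI)
  fix N assume "N \<in> plain \<N>"
  then obtain G where G: "G \<in> \<N>" "N = (G, {})" by (auto simp: plain_def)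
  show "wf_bnetwork N" using G wf by (simp add: wf_bnetwork_def)
  fix f :: "nat \<Rightarrow> nat" assume "bij f"
  then have "inj_on f (internals G)" using inj_on_subset[OF bij_is_inj] by blast
  then have "act False f G \<in> \<N>" using act_closed[OF G(1)] by simp
  then show "bact False f N \<in> plain \<N>" by (simp add: G bact_def plain_def)
qed

lemma bact_parallel_closed:
  assumes "X \<subseteq> \<N>" "composable X" "bij f"
  obtains Y where "Y \<subseteq> \<N>" "composable Y" "card Y = card X" "bact False f (parallel X) = parallel Y"
proof
  have inj: "inj_on f (labels X)" using assms(3) bij_is_inj inj_on_subset by blast
  show "act False f ` X \<subseteq> \<N>" using act_subset[OF assms(1) inj] by simp
  show "composable (act False f ` X)" by (rule composable_act[OF assms(2) inj])
  show "card (act False f ` X) = card X"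
    using act_inj[OF bij_is_inj[OF assms(3)]] by (auto intro: card_image inj_on_subset)
  show "bact False f (parallel X) = parallel (act False f ` X)" by (rule bact_parallel)
qed

section \<open>Compositions as sets of components\<close>

text \<open>The predicate on the number of components lets \<open>E\<close> and \<open>E2\<close>
  share closure and enumeration.\<close>

definition compositions :: "(nat \<Rightarrow> bool) \<Rightarrow> bnetwork set" where
  "compositions Q = {parallel X | X. X \<subseteq> \<N> \<and> composable X \<and> Q (card X)}"

lemma E_eq: "E \<N> = compositions (\<lambda>_. True)"
  and E2_eq: "E2 \<N> = compositions (\<lambda>n. n = 2)"
  by (simp_all add: E_def E2_def compositions_def)

lemma closed_class_compositions: "closed_class (compositions Q)"
  unfolding closed_class_def
proof (intro ballI conjI allI impI)
  fix N assume "N \<in> compositions Q"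
  then obtain X where X: "X \<subseteq> \<N>" "composable X" "N = parallel X" "Q (card X)"
    by (auto simp: compositions_def)
  show "wf_bnetwork N" using wf_parallel X by simp
  fix f :: "nat \<Rightarrow> nat" assume "bij f"
  then obtain Y where "Y \<subseteq> \<N>" "composable Y" "card Y = card X" "bact False f N = parallel Y"
    using bact_parallel_closed[OF X(1,2)] unfolding X(3) by blast
  then show "bact False f N \<in> compositions Q"
    using X(4) unfolding compositions_def by auto
qed

definition automorphic :: "nat set \<Rightarrow> (network set \<times> (nat \<Rightarrow> nat)) set" where
  "automorphic U = {(X, \<sigma>). X \<subseteq> \<N> \<and> composable X \<and> labels X = U \<and> \<sigma> permutes U \<and> act e \<sigma> ` X = X}"

definition cweight :: "network set \<times> (nat \<Rightarrow> nat) \<Rightarrow> ivar multiset" where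
  "cweight = (\<lambda>(X, \<sigma>). wt (Internal ` labels X) (\<Union> (edges ` X)) (ext e \<sigma>))"

text \<open>An automorphism maps the composition to the composition of the images of the components;
  uniqueness of the components turns equality of the compositions into equality of these
  sets.\<close>

lemma Aut_parallel:
  assumes X: "X \<subseteq> \<N>" "composable X" and s: "\<sigma> permutes labels X"
  shows "\<sigma> \<in> Aut e (parallel X) \<longleftrightarrow> act e \<sigma> ` X = X"
proof
  assume "act e \<sigma> ` X = X"
  then show "\<sigma> \<in> Aut e (parallel X)" using s by (simp add: Aut_def support_parallel bact_parallel)
next
  assume "\<sigma> \<in> Aut e (parallel X)"
  then have eq: "parallel (act e \<sigma> ` X) = parallel X" by (simp add: Aut_def bact_parallel)
  have inj: "inj_on \<sigma> (labels X)" using permutes_inj[OF s] inj_on_subset by blast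
  have "act e \<sigma> ` X \<subseteq> \<N>" "composable (act e \<sigma> ` X)"
    using act_subset[OF X(1) inj] composable_act[OF X(2) inj] by auto
  then show "act e \<sigma> ` X = X"
    using parallel_eq_subset[OF _ _ X eq] parallel_eq_subset[OF X _ _ eq[symmetric]] by blast
qed

lemma bij_betw_automorphic_pairs:
  "bij_betw (\<lambda>(X, \<sigma>). (parallel X, \<sigma>)) {(X, \<sigma>) \<in> automorphic U. Q (card X)}
    (pairs e (compositions Q) U)"
  unfolding bij_betw_def
proof
  show "inj_on (\<lambda>(X, \<sigma>). (parallel X, \<sigma>)) {(X, \<sigma>) \<in> automorphic U. Q (card X)}"
  proof (rule inj_onI, clarsimp)
    fix X Y \<sigma> assume "(X, \<sigma>) \<in> automorphic U" "(Y, \<sigma>) \<in> automorphic U" and eq: "parallel X = parallel Y"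
    then have "X \<subseteq> \<N>" "composable X" "Y \<subseteq> \<N>" "composable Y" by (auto simp: automorphic_def)
    then show "X = Y" using parallel_eq_subset eq by (metis subset_antisym)
  qed
  show "(\<lambda>(X, \<sigma>). (parallel X, \<sigma>)) ` {(X, \<sigma>) \<in> automorphic U. Q (card X)}
      = pairs e (compositions Q) U"
  proof
    show "(\<lambda>(X, \<sigma>). (parallel X, \<sigma>)) ` {(X, \<sigma>) \<in> automorphic U. Q (card X)}
      \<subseteq> pairs e (compositions Q) U"
    proof clarsimp
      fix X \<sigma> assume "(X, \<sigma>) \<in> automorphic U" "Q (card X)"
      then show "(parallel X, \<sigma>) \<in> pairs e (compositions Q) U"
        using Aut_parallel[of X \<sigma>] by (auto simp: automorphic_def pairs_def support_parallel compositions_def)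
    qed
    show "pairs e (compositions Q) U
      \<subseteq> (\<lambda>(X, \<sigma>). (parallel X, \<sigma>)) ` {(X, \<sigma>) \<in> automorphic U. Q (card X)}"
    proof
      fix s assume "s \<in> pairs e (compositions Q) U"
      then obtain X \<sigma> where X: "s = (parallel X, \<sigma>)" "X \<subseteq> \<N>" "composable X" "Q (card X)"
        "labels X = U" "\<sigma> \<in> Aut e (parallel X)"
        by (auto simp: pairs_def support_parallel compositions_def)
      then have "\<sigma> permutes labels X" by (simp add: Aut_def support_parallel)
      then have "(X, \<sigma>) \<in> automorphic U"
        using Aut_parallel[OF X(2,3)] X by (simp add: automorphic_def)
      then show "s \<in> (\<lambda>(X, \<sigma>). (parallel X, \<sigma>)) ` {(X, \<sigma>) \<in> automorphic U. Q (card X)}"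
        using X by force
    qed
  qed
qed

lemma enumerates_automorphic:
  "enumerates (\<lambda>U. {(X, \<sigma>) \<in> automorphic U. Q (card X)}) cweight
    (W e (compositions Q))"
  by (rule enumerates_bij[OF enumerates_pairs[OF closed_class_compositions] bij_betw_automorphic_pairs])
    (auto simp: cweight_def pole_free_weight_def support_parallel edges_parallel)

lemma automorphicD:
  assumes "(X, \<sigma>) \<in> automorphic U"
  shows "X \<subseteq> \<N>" "composable X" "labels X = U" "\<sigma> permutes U" "act e \<sigma> ` X = X" "finite X" "finite U"
    "inj_on (act e \<sigma>) X"
proof -
  show 1: "X \<subseteq> \<N>" "composable X" "labels X = U" "\<sigma> permutes U" "act e \<sigma> ` X = X"
    using assms by (auto simp: automorphic_def)
  show 2: "finite X" using 1(2) by (simp add: composable_def)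
  show "finite U" using finite_labels[OF 1(1,2)] 1(3) by simp
  show "inj_on (act e \<sigma>) X" using 1(5) 2 by (simp add: eq_card_imp_inj_on)
qed

lemma ext_invariant:
  assumes "Y \<subseteq> \<N>" "act e \<sigma> ` Y = Y"
  shows "ext e \<sigma> ` Internal ` labels Y = Internal ` labels Y"
    and "(`) (ext e \<sigma>) ` (\<Union> (edges ` Y)) = \<Union> (edges ` Y)"
proof -
  have "\<sigma> ` labels Y = labels Y" using labels_act[of e \<sigma> Y] assms(2) by simp
  moreover have "ext e \<sigma> ` Internal ` labels Y = Internal ` \<sigma> ` labels Y"
    by (simp add: image_image)
  ultimately show "ext e \<sigma> ` Internal ` labels Y = Internal ` labels Y" by simp
  have "(`) (ext e \<sigma>) ` (\<Union> (edges ` Y)) = \<Union> (edges ` act e \<sigma> ` Y)"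
    by (simp add: image_UN edges_act)
  then show "(`) (ext e \<sigma>) ` (\<Union> (edges ` Y)) = \<Union> (edges ` Y)" by (simp only: assms(2))
qed

lemma ext_cong_labels:
  assumes "Y \<subseteq> \<N>" "\<And>x. x \<in> labels Y \<Longrightarrow> \<sigma> x = \<sigma>' x" "v \<in> Internal ` labels Y \<union> \<Union> (\<Union> (edges ` Y))"
  shows "ext e' \<sigma> v = ext e' \<sigma>' v"
proof (cases v)
  case (Internal x)
  have "x \<in> labels Y"
  proof (cases "v \<in> Internal ` labels Y")
    case False
    then obtain N d where "N \<in> Y" "d \<in> edges N" "v \<in> d" using assms(3) by auto
    then have "v \<in> verts N" using assms(1) wf by (auto simp: wf_network_def)
    then show ?thesis using \<open>N \<in> Y\<close> Internal by (auto simp: internals_def)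
  qed (use Internal in auto)
  then show ?thesis using assms(2) Internal by simp
qed auto

lemma act_cong_labels:
  assumes "Y \<subseteq> \<N>" "\<And>x. x \<in> labels Y \<Longrightarrow> \<sigma> x = \<sigma>' x" "N \<in> Y"
  shows "act e' \<sigma> N = act e' \<sigma>' N"
  by (rule act_cong) (use assms wf in auto)

lemma cweight_cong:
  assumes Y: "Y \<subseteq> \<N>" "composable Y" "act e \<sigma> ` Y = Y" and eq: "\<And>x. x \<in> labels Y \<Longrightarrow> \<sigma>' x = \<sigma> x"
  shows "cweight (Y, \<sigma>') = cweight (Y, \<sigma>)"
  unfolding cweight_def prod.case
proof (rule wt_cong)
  show "finite (Internal ` labels Y)" using finite_labels[OF Y(1,2)] by simp
  show "finite (\<Union> (edges ` Y))" using Y finite_edges wf by (auto simp: composable_def)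
  show "ext e \<sigma> v \<in> Internal ` labels Y" if "v \<in> Internal ` labels Y" for v
    using that ext_invariant(1)[OF Y(1,3)] by blast
  show "ext e \<sigma> ` d \<in> \<Union> (edges ` Y)" if "d \<in> \<Union> (edges ` Y)" for d
    using that ext_invariant(2)[OF Y(1,3)] by blast
  show "ext e \<sigma>' v = ext e \<sigma> v" if "v \<in> Internal ` labels Y \<union> \<Union> (\<Union> (edges ` Y))" for v
    using ext_cong_labels[OF Y(1) eq that] .
qed

text \<open>The permutation has to be the identity off the remaining labels, hence the restriction;
  cycles of components and weights in Y depend only on its values on the labels of Y.\<close>

lemma automorphic_restrict:
  assumes X: "(X, \<sigma>) \<in> automorphic U" and Y: "Y \<subseteq> X" "act e \<sigma> ` Y = Y"
  shows "(Y, perm_restrict \<sigma> (labels Y)) \<in> automorphic (labels Y)"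
    and "\<And>N. N \<in> Y \<Longrightarrow> orbit (act e (perm_restrict \<sigma> (labels Y))) N = orbit (act e \<sigma>) N"
    and "cweight (Y, perm_restrict \<sigma> (labels Y)) = cweight (Y, \<sigma>)"
proof -
  note D = automorphicD[OF X]
  have YN: "Y \<subseteq> \<N>" and cY: "composable Y" using D Y composable_subset by auto
  have eq: "act e (perm_restrict \<sigma> (labels Y)) N = act e \<sigma> N" if "N \<in> Y" for N
    by (rule act_cong_labels[OF YN _ that]) (simp add: perm_restrict_def)
  have "\<sigma> ` labels Y = labels Y" using labels_act[of e \<sigma> Y] Y(2) by simp
  then have "perm_restrict \<sigma> (labels Y) permutes labels Y"
    using perm_restrict_permutes[OF finite_labels[OF YN cY]] by simp
  moreover have "act e (perm_restrict \<sigma> (labels Y)) ` Y = Y"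
    using image_cong[OF refl eq, of Y "\<lambda>N. N"] Y(2) by simp
  ultimately show "(Y, perm_restrict \<sigma> (labels Y)) \<in> automorphic (labels Y)"
    using YN cY by (simp add: automorphic_def)
  show "orbit (act e (perm_restrict \<sigma> (labels Y))) N = orbit (act e \<sigma>) N" if "N \<in> Y" for N
    by (rule orbit_cong_on[of Y]) (use Y(2) eq that in auto)
  show "cweight (Y, perm_restrict \<sigma> (labels Y)) = cweight (Y, \<sigma>)"
    by (rule cweight_cong[OF YN cY Y(2)]) (simp add: perm_restrict_def)
qed

lemma labels_disjoint:
  assumes "X \<subseteq> \<N>" "composable X" "Y \<subseteq> X" "Z \<subseteq> X" "Y \<inter> Z = {}"
  shows "labels Y \<inter> labels Z = {}" "\<Union> (edges ` Y) \<inter> \<Union> (edges ` Z) = {}"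
proof -
  have d: "internals M \<inter> internals N = {}" if "M \<in> Y" "N \<in> Z" for M N
  proof -
    have "M \<noteq> N" "M \<in> X" "N \<in> X" using that assms by auto
    then show ?thesis using assms(2) by (simp add: composable_def pairwise_def)
  qed
  then show "labels Y \<inter> labels Z = {}" by blast
  have "edges M \<inter> edges N = {}" if "M \<in> Y" "N \<in> Z" for M N
    using edges_disjoint[OF _ _ d[OF that]] that assms by blast
  then show "\<Union> (edges ` Y) \<inter> \<Union> (edges ` Z) = {}" by blast
qed

lemma cweight_split:
  assumes X: "(X, \<sigma>) \<in> automorphic U" and Y: "Y \<subseteq> X" "act e \<sigma> ` Y = Y" "act e \<sigma> ` (X - Y) = X - Y"
  shows "cweight (X, \<sigma>) = cweight (Y, \<sigma>) + cweight (X - Y, \<sigma>)"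
proof -
  note D = automorphicD[OF X]
  let ?Z = "X - Y"
  have YN: "Y \<subseteq> \<N>" "?Z \<subseteq> \<N>" and c: "composable Y" "composable ?Z"
    using D Y composable_subset by auto
  have un: "labels X = labels Y \<union> labels ?Z" "\<Union> (edges ` X) = \<Union> (edges ` Y) \<union> \<Union> (edges ` ?Z)"
    using Y(1) by auto
  have disj: "labels Y \<inter> labels ?Z = {}" "\<Union> (edges ` Y) \<inter> \<Union> (edges ` ?Z) = {}"
    using labels_disjoint[OF D(1,2) Y(1), of ?Z] by auto
  have fe: "finite (\<Union> (edges ` Y))" "finite (\<Union> (edges ` ?Z))"
    using YN c finite_edges wf by (auto simp: composable_def)
  show ?thesis unfolding cweight_def prod.case un image_Un
  proof (rule wt_Un)
    show "finite (Internal ` labels Y)" "finite (Internal ` labels ?Z)"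
      using finite_labels[OF YN(1) c(1)] finite_labels[OF YN(2) c(2)] by simp_all
    show "Internal ` labels Y \<inter> Internal ` labels ?Z = {}" using disj(1) by blast
  qed (simp_all only: fe disj ext_invariant[OF YN(1) Y(2)] ext_invariant[OF YN(2) Y(3)] subset_refl)
qed

text \<open>Inverse to restriction: the two permutations move disjoint sets of labels, so their
  composition agrees with each of them on its own components.\<close>

lemma automorphic_join:
  assumes Y: "(Y, \<sigma>1) \<in> automorphic V" and Z: "(Z, \<sigma>2) \<in> automorphic V'" and disj: "V \<inter> V' = {}"
  shows "(Y \<union> Z, \<sigma>1 \<circ> \<sigma>2) \<in> automorphic (V \<union> V')"
    and "Y \<inter> Z = {}"
    and "\<And>N. N \<in> Y \<Longrightarrow> orbit (act e (\<sigma>1 \<circ> \<sigma>2)) N = orbit (act e \<sigma>1) N"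
    and "\<And>N. N \<in> Z \<Longrightarrow> orbit (act e (\<sigma>1 \<circ> \<sigma>2)) N = orbit (act e \<sigma>2) N"
    and "perm_restrict (\<sigma>1 \<circ> \<sigma>2) V = \<sigma>1" "perm_restrict (\<sigma>1 \<circ> \<sigma>2) V' = \<sigma>2"
proof -
  note D = automorphicD[OF Y] and D' = automorphicD[OF Z]
  have on1: "(\<sigma>1 \<circ> \<sigma>2) x = \<sigma>1 x" if "x \<in> V" for x
  proof -
    have "x \<notin> V'" using that disj by blast
    then show ?thesis using permutes_not_in[OF D'(4)] by simp
  qed
  have on2: "(\<sigma>1 \<circ> \<sigma>2) x = \<sigma>2 x" if "x \<in> V'" for x
  proof -
    have "\<sigma>2 x \<notin> V" using that disj permutes_in_image[OF D'(4), of x] by blast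
    then show ?thesis using permutes_not_in[OF D(4)] by simp
  qed
  have eq1: "act e (\<sigma>1 \<circ> \<sigma>2) N = act e \<sigma>1 N" if "N \<in> Y" for N
    by (rule act_cong_labels[OF D(1) _ that]) (use on1 D(3) in simp)
  have eq2: "act e (\<sigma>1 \<circ> \<sigma>2) N = act e \<sigma>2 N" if "N \<in> Z" for N
    by (rule act_cong_labels[OF D'(1) _ that]) (use on2 D'(3) in simp)
  show "perm_restrict (\<sigma>1 \<circ> \<sigma>2) V = \<sigma>1"
    using on1 permutes_not_in[OF D(4)] by (auto simp: perm_restrict_def fun_eq_iff)
  show "perm_restrict (\<sigma>1 \<circ> \<sigma>2) V' = \<sigma>2"
    using on2 permutes_not_in[OF D'(4)] by (auto simp: perm_restrict_def fun_eq_iff)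
  show "orbit (act e (\<sigma>1 \<circ> \<sigma>2)) N = orbit (act e \<sigma>1) N" if "N \<in> Y" for N
    by (rule orbit_cong_on[of Y]) (use D(5) eq1 that in auto)
  show "orbit (act e (\<sigma>1 \<circ> \<sigma>2)) N = orbit (act e \<sigma>2) N" if "N \<in> Z" for N
    by (rule orbit_cong_on[of Z]) (use D'(5) eq2 that in auto)
  have ii: "internals M \<inter> internals N = {}" if "M \<in> Y" "N \<in> Z" for M N
    using that D(3) D'(3) disj by blast
  show "Y \<inter> Z = {}"
  proof (rule ccontr)
    assume "Y \<inter> Z \<noteq> {}"
    then obtain N where "N \<in> Y" "N \<in> Z" by auto
    then show False using ii[of N N] internals_nonempty[of N] D(1) by auto
  qed
  have "composable (Y \<union> Z)"
    unfolding composable_def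
  proof
    show "pairwise (\<lambda>M N. internals M \<inter> internals N = {}) (Y \<union> Z)"
    proof (rule pairwiseI)
      fix M N assume MN: "M \<in> Y \<union> Z" "N \<in> Y \<union> Z" "M \<noteq> N"
      consider "M \<in> Y" "N \<in> Y" | "M \<in> Z" "N \<in> Z" | "M \<in> Y" "N \<in> Z" | "M \<in> Z" "N \<in> Y"
        using MN by blast
      then show "internals M \<inter> internals N = {}"
      proof cases
        case 1
        then show ?thesis using D(2) MN(3) by (simp add: composable_def pairwise_def)
      next
        case 2
        then show ?thesis using D'(2) MN(3) by (simp add: composable_def pairwise_def)
      next
        case 3
        then show ?thesis by (rule ii)
      next
        case 4
        then show ?thesis using ii[of N M] by blast
      qed
    qed
  qed (use D(6) D'(6) in auto)
  moreover have "act e (\<sigma>1 \<circ> \<sigma>2) ` (Y \<union> Z) = Y \<union> Z"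
  proof -
    have "act e (\<sigma>1 \<circ> \<sigma>2) ` Y = Y" using image_cong[OF refl eq1, of Y "\<lambda>N. N"] D(5) by simp
    moreover have "act e (\<sigma>1 \<circ> \<sigma>2) ` Z = Z" using image_cong[OF refl eq2, of Z "\<lambda>N. N"] D'(5) by simp
    ultimately show ?thesis by (simp add: image_Un)
  qed
  moreover have "\<sigma>1 \<circ> \<sigma>2 permutes V \<union> V'"
    using permutes_compose[OF permutes_subset[OF D'(4), of "V \<union> V'"] permutes_subset[OF D(4), of "V \<union> V'"]]
    by simp
  ultimately show "(Y \<union> Z, \<sigma>1 \<circ> \<sigma>2) \<in> automorphic (V \<union> V')"
    using D(1,3) D'(1,3) by (simp add: automorphic_def)
qed

section \<open>Decomposition into cycles of components\<close>

definition with_orbits :: "nat \<Rightarrow> nat set \<Rightarrow> nat set \<Rightarrow> (network set \<times> (nat \<Rightarrow> nat)) set" where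
  "with_orbits k J U = {(X, \<sigma>) \<in> automorphic U.
     card (orbit (act e \<sigma>) ` X) = k \<and> (\<forall>N\<in>X. card (orbit (act e \<sigma>) N) \<in> J)}"

lemma with_orbits_1D:
  assumes "(Y, \<sigma>) \<in> with_orbits 1 J V"
  shows "Y \<noteq> {}" "\<And>N. N \<in> Y \<Longrightarrow> orbit (act e \<sigma>) N = Y" "card Y \<in> J"
proof -
  have Y: "(Y, \<sigma>) \<in> automorphic V" and 1: "card (orbit (act e \<sigma>) ` Y) = 1"
    and J: "\<And>N. N \<in> Y \<Longrightarrow> card (orbit (act e \<sigma>) N) \<in> J"
    using assms by (auto simp: with_orbits_def)
  show ne: "Y \<noteq> {}" using 1 by auto
  obtain C where C: "orbit (act e \<sigma>) ` Y = {C}" using 1 by (meson card_1_singletonE)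
  have "Y = C" using Union_orbits[OF automorphicD(6,5)[OF Y]] unfolding C by simp
  then show *: "orbit (act e \<sigma>) N = Y" if "N \<in> Y" for N using C that by blast
  show "card Y \<in> J" using ne * J by force
qed

lemma with_orbits_1I:
  assumes "(Y, \<sigma>) \<in> automorphic V" "Y \<noteq> {}" "\<And>N. N \<in> Y \<Longrightarrow> orbit (act e \<sigma>) N = Y" "card Y \<in> J"
  shows "(Y, \<sigma>) \<in> with_orbits 1 J V"
proof -
  have "orbit (act e \<sigma>) ` Y = {Y}" using assms(2,3) by auto
  then show ?thesis using assms by (simp add: with_orbits_def)
qed

text \<open>For a single cycle the length is the number of components, so J restricts
  \<open>card Y\<close>; unions and disjointness over J can then be read off.\<close>

lemma with_orbits_1_eq:
  "with_orbits 1 J U =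
     {(Y, \<sigma>) \<in> automorphic U. Y \<noteq> {} \<and> (\<forall>N\<in>Y. orbit (act e \<sigma>) N = Y) \<and> card Y \<in> J}"
  (is "_ = ?R")
proof
  show "with_orbits 1 J U \<subseteq> ?R"
  proof (rule subrelI)
    fix Y \<sigma> assume Y: "(Y, \<sigma>) \<in> with_orbits 1 J U"
    then have "(Y, \<sigma>) \<in> automorphic U" by (simp add: with_orbits_def)
    then show "(Y, \<sigma>) \<in> ?R" using with_orbits_1D[OF Y] by simp
  qed
  show "?R \<subseteq> with_orbits 1 J U" by (rule subrelI, rule with_orbits_1I) simp_all
qed

text \<open>Marking one of the \<open>Suc k\<close> cycles splits the pair into a transitive pair
  and one with k cycles. Conversely such pairs on complementary label sets are joined, and the first
  one is marked.\<close>

lemma enumerates_with_orbits_Suc: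
  assumes C: "enumerates (with_orbits 1 J) cweight C"
    and f: "enumerates (with_orbits k J) cweight f"
  shows "enumerates (with_orbits (Suc k) J) cweight (scale (1 / of_nat (Suc k)) (C * f))"
proof (rule enumerates_marked)
  let ?A = "\<lambda>s :: network set \<times> (nat \<Rightarrow> nat). orbit (act e (snd s)) ` fst s"
  let ?G = "\<lambda>U. {(V, s, t). V \<subseteq> U \<and> s \<in> with_orbits 1 J V \<and> t \<in> with_orbits k J (U - V)}"
  let ?j = "\<lambda>((X, \<sigma>), Y). (labels Y, (Y, perm_restrict \<sigma> (labels Y)),
    (X - Y, perm_restrict \<sigma> (labels (X - Y))))"
  let ?i = "\<lambda>(V, (Y, \<sigma>1), (Z, \<sigma>2)). ((Y \<union> Z, \<sigma>1 \<circ> \<sigma>2), Y)"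
  show "card (?A s) = Suc k" if "s \<in> with_orbits (Suc k) J U" for U s
    using that by (auto simp: with_orbits_def)
  have split: "Y \<subseteq> X \<and> act e \<sigma> ` Y = Y \<and> act e \<sigma> ` (X - Y) = X - Y"
    if X: "(X, \<sigma>) \<in> automorphic U" and Y: "Y \<in> orbit (act e \<sigma>) ` X" for X \<sigma> Y U
  proof -
    note D = automorphicD[OF X]
    obtain N where N: "N \<in> X" "Y = orbit (act e \<sigma>) N" using Y by auto
    have 1: "Y \<subseteq> X" unfolding N using orbit_subset_closed[of X "act e \<sigma>" N] D(5) N(1) by blast
    have 2: "act e \<sigma> ` Y = Y" unfolding N by (rule orbit_image_self[OF self_in_orbit[OF D(6,5) N(1)]])
    have "act e \<sigma> ` (X - Y) = X - Y"
      using inj_on_image_set_diff[OF D(8), of X Y] 1 2 D(5) by auto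
    then show ?thesis using 1 2 by simp
  qed
  show "enumerates (\<lambda>U. SIGMA s:with_orbits (Suc k) J U. ?A s) (cweight \<circ> fst) (C * f)"
  proof (rule enumerates_bij[OF enumerates_times[OF C f], of ?j])
    fix U :: "nat set" and s
    assume s: "s \<in> (SIGMA s:with_orbits (Suc k) J U. ?A s)"
    then obtain X \<sigma> Y where s': "s = ((X, \<sigma>), Y)" and X: "(X, \<sigma>) \<in> automorphic U"
      and Y: "Y \<in> orbit (act e \<sigma>) ` X" by (auto simp: with_orbits_def)
    note sp = split[OF X Y]
    show "(case ?j s of (V, s, t) \<Rightarrow> cweight s + cweight t) = (cweight \<circ> fst) s"
      using cweight_split[OF X, of Y] automorphic_restrict(3)[OF X, of Y]
        automorphic_restrict(3)[OF X, of "X - Y"] sp by (simp add: s')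
  next
    fix U :: "nat set" assume U: "finite U"
    show "bij_betw ?j (SIGMA s:with_orbits (Suc k) J U. ?A s) (?G U)"
    proof (rule bij_betw_byWitness[where f' = ?i])
      have left: "?i (?j s) = s \<and> ?j s \<in> ?G U" if s: "s \<in> (SIGMA s:with_orbits (Suc k) J U. ?A s)" for s
      proof -
        obtain X \<sigma> Y where s': "s = ((X, \<sigma>), Y)" and X: "(X, \<sigma>) \<in> automorphic U"
          and Y: "Y \<in> orbit (act e \<sigma>) ` X" and k: "card (orbit (act e \<sigma>) ` X) = Suc k"
          and J: "\<And>N. N \<in> X \<Longrightarrow> card (orbit (act e \<sigma>) N) \<in> J"
          using s by (auto simp: with_orbits_def)
        note D = automorphicD[OF X] and sp = split[OF X Y]
        let ?Z = "X - Y"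
        have disj: "labels Y \<inter> labels ?Z = {}"
          using labels_disjoint(1)[OF D(1,2), of Y ?Z] sp by auto
        have un: "labels Y \<union> labels ?Z = U" using D(3) sp by auto
        then have Zl: "labels ?Z = U - labels Y" using disj by auto
        have rY: "(Y, perm_restrict \<sigma> (labels Y)) \<in> automorphic (labels Y)"
          using automorphic_restrict(1)[OF X] sp by simp
        have rZ: "(?Z, perm_restrict \<sigma> (labels ?Z)) \<in> automorphic (labels ?Z)"
          using automorphic_restrict(1)[OF X, of ?Z] sp by simp
        have "perm_restrict \<sigma> (labels Y) \<circ> perm_restrict \<sigma> (labels ?Z) = perm_restrict \<sigma> U"
          unfolding un[symmetric]
          by (rule perm_restrict_union[OF automorphicD(4)[OF rY] automorphicD(4)[OF rZ] disj])
        also have "\<dots> = \<sigma>" using permutes_not_in[OF D(4)] by (auto simp: perm_restrict_def fun_eq_iff)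
        finally have inv: "?i (?j s) = s" using sp by (simp add: s' Un_absorb1)
        have oY: "orbit (act e \<sigma>) N = Y" if "N \<in> Y" for N
          using Y orbit_eq_of_mem[OF D(6,5)] that by auto
        have "(Y, perm_restrict \<sigma> (labels Y)) \<in> with_orbits 1 J (labels Y)"
        proof (rule with_orbits_1I[OF rY])
          show "Y \<noteq> {}" using Y orbit_nonempty[of "act e \<sigma>"] by blast
          show "orbit (act e (perm_restrict \<sigma> (labels Y))) N = Y" if "N \<in> Y" for N
            using automorphic_restrict(2)[OF X _ _ that] sp oY[OF that] by simp
          show "card Y \<in> J" using Y J by auto
        qed
        moreover have "(?Z, perm_restrict \<sigma> (labels ?Z)) \<in> with_orbits k J (labels ?Z)"
        proof -
          have eq: "orbit (act e (perm_restrict \<sigma> (labels ?Z))) N = orbit (act e \<sigma>) N" if "N \<in> ?Z" for N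
            using automorphic_restrict(2)[OF X _ _ that] sp by simp
          have "orbit (act e (perm_restrict \<sigma> (labels ?Z))) ` ?Z = orbit (act e \<sigma>) ` ?Z"
            by (rule image_cong[OF refl eq])
          \<comment> \<open>Orbits are disjoint, so deleting the components in Y deletes precisely
            one orbit.\<close>
          also have "\<dots> = orbit (act e \<sigma>) ` X - {Y}"
          proof
            show "orbit (act e \<sigma>) ` ?Z \<subseteq> orbit (act e \<sigma>) ` X - {Y}"
              using self_in_orbit[OF D(6,5)] by auto
            show "orbit (act e \<sigma>) ` X - {Y} \<subseteq> orbit (act e \<sigma>) ` ?Z" using oY by blast
          qed
          finally have "card (orbit (act e (perm_restrict \<sigma> (labels ?Z))) ` ?Z) = k"
            using k Y by (simp add: card_Diff_singleton)
          then show ?thesis using rZ eq J by (simp add: with_orbits_def)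
        qed
        ultimately have "?j s \<in> ?G U" using un Zl by (auto simp: s')
        then show ?thesis using inv by simp
      qed
      have right: "?j (?i t) = t \<and> ?i t \<in> (SIGMA s:with_orbits (Suc k) J U. ?A s)" if t: "t \<in> ?G U" for t
      proof -
        obtain V Y \<sigma>1 Z \<sigma>2 where t': "t = (V, (Y, \<sigma>1), (Z, \<sigma>2))" and V: "V \<subseteq> U"
          and Y: "(Y, \<sigma>1) \<in> with_orbits 1 J V" and Z: "(Z, \<sigma>2) \<in> with_orbits k J (U - V)"
          using t by auto
        have aY: "(Y, \<sigma>1) \<in> automorphic V" and aZ: "(Z, \<sigma>2) \<in> automorphic (U - V)"
          using Y Z by (auto simp: with_orbits_def)
        have d: "V \<inter> (U - V) = {}" by auto
        note jn = automorphic_join[OF aY aZ d]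
        note lY = automorphicD(3)[OF aY] and lZ = automorphicD(3)[OF aZ]
        have "(Y \<union> Z) - Y = Z" using jn(2) by auto
        then have inv: "?j (?i t) = t" using jn(5,6) lY lZ by (simp add: t')
        let ?o = "orbit (act e (\<sigma>1 \<circ> \<sigma>2))"
        note Y1 = with_orbits_1D[OF Y]
        have oY: "?o ` Y = {Y}" using jn(3) Y1(1,2) by auto
        have oZ: "?o ` Z = orbit (act e \<sigma>2) ` Z" using jn(4) by (rule image_cong[OF refl])
        \<comment> \<open>The added orbit is nonempty and disjoint from Z, hence new; this makes the
          number of orbits exactly \<open>Suc k\<close>.\<close>
        have "Y \<notin> orbit (act e \<sigma>2) ` Z"
        proof
          assume "Y \<in> orbit (act e \<sigma>2) ` Z"
          then have "Y \<subseteq> Z" using Union_orbits[OF automorphicD(6,5)[OF aZ]] by auto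
          then show False using jn(2) Y1(1) by auto
        qed
        moreover have "?o ` (Y \<union> Z) = insert Y (orbit (act e \<sigma>2) ` Z)"
          unfolding image_Un oY oZ by simp
        ultimately have "card (?o ` (Y \<union> Z)) = Suc k"
          using Z automorphicD(6)[OF aZ] by (simp add: with_orbits_def)
        moreover have "card (?o N) \<in> J" if "N \<in> Y \<union> Z" for N
          using that jn(3,4) Y1(2,3) Z by (auto simp: with_orbits_def)
        moreover have "V \<union> (U - V) = U" using V by auto
        ultimately have "(Y \<union> Z, \<sigma>1 \<circ> \<sigma>2) \<in> with_orbits (Suc k) J U"
          using jn(1) by (simp add: with_orbits_def)
        moreover have "Y \<in> ?o ` (Y \<union> Z)" unfolding image_Un oY by simp
        ultimately have "?i t \<in> (SIGMA s:with_orbits (Suc k) J U. ?A s)" by (simp add: t')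
        then show ?thesis using inv by blast
      qed
      show "\<forall>s\<in>(SIGMA s:with_orbits (Suc k) J U. ?A s). ?i (?j s) = s"
        by (rule ballI, rule conjunct1[OF left])
      show "\<forall>t\<in>?G U. ?j (?i t) = t"
        by (rule ballI, rule conjunct1[OF right])
      show "?j ` (SIGMA s:with_orbits (Suc k) J U. ?A s) \<subseteq> ?G U"
        by (rule image_subsetI, rule conjunct2[OF left])
      show "?i ` ?G U \<subseteq> (SIGMA s:with_orbits (Suc k) J U. ?A s)"
        by (rule image_subsetI, rule conjunct2[OF right])
    qed
  qed
qed simp

lemma enumerates_with_orbits_0: "enumerates (with_orbits 0 J) cweight 1"
proof -
  have eq: "with_orbits 0 J U = (if U = {} then {({}, id)} else {})" for U
  proof -
    have "X = {}" if "(X, \<sigma>) \<in> with_orbits 0 J U" for X \<sigma>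
      using that automorphicD(6) by (fastforce simp: with_orbits_def)
    moreover have "(({} :: network set), \<sigma>) \<in> with_orbits 0 J U \<longleftrightarrow> U = {} \<and> \<sigma> = id" for \<sigma>
      by (auto simp: with_orbits_def automorphic_def composable_def)
    ultimately show ?thesis by auto
  qed
  have w: "cweight ({}, id) = {#}" by (simp add: cweight_def wt_def)
  show ?thesis
  proof (rule enumeratesI)
    fix U :: "nat set" and M assume U: "finite U" "card U = deg M"
    show "of_nat (card {s \<in> with_orbits 0 J U. cweight s = M}) = fact (card U) * coeff 1 M"
    proof (cases "U = {} \<and> M = {#}")
      case True
      then have "{s \<in> with_orbits 0 J U. cweight s = M} = {({}, id)}" using w by (auto simp: eq)
      then show ?thesis using True by (simp add: coeff_one)
    next
      case False
      then have "{s \<in> with_orbits 0 J U. cweight s = M} = {}" using w by (auto simp: eq)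
      moreover have "M \<noteq> {#}" using False U by auto
      ultimately show ?thesis unfolding coeff_one by (simp only: card.empty) simp
    qed
  qed (auto simp: eq w split: if_splits)
qed

lemma enumerates_with_orbits:
  assumes "enumerates (with_orbits 1 J) cweight C"
  shows "enumerates (with_orbits k J) cweight (scale (1 / fact k) (C ^ k))"
proof (induction k)
  case 0
  show ?case using enumerates_with_orbits_0 by (simp add: scale_one)
next
  case (Suc k)
  have "scale (1 / of_nat (Suc k)) (C * scale (1 / fact k) (C ^ k)) = scale (1 / fact (Suc k)) (C ^ Suc k)"
    by (simp add: scale_times scale_scale)
  then show ?case using enumerates_with_orbits_Suc[OF assms Suc.IH] by simp
qed

section \<open>A single cycle of components\<close>

lemma act_funpow_mem:
  assumes "N \<in> \<N>" "\<sigma> permutes U"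
  shows "(act e \<sigma> ^^ i) N \<in> \<N>"
  unfolding act_funpow
  by (rule act_closed[OF assms(1)])
    (use inj_fn[OF permutes_inj[OF assms(2)]] in \<open>auto intro: inj_on_subset\<close>)

text \<open>The components are the images of N under the powers of the action. They are disjoint
  because the blocks are, and the cycle closes after m steps because \<rho> is an automorphism of N
  of the right type.\<close>

lemma cyclic_extension_orbit:
  assumes N: "N \<in> \<N>" and m: "1 \<le> m" and r: "\<rho> \<in> Aut (e \<and> odd m) (N, {})"
    and s: "\<sigma> \<in> cyclic_extensions m U (internals N) \<rho>"
  shows "orbit (act e \<sigma>) N = (\<lambda>i. (act e \<sigma> ^^ i) N) ` {..<m}"
    and "N \<in> orbit (act e \<sigma>) N"
    and "(orbit (act e \<sigma>) N, \<sigma>) \<in> with_orbits 1 {m} U"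
    and "cweight (orbit (act e \<sigma>) N, \<sigma>)
      = image_mset (index_times m) (pole_free_weight (e \<and> odd m) (N, {}) \<rho>)"
proof -
  let ?V = "internals N" and ?Y = "orbit (act e \<sigma>) N" and ?h = "ext e \<sigma>"
  have perm: "\<sigma> permutes U" and cb: "cyclic_blocks \<sigma> m ?V" and sp: "spread \<sigma> m ?V = U"
    and pw: "\<And>x. x \<in> ?V \<Longrightarrow> (\<sigma> ^^ m) x = \<rho> x"
    using s by (auto simp: cyclic_extensions_def)
  have disj: "(\<sigma> ^^ i) ` ?V \<inter> (\<sigma> ^^ j) ` ?V = {}" if "i < m" "j < m" "i \<noteq> j" for i j
    using cb that by (simp add: cyclic_blocks_def)
  have "act (e \<and> odd m) \<rho> N = N" using r by (simp add: Aut_def bact_def)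
  moreover have "act (e \<and> odd m) (\<sigma> ^^ m) N = act (e \<and> odd m) \<rho> N"
    by (rule act_cong[OF wf[OF N]]) (rule pw)
  ultimately have cyc: "(act e \<sigma> ^^ m) N = N" by (simp add: act_funpow)
  show Y: "?Y = (\<lambda>i. (act e \<sigma> ^^ i) N) ` {..<m}" by (rule orbit_of_cycle[OF cyc m])
  have int: "internals ((act e \<sigma> ^^ i) N) = (\<sigma> ^^ i) ` ?V" for i
    by (simp add: act_funpow internals_act)
  have mem: "(act e \<sigma> ^^ i) N \<in> \<N>" for i by (rule act_funpow_mem[OF N perm])
  have YN: "?Y \<subseteq> \<N>" using Y mem by auto
  show self: "N \<in> ?Y"
  proof -
    have "(act e \<sigma> ^^ 0) N \<in> ?Y" unfolding Y using m by (intro imageI) auto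
    then show ?thesis by simp
  qed
  \<comment> \<open>Blocks that are disjoint and nonempty differ, so the first m images of N are
    distinct and the cycle has length exactly m.\<close>
  have inj: "inj_on (\<lambda>i. (act e \<sigma> ^^ i) N) {..<m}"
  proof (rule inj_onI)
    fix i j assume ij: "i \<in> {..<m}" "j \<in> {..<m}" "(act e \<sigma> ^^ i) N = (act e \<sigma> ^^ j) N"
    then have "(\<sigma> ^^ i) ` ?V = (\<sigma> ^^ j) ` ?V" using int by metis
    moreover have "?V \<noteq> {}" by (rule internals_nonempty[OF N])
    ultimately show "i = j" using disj[of i j] ij by auto
  qed
  have card: "card ?Y = m" using card_image[OF inj] Y by simp
  have "composable ?Y"
    unfolding composable_def
  proof
    show "finite ?Y" using Y by simp
    show "pairwise (\<lambda>M N. internals M \<inter> internals N = {}) ?Y"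
    proof (rule pairwiseI)
      fix M M' assume "M \<in> ?Y" "M' \<in> ?Y" "M \<noteq> M'"
      then obtain i j where "i < m" "j < m" "i \<noteq> j" "M = (act e \<sigma> ^^ i) N" "M' = (act e \<sigma> ^^ j) N"
        unfolding Y by blast
      then show "internals M \<inter> internals M' = {}" using disj int by simp
    qed
  qed
  moreover have lab: "labels ?Y = U" unfolding Y sp[symmetric] spread_def by (simp add: int image_image)
  moreover have cl: "act e \<sigma> ` ?Y = ?Y" by (rule orbit_image_self[OF self])
  ultimately have aut: "(?Y, \<sigma>) \<in> automorphic U" using YN perm by (simp add: automorphic_def)
  show "(?Y, \<sigma>) \<in> with_orbits 1 {m} U"
  proof (rule with_orbits_1I[OF aut])
    show "?Y \<noteq> {}" using self by auto
    show "orbit (act e \<sigma>) M = ?Y" if "M \<in> ?Y" for M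
      using orbit_eq_of_mem[OF automorphicD(6)[OF aut] cl self that] .
  qed (simp add: card)
  have finV: "finite ?V" and finE: "finite (edges N)"
    using finite_internals[OF wf[OF N]] finite_edges[OF wf[OF N]] by auto
  have hpow: "?h ^^ i = ext (e \<and> odd i) (\<sigma> ^^ i)" for i by (rule ext_funpow)
  have hV: "(?h ^^ i) ` Internal ` ?V = Internal ` (\<sigma> ^^ i) ` ?V" for i
    by (simp add: hpow image_image)
  have hE: "((`) ?h ^^ i) ` edges N = edges ((act e \<sigma> ^^ i) N)" for i
    by (simp add: image_funpow hpow act_funpow edges_act)
  have cV: "cyclic_blocks ?h m (Internal ` ?V)"
    unfolding cyclic_blocks_def
  proof (intro conjI allI impI)
    show "(?h ^^ m) ` Internal ` ?V = Internal ` ?V"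
      unfolding hV using cb by (simp add: cyclic_blocks_def)
    show "(?h ^^ i) ` Internal ` ?V \<inter> (?h ^^ j) ` Internal ` ?V = {}" if "i < m" "j < m" "i \<noteq> j" for i j
      unfolding hV using disj[OF that] by blast
  qed (use m finV in auto)
  \<comment> \<open>Although different components share the poles, their edge sets are disjoint, so
    the edges are permuted in blocks just as the vertices are.\<close>
  have cE: "cyclic_blocks ((`) ?h) m (edges N)"
    unfolding cyclic_blocks_def hE cyc
  proof (intro conjI allI impI)
    show "edges ((act e \<sigma> ^^ i) N) \<inter> edges ((act e \<sigma> ^^ j) N) = {}" if "i < m" "j < m" "i \<noteq> j" for i j
      by (rule edges_disjoint[OF mem mem]) (use disj[OF that] int in simp)
  qed (use m finE in auto)
  have "Internal ` labels ?Y = spread ?h m (Internal ` ?V)"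
    unfolding lab sp[symmetric] spread_def hV by (simp add: image_UN)
  moreover have "\<Union> (edges ` ?Y) = spread ((`) ?h) m (edges N)"
    unfolding Y spread_def hE by (simp add: image_image)
  ultimately have "cweight (?Y, \<sigma>)
      = image_mset (index_times m) (wt (Internal ` ?V) (edges N) (?h ^^ m))"
    unfolding cweight_def prod.case using wt_spread[OF inj_ext[OF permutes_inj[OF perm]] cV cE] by simp
  also have "wt (Internal ` ?V) (edges N) (?h ^^ m) = wt (Internal ` ?V) (edges N) (ext (e \<and> odd m) \<rho>)"
  proof (rule wt_cong)
    show "ext (e \<and> odd m) \<rho> v \<in> Internal ` ?V" if "v \<in> Internal ` ?V" for v
      using Aut_Internal[OF r] that unfolding fst_conv by blast
    show "ext (e \<and> odd m) \<rho> ` d \<in> edges N" if "d \<in> edges N" for d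
      using Aut_edges[OF r] that unfolding fst_conv by blast
    show "(?h ^^ m) v = ext (e \<and> odd m) \<rho> v" if "v \<in> Internal ` ?V \<union> \<Union> (edges N)" for v
      unfolding hpow using ext_cong_labels[of "{N}" "\<sigma> ^^ m" \<rho> v] that N pw by simp
  qed (use finV finE in auto)
  finally show "cweight (?Y, \<sigma>) = image_mset (index_times m) (pole_free_weight (e \<and> odd m) (N, {}) \<rho>)"
    by (simp add: pole_free_weight_def)
qed

text \<open>A transitive pair with a distinguished component N returns N to itself after exactly m
  steps; the return map, restricted to the labels of N, is the automorphism sought.\<close>

lemma orbit_cyclic_extension:
  assumes Y: "(Y, \<sigma>) \<in> with_orbits 1 {m} U" and N: "N \<in> Y"
  shows "perm_restrict (\<sigma> ^^ m) (internals N) \<in> Aut (e \<and> odd m) (N, {})"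
    and "\<sigma> \<in> cyclic_extensions m U (internals N) (perm_restrict (\<sigma> ^^ m) (internals N))"
proof -
  let ?V = "internals N" and ?r = "perm_restrict (\<sigma> ^^ m) (internals N)"
  have aut: "(Y, \<sigma>) \<in> automorphic U" using Y by (simp add: with_orbits_def)
  note D = automorphicD[OF aut]
  have o: "orbit (act e \<sigma>) N = Y" and card: "card Y = m" using with_orbits_1D[OF Y] N by auto
  have NN: "N \<in> \<N>" using N D(1) by auto
  note cyc = orbit_cycle[of N "act e \<sigma>" m, unfolded o, OF N card]
  have m: "1 \<le> m" using card N D(6) by (metis One_nat_def Suc_leI card_gt_0_iff empty_iff)
  have int: "internals ((act e \<sigma> ^^ i) N) = (\<sigma> ^^ i) ` ?V" for i
    by (simp add: act_funpow internals_act)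
  have finV: "finite ?V" using finite_internals[OF wf[OF NN]] .
  have VV: "(\<sigma> ^^ m) ` ?V = ?V" using int[of m] cyc(3) by simp
  have "act (e \<and> odd m) ?r N = act (e \<and> odd m) (\<sigma> ^^ m) N"
    by (rule act_cong[OF wf[OF NN]]) (simp add: perm_restrict_def)
  then have "act (e \<and> odd m) ?r N = N" using cyc(3) by (simp add: act_funpow)
  then show "?r \<in> Aut (e \<and> odd m) (N, {})"
    using perm_restrict_permutes[OF finV VV] by (simp add: Aut_def bact_def)
  have "(\<sigma> ^^ i) ` ?V \<inter> (\<sigma> ^^ j) ` ?V = {}" if "i < m" "j < m" "i \<noteq> j" for i j
  proof -
    have "(act e \<sigma> ^^ i) N \<noteq> (act e \<sigma> ^^ j) N" using cyc(2) that by (auto dest: inj_onD)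
    moreover have "(act e \<sigma> ^^ i) N \<in> Y" "(act e \<sigma> ^^ j) N \<in> Y" using cyc(1) that by auto
    ultimately show ?thesis unfolding int[symmetric] using D(2) by (simp add: composable_def pairwise_def)
  qed
  then have "cyclic_blocks \<sigma> m ?V" using m finV VV by (simp add: cyclic_blocks_def)
  moreover have "spread \<sigma> m ?V = U"
  proof -
    have "labels Y = (\<Union>i<m. internals ((act e \<sigma> ^^ i) N))" using cyc(1) by simp
    then show ?thesis using D(3) by (simp add: spread_def int)
  qed
  ultimately show "\<sigma> \<in> cyclic_extensions m U ?V ?r"
    using D(4) by (simp add: cyclic_extensions_def perm_restrict_def)
qed

text \<open>Nothing is lost in either direction: the cycle is recovered as the orbit of N under
  \<sigma>, and \<rho> as the restriction of the m-th power of \<sigma>.\<close>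

lemma bij_betw_marked_cycles:
  assumes m: "1 \<le> m"
  shows "bij_betw (\<lambda>((Y, \<sigma>), N). (internals N, (((N, {}), perm_restrict (\<sigma> ^^ m) (internals N)), \<sigma>)))
    (SIGMA s:with_orbits 1 {m} U. fst s)
    (SIGMA V:Pow U. SIGMA t:pairs (e \<and> odd m) (plain \<N>) V. cyclic_extensions m U V (snd t))"
    (is "bij_betw ?j ?T ?R")
proof (rule bij_betw_byWitness[where f' = "\<lambda>(V, ((N, \<rho>), \<sigma>)). ((orbit (act e \<sigma>) (fst N), \<sigma>), fst N)"])
  let ?i = "\<lambda>(V, ((N, \<rho>), \<sigma>)). ((orbit (act e \<sigma>) (fst N), \<sigma>), fst N)"
  have left: "?i (?j x) = x \<and> ?j x \<in> ?R" if x: "x \<in> ?T" for x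
  proof -
    obtain Y \<sigma> N where x': "x = ((Y, \<sigma>), N)" and Y: "(Y, \<sigma>) \<in> with_orbits 1 {m} U" and N: "N \<in> Y"
      using x by auto
    have aut: "(Y, \<sigma>) \<in> automorphic U" using Y by (simp add: with_orbits_def)
    have NN: "N \<in> \<N>" "internals N \<subseteq> U" using automorphicD(1,3)[OF aut] N by auto
    have "orbit (act e \<sigma>) N = Y" using with_orbits_1D(2)[OF Y N] .
    then show ?thesis
      using orbit_cyclic_extension[OF Y N] NN by (simp add: x' pairs_def plain_def)
  qed
  have right: "?j (?i y) = y \<and> ?i y \<in> ?T" if y: "y \<in> ?R" for y
  proof -
    obtain V N \<rho> \<sigma> where y': "y = (V, (((N, {}), \<rho>), \<sigma>))" and N: "N \<in> \<N>" and V: "V = internals N"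
      and r: "\<rho> \<in> Aut (e \<and> odd m) (N, {})" and s: "\<sigma> \<in> cyclic_extensions m U (internals N) \<rho>"
      using y by (auto simp: pairs_def plain_def)
    note c = cyclic_extension_orbit[OF N m r s]
    have rp: "\<rho> permutes internals N" using r by (simp add: Aut_def)
    have "perm_restrict (\<sigma> ^^ m) (internals N) = \<rho>"
      using s permutes_not_in[OF rp] by (auto simp: perm_restrict_def cyclic_extensions_def fun_eq_iff)
    then show ?thesis using c(2,3) by (simp add: y' V)
  qed
  show "\<forall>x\<in>?T. ?i (?j x) = x" by (rule ballI, rule conjunct1[OF left])
  show "\<forall>y\<in>?R. ?j (?i y) = y" by (rule ballI, rule conjunct1[OF right])
  show "?j ` ?T \<subseteq> ?R" by (rule image_subsetI, rule conjunct2[OF left])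
  show "?i ` ?R \<subseteq> ?T" by (rule image_subsetI, rule conjunct2[OF right])
qed

lemma automorphic_finite_deg:
  assumes "finite U"
  shows "finite (automorphic U)" "\<And>s. s \<in> automorphic U \<Longrightarrow> deg (cweight s) = card U"
  using enumerates_finite[OF enumerates_automorphic[of "\<lambda>_. True"] assms]
    enumerates_deg[OF enumerates_automorphic[of "\<lambda>_. True"] assms] by auto

text \<open>A cycle is counted here once for each of its m components, so the factor 1/m is still
  absent. Only stretched monomials occur as weights, and each of them determines the weight of the
  distinguished component.\<close>

lemma enumerates_marked_cycles:
  assumes m: "1 \<le> m"
  shows "enumerates (\<lambda>U. SIGMA s:with_orbits 1 {m} U. fst s) (cweight \<circ> fst)
    (dilate m (W (e \<and> odd m) (plain \<N>)))"
proof (rule enumeratesI)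
  let ?e = "e \<and> odd m"
  let ?W = "W ?e (plain \<N>)" and ?pw = "\<lambda>(N, \<sigma>). pole_free_weight ?e N \<sigma>"
  let ?j = "\<lambda>((Y, \<sigma>), N). (internals N, (((N, {}), perm_restrict (\<sigma> ^^ m) (internals N)), \<sigma>))"
  note en = enumerates_pairs[OF closed_class_plain, of ?e]
  fix U :: "nat set" assume U: "finite U"
  let ?T = "SIGMA s:with_orbits 1 {m} U. fst s"
  let ?R = "SIGMA V:Pow U. SIGMA t:pairs ?e (plain \<N>) V. cyclic_extensions m U V (snd t)"
  have sub: "with_orbits 1 {m} U \<subseteq> automorphic U" by (auto simp: with_orbits_def)
  show "finite ?T"
  proof (rule finite_SigmaI)
    show "finite (with_orbits 1 {m} U)"
      by (rule finite_subset[OF sub automorphic_finite_deg(1)[OF U]])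
    show "finite (fst s)" if "s \<in> with_orbits 1 {m} U" for s
      using that sub automorphicD(6)[of "fst s" "snd s" U] by auto
  qed
  show "deg ((cweight \<circ> fst) x) = card U" if "x \<in> ?T" for x
    using that sub automorphic_finite_deg(2)[OF U, of "fst x"] by auto
  fix M assume M: "card U = deg M"
  have w: "image_mset (index_times m) (?pw (fst (snd (?j x)))) = (cweight \<circ> fst) x" if x: "x \<in> ?T" for x
  proof -
    obtain Y \<sigma> N where x': "x = ((Y, \<sigma>), N)" and Y: "(Y, \<sigma>) \<in> with_orbits 1 {m} U" and N: "N \<in> Y"
      using x by auto
    have NN: "N \<in> \<N>" using automorphicD(1)[of Y \<sigma> U] sub Y N by blast
    have o: "orbit (act e \<sigma>) N = Y" using with_orbits_1D(2)[OF Y N] .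
    show ?thesis
      using cyclic_extension_orbit(4)[OF NN m orbit_cyclic_extension[OF Y N]] o by (simp add: x')
  qed
  have "bij_betw ?j {x \<in> ?T. (cweight \<circ> fst) x = M}
      {y \<in> ?R. image_mset (index_times m) (?pw (fst (snd y))) = M}"
    by (rule bij_betw_Collect[OF bij_betw_marked_cycles[OF m]]) (simp only: w)
  then have cardT: "card {x \<in> ?T. (cweight \<circ> fst) x = M}
      = card {y \<in> ?R. image_mset (index_times m) (?pw (fst (snd y))) = M}"
    by (rule bij_betw_same_card)
  show "of_nat (card {x \<in> ?T. (cweight \<circ> fst) x = M}) = fact (card U) * coeff (dilate m ?W) M"
  proof (cases "M \<in> range (image_mset (index_times m))")
    case False
    then have "{y \<in> ?R. image_mset (index_times m) (?pw (fst (snd y))) = M} = {}" by blast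
    then show ?thesis unfolding cardT coeff_dilate_not_image[OF False]
      by (simp only: card.empty of_nat_0 mult_zero_right)
  next
    case True
    then obtain M' where M': "M = image_mset (index_times m) M'" by auto
    let ?k = "deg M'" and ?n = "card U"
    \<comment> \<open>Stretching by m multiplies the degree by m, so the distinguished component
      receives the m-th part of the labels, as the count of cyclic extensions requires.\<close>
    have n: "?n = m * ?k" using M by (simp add: M' deg_image_index_times)
    then have kn: "?k \<le> ?n" using m by simp
    have inj: "image_mset (index_times m) A = M \<longleftrightarrow> A = M'" for A
      using multiset.inj_map[OF inj_index_times[OF m]] unfolding M' by (auto dest: injD)
    let ?P = "\<lambda>V. {t \<in> pairs ?e (plain \<N>) V. ?pw t = M'}"
    have fin: "finite V" if "V \<in> Pow U" for V using that U finite_subset by auto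
    have finP: "finite (?P V)" if "V \<in> Pow U" for V
      using enumerates_finite[OF en fin[OF that]] by simp
    have finC: "finite (cyclic_extensions m U V \<rho>)" for V \<rho>
      by (rule finite_subset[OF _ finite_permutations[OF U]]) (auto simp: cyclic_extensions_def)
    have "{y \<in> ?R. image_mset (index_times m) (?pw (fst (snd y))) = M}
        = (SIGMA V:Pow U. SIGMA t:?P V. cyclic_extensions m U V (snd t))"
      unfolding inj by auto
    then have "card {x \<in> ?T. (cweight \<circ> fst) x = M}
        = (\<Sum>V\<in>Pow U. \<Sum>t\<in>?P V. card (cyclic_extensions m U V (snd t)))"
      unfolding cardT using U finP finC by (simp add: card_SigmaI finite_SigmaI)
    also have "\<dots> = (\<Sum>V\<in>Pow U. card (?P V) * fact (?n - ?k))"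
    proof (rule sum.cong[OF refl])
      fix V assume V: "V \<in> Pow U"
      have "card (cyclic_extensions m U V (snd t)) = fact (?n - ?k)" if t: "t \<in> ?P V" for t
      proof -
        have "card V = ?k" using enumerates_deg[OF en fin[OF V], of t] t by auto
        moreover have "snd t permutes V" using t by (auto simp: pairs_def Aut_def)
        ultimately show ?thesis using card_cyclic_extensions[OF U _ _ m, of V "snd t"] V n by simp
      qed
      then show "(\<Sum>t\<in>?P V. card (cyclic_extensions m U V (snd t))) = card (?P V) * fact (?n - ?k)"
        by simp
    qed
    finally have "of_nat (card {x \<in> ?T. (cweight \<circ> fst) x = M})
        = (\<Sum>V\<in>Pow U. of_nat (card (?P V)) * fact (?n - ?k) :: rat)" by simp
    also have "\<dots> = (\<Sum>V\<in>Pow U. if card V = ?k then fact ?k * coeff ?W M' * fact (?n - ?k) else 0)"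
    proof (rule sum.cong[OF refl])
      fix V assume V: "V \<in> Pow U"
      show "of_nat (card (?P V)) * fact (?n - ?k)
          = (if card V = ?k then fact ?k * coeff ?W M' * fact (?n - ?k) else 0)"
        unfolding enumerates_card[OF en fin[OF V]] by simp
    qed
    also have "\<dots> = of_nat (card {V \<in> Pow U. card V = ?k}) * (fact ?k * coeff ?W M' * fact (?n - ?k))"
      using U by (simp add: sum.If_cases Int_def)
    also have "card {V \<in> Pow U. card V = ?k} = ?n choose ?k"
      using n_subsets[OF U, of ?k] by (simp add: Pow_def)
    also have "of_nat (?n choose ?k) * (fact ?k * coeff ?W M' * fact (?n - ?k)) = fact ?n * coeff ?W M'"
      using kn by (simp add: binomial_fact)
    also have "coeff ?W M' = coeff (dilate m ?W) M"
      unfolding M' by (rule coeff_dilate_image[OF m, symmetric])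
    finally show ?thesis .
  qed
qed

lemma enumerates_cycles:
  assumes "1 \<le> m"
  shows "enumerates (with_orbits 1 {m}) cweight (scale (1 / of_nat m) (dilate m (W (e \<and> odd m) (plain \<N>))))"
proof (rule enumerates_marked[OF enumerates_marked_cycles[OF assms] _ assms])
  fix U :: "nat set" and s assume "s \<in> with_orbits 1 {m} U"
  then show "card (fst s) = m" using with_orbits_1D(3)[of "fst s" "snd s" "{m}" U] by simp
qed

section \<open>Summation over cycles\<close>

text \<open>Choosing an internal vertex in every component is injective. The bounds leave only
  finitely many cycle lengths and numbers of cycles on a given label set, as formal sums
  require.\<close>

lemma card_orbits_le:
  assumes "(X, \<sigma>) \<in> automorphic U"
  shows "card X \<le> card U" "card (orbit (act e \<sigma>) ` X) \<le> card U"
proof -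
  note D = automorphicD[OF assms]
  define f where "f N = (SOME x. x \<in> internals N)" for N
  have f: "f N \<in> internals N" if "N \<in> X" for N
    unfolding f_def using internals_nonempty[of N] that D(1) some_in_eq[of "internals N"] by blast
  have "inj_on f X"
  proof (rule inj_onI)
    fix M N assume MN: "M \<in> X" "N \<in> X" "f M = f N"
    then show "M = N" using internals_inj[OF D(1,2) MN(1,2) f[OF MN(1)]] f[OF MN(2)] by simp
  qed
  moreover have "f ` X \<subseteq> U" using f D(3) by auto
  ultimately show le: "card X \<le> card U" using D(7) by (rule card_inj_on_le)
  show "card (orbit (act e \<sigma>) ` X) \<le> card U" using card_image_le[OF D(6)] le by (rule le_trans)
qed

lemma enumerates_connected:
  assumes "J \<subseteq> {m. 1 \<le> m}"
  shows "enumerates (with_orbits 1 J) cweight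
    (formal_sum (\<lambda>m. scale (1 / of_nat m) (dilate m (W (e \<and> odd m) (plain \<N>)))) J)"
proof -
  have "enumerates (\<lambda>U. \<Union>m\<in>J. with_orbits 1 {m} U) cweight
    (formal_sum (\<lambda>m. scale (1 / of_nat m) (dilate m (W (e \<and> odd m) (plain \<N>)))) J)"
  proof (rule enumerates_formal_sum)
    fix U :: "nat set" assume "finite U"
    have "m \<le> card U" if m: "with_orbits 1 {m} U \<noteq> {}" for m
    proof -
      obtain Y \<sigma> where Y: "(Y, \<sigma>) \<in> with_orbits 1 {m} U" using m by auto
      then have "card Y \<le> card U" using card_orbits_le(1) by (auto simp: with_orbits_def)
      then show ?thesis using with_orbits_1D(3)[OF Y] by simp
    qed
    then have "{m \<in> J. with_orbits 1 {m} U \<noteq> {}} \<subseteq> {..card U}" by auto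
    then show "finite {m \<in> J. with_orbits 1 {m} U \<noteq> {}}" by (rule finite_subset) simp
    show "with_orbits 1 {i} U \<inter> with_orbits 1 {j} U = {}" if "i \<noteq> j" for i j
      using that by (auto simp: with_orbits_1_eq simp del: One_nat_def)
  qed (use enumerates_cycles assms in auto)
  moreover have "(\<Union>m\<in>J. with_orbits 1 {m} U) = with_orbits 1 J U" for U
    unfolding with_orbits_1_eq by blast
  ultimately show ?thesis by simp
qed

text \<open>Needed to separate even from odd cycle lengths, for which the identity for
  \<open>W_minus\<close> has different summands.\<close>

lemma enumerates_connected_Un:
  assumes "enumerates (with_orbits 1 J) cweight f" "enumerates (with_orbits 1 J') cweight g"
    and "J \<inter> J' = {}"
  shows "enumerates (with_orbits 1 (J \<union> J')) cweight (f + g)"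
proof -
  have "with_orbits 1 J U \<inter> with_orbits 1 J' U = {}" for U
    using assms(3) unfolding with_orbits_1_eq by blast
  then have "enumerates (\<lambda>U. with_orbits 1 J U \<union> with_orbits 1 J' U) cweight (f + g)"
    using enumerates_plus[OF assms(1,2)] by blast
  moreover have "with_orbits 1 J U \<union> with_orbits 1 J' U = with_orbits 1 (J \<union> J') U" for U
    unfolding with_orbits_1_eq by blast
  ultimately show ?thesis by simp
qed

text \<open>Sorting all pairs by the number k of their cycles gives the k-th term of the
  exponential.\<close>

lemma W_E:
  assumes C: "enumerates (with_orbits 1 {m. 1 \<le> m}) cweight C"
  shows "W e (E \<N>) = series_exp C"
proof -
  let ?K = "\<lambda>k. with_orbits k {m. 1 \<le> m}"
  have "enumerates (\<lambda>U. \<Union>k\<in>UNIV. ?K k U) cweight (series_exp C)"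
    unfolding series_exp_def
  proof (rule enumerates_formal_sum)
    fix U :: "nat set" assume "finite U"
    have "k \<le> card U" if "?K k U \<noteq> {}" for k
      using that card_orbits_le(2) by (auto simp: with_orbits_def)
    then have "{k \<in> UNIV. ?K k U \<noteq> {}} \<subseteq> {..card U}" by auto
    then show "finite {k \<in> UNIV. ?K k U \<noteq> {}}" by (rule finite_subset) simp
    show "?K i U \<inter> ?K j U = {}" if "i \<noteq> j" for i j using that by (auto simp: with_orbits_def)
  qed (rule enumerates_with_orbits[OF C])
  moreover have "(\<Union>k\<in>UNIV. ?K k U) = {(X, \<sigma>) \<in> automorphic U. True}" for U
  proof -
    have "1 \<le> card (orbit (act e \<sigma>) N)" if X: "(X, \<sigma>) \<in> automorphic U" "N \<in> X" for X \<sigma> N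
    proof -
      have "finite (orbit (act e \<sigma>) N)"
        using Union_orbits[OF automorphicD(6,5)[OF X(1)]] automorphicD(6)[OF X(1)] X(2)
        by (metis UN_upper finite_subset)
      then show ?thesis using orbit_nonempty[of "act e \<sigma>" N] by (simp add: Suc_leI card_gt_0_iff)
    qed
    then show ?thesis by (auto simp: with_orbits_def)
  qed
  ultimately have "enumerates (\<lambda>U. {(X, \<sigma>) \<in> automorphic U. True}) cweight (series_exp C)" by simp
  then show ?thesis
    unfolding E_eq by (rule enumerates_unique[OF enumerates_automorphic[of "\<lambda>_. True"]])
qed

text \<open>The lengths of the cycles are positive and add up to the number of components, and 2 is
  only 1 + 1 or 2.\<close>

lemma card_2_orbits:
  assumes "(X, \<sigma>) \<in> automorphic U"
  shows "card X = 2 \<longleftrightarrow> (X, \<sigma>) \<in> with_orbits 2 {1} U \<union> with_orbits 1 {2} U"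
proof -
  note D = automorphicD[OF assms]
  let ?o = "orbit (act e \<sigma>)"
  have sum: "(\<Sum>C\<in>?o ` X. card C) = card X" by (rule sum_card_orbits[OF D(6,5)])
  have pos: "1 \<le> card C" if "C \<in> ?o ` X" for C
  proof -
    have "finite C" using Union_orbits[OF D(6,5)] D(6) that by (metis Union_upper finite_subset)
    then show ?thesis using that orbit_nonempty[of "act e \<sigma>"] by (auto simp: Suc_leI card_gt_0_iff)
  qed
  show ?thesis
  proof
    assume 2: "card X = 2"
    have "(\<Sum>C\<in>?o ` X. 1) \<le> (\<Sum>C\<in>?o ` X. card C)" by (rule sum_mono) (rule pos)
    then have le: "card (?o ` X) \<le> 2" using sum 2 by simp
    have "card (?o ` X) \<noteq> 0" using 2 D(6) by auto
    then consider "card (?o ` X) = 1" | "card (?o ` X) = 2" using le by linarith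
    then show "(X, \<sigma>) \<in> with_orbits 2 {1} U \<union> with_orbits 1 {2} U"
    proof cases
      case 1
      then obtain C where C: "?o ` X = {C}" by (meson card_1_singletonE)
      then have "card C = 2" using sum 2 by simp
      then have "card (?o N) = 2" if "N \<in> X" for N using C that by (metis image_eqI singletonD)
      then show ?thesis using 1 assms by (simp add: with_orbits_def)
    next
      case orbits: 2
      then obtain C C' where C: "?o ` X = {C, C'}" "C \<noteq> C'" by (meson card_2_iff)
      then have "card C + card C' = 2" using sum 2 by simp
      then have "card C = 1 \<and> card C' = 1" using pos[of C] pos[of C'] C(1) by auto
      then have "card (?o N) = 1" if "N \<in> X" for N
        using C that by (metis image_eqI insertE singletonD)
      then show ?thesis using orbits assms by (simp add: with_orbits_def)
    qed
  next
    assume "(X, \<sigma>) \<in> with_orbits 2 {1} U \<union> with_orbits 1 {2} U"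
    then consider "card (?o ` X) = 2" "\<forall>N\<in>X. card (?o N) = 1" | "card (?o ` X) = 1" "\<forall>N\<in>X. card (?o N) = 2"
      by (auto simp: with_orbits_def)
    then show "card X = 2"
    proof cases
      case 1
      then have "(\<Sum>C\<in>?o ` X. card C) = (\<Sum>C\<in>?o ` X. 1)" by (intro sum.cong) auto
      then show ?thesis using sum 1(1) by simp
    next
      case 2
      then have "(\<Sum>C\<in>?o ` X. card C) = (\<Sum>C\<in>?o ` X. 2)" by (intro sum.cong) auto
      then show ?thesis using sum 2(1) by simp
    qed
  qed
qed

text \<open>Two fixed components give half the square. In a cycle of length 2 the return map is a
  square and preserves the poles for either value of \<open>e\<close>, so the dilated series is
  \<open>W False\<close> in both cases.\<close>

lemma W_E2:
  "W e (E2 \<N>) = scale (1 / 2) ((W e (plain \<N>))\<^sup>2 + dilate 2 (W False (plain \<N>)))"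
proof -
  have "enumerates (with_orbits 1 {1}) cweight (W e (plain \<N>))"
    using enumerates_cycles[of 1] by (simp add: scale_one dilate_1[unfolded One_nat_def])
  then have "enumerates (with_orbits 2 {1}) cweight (scale (1 / 2) ((W e (plain \<N>))\<^sup>2))"
    using enumerates_with_orbits[of "{1}" _ 2] by simp
  moreover have "enumerates (with_orbits 1 {2}) cweight (scale (1 / 2) (dilate 2 (W False (plain \<N>))))"
    using enumerates_cycles[of 2] by simp
  ultimately have "enumerates (\<lambda>U. with_orbits 2 {1} U \<union> with_orbits 1 {2} U) cweight
      (scale (1 / 2) ((W e (plain \<N>))\<^sup>2) + scale (1 / 2) (dilate 2 (W False (plain \<N>))))"
    by (rule enumerates_plus) (auto simp: with_orbits_def)
  moreover have "with_orbits 2 {1} U \<union> with_orbits 1 {2} U = {(X, \<sigma>) \<in> automorphic U. card X = 2}" for U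
  proof -
    have "with_orbits 2 {1} U \<union> with_orbits 1 {2} U \<subseteq> automorphic U" by (auto simp: with_orbits_def)
    then show ?thesis using card_2_orbits[of _ _ U] by blast
  qed
  ultimately have "enumerates (\<lambda>U. {(X, \<sigma>) \<in> automorphic U. card X = 2}) cweight
      (scale (1 / 2) ((W e (plain \<N>))\<^sup>2 + dilate 2 (W False (plain \<N>))))"
    by (simp add: scale_plus)
  then show ?thesis
    unfolding E2_eq by (rule enumerates_unique[OF enumerates_automorphic[of "\<lambda>n. n = 2"]])
qed

end

section \<open>The four identities\<close>

theorem theorem7:
  fixes \<N> :: "network set"
  assumes "network_species \<N>"
    and "\<And>N. N \<in> \<N> \<Longrightarrow> N \<noteq> trivial_network"
    and "\<And>N. N \<in> \<N> \<Longrightarrow> \<not> adjacent_poles N"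
  shows "W_plus (E \<N>) =
           series_exp (formal_sum
             (\<lambda>m. scale (1 / of_nat m) (dilate m (W_plus (plain \<N>)))) {m. 1 \<le> m})
       \<and> (tau_closed \<N> \<longrightarrow> W_minus (E \<N>) =
           series_exp (formal_sum
               (\<lambda>m. scale (1 / of_nat m) (dilate m (W_plus (plain \<N>)))) {m. 1 \<le> m \<and> even m}
             + formal_sum
               (\<lambda>m. scale (1 / of_nat m) (dilate m (W_minus (plain \<N>)))) {m. 1 \<le> m \<and> odd m}))
       \<and> W_plus (E2 \<N>) =
           scale (1 / 2) ((W_plus (plain \<N>))\<^sup>2 + dilate 2 (W_plus (plain \<N>)))
       \<and> (tau_closed \<N> \<longrightarrow> W_minus (E2 \<N>) =
           scale (1 / 2) ((W_minus (plain \<N>))\<^sup>2 + dilate 2 (W_plus (plain \<N>))))"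
proof -
  \<comment> \<open>The classes are closed under pole-preserving isomorphisms, so this instance also
    identifies \<open>W_minus\<close> with \<open>W True\<close>; exchanging the poles within the
    species matters only for the evaluation of \<open>W True\<close>.\<close>
  interpret P: parallel_species \<N> False
    using assms by unfold_locales auto
  have plus: "W_plus (E \<N>) = W False (E \<N>)" "W_plus (E2 \<N>) = W False (E2 \<N>)"
      "W_plus (plain \<N>) = W False (plain \<N>)"
    by (simp_all only: P.E_eq P.E2_eq W_plus_eq[OF P.closed_class_compositions] W_plus_eq[OF P.closed_class_plain])
  have minus: "W_minus (E \<N>) = W True (E \<N>)" "W_minus (E2 \<N>) = W True (E2 \<N>)"
      "W_minus (plain \<N>) = W True (plain \<N>)"
    by (simp_all only: P.E_eq P.E2_eq W_minus_eq[OF P.closed_class_compositions] W_minus_eq[OF P.closed_class_plain])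
  have 1: "W False (E \<N>) =
      series_exp (formal_sum (\<lambda>m. scale (1 / of_nat m) (dilate m (W False (plain \<N>)))) {m. 1 \<le> m})"
    using P.W_E[OF P.enumerates_connected] by simp
  have 2: "W True (E \<N>) = series_exp
        (formal_sum (\<lambda>m. scale (1 / of_nat m) (dilate m (W False (plain \<N>)))) {m. 1 \<le> m \<and> even m}
       + formal_sum (\<lambda>m. scale (1 / of_nat m) (dilate m (W True (plain \<N>)))) {m. 1 \<le> m \<and> odd m})"
    and 3: "W True (E2 \<N>) = scale (1 / 2) ((W True (plain \<N>))\<^sup>2 + dilate 2 (W False (plain \<N>)))"
    if "tau_closed \<N>"
  proof -
    interpret M: parallel_species \<N> True
      using assms that by unfold_locales auto
    have "formal_sum (\<lambda>m. scale (1 / of_nat m) (dilate m (W (True \<and> odd m) (plain \<N>)))) {m. 1 \<le> m \<and> even m}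
        = formal_sum (\<lambda>m. scale (1 / of_nat m) (dilate m (W False (plain \<N>)))) {m. 1 \<le> m \<and> even m}"
      by (rule formal_sum_cong) simp
    moreover have "formal_sum (\<lambda>m. scale (1 / of_nat m) (dilate m (W (True \<and> odd m) (plain \<N>)))) {m. 1 \<le> m \<and> odd m}
        = formal_sum (\<lambda>m. scale (1 / of_nat m) (dilate m (W True (plain \<N>)))) {m. 1 \<le> m \<and> odd m}"
      by (rule formal_sum_cong) simp
    moreover have "enumerates (M.with_orbits 1 ({m. 1 \<le> m \<and> even m} \<union> {m. 1 \<le> m \<and> odd m})) M.cweight
        (formal_sum (\<lambda>m. scale (1 / of_nat m) (dilate m (W (True \<and> odd m) (plain \<N>)))) {m. 1 \<le> m \<and> even m}
       + formal_sum (\<lambda>m. scale (1 / of_nat m) (dilate m (W (True \<and> odd m) (plain \<N>)))) {m. 1 \<le> m \<and> odd m})"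
      by (intro M.enumerates_connected_Un M.enumerates_connected) auto
    moreover have "{m. 1 \<le> m \<and> even m} \<union> {m. 1 \<le> m \<and> odd m} = {m :: nat. 1 \<le> m}" by auto
    ultimately show "W True (E \<N>) = series_exp
        (formal_sum (\<lambda>m. scale (1 / of_nat m) (dilate m (W False (plain \<N>)))) {m. 1 \<le> m \<and> even m}
       + formal_sum (\<lambda>m. scale (1 / of_nat m) (dilate m (W True (plain \<N>)))) {m. 1 \<le> m \<and> odd m})"
      by (simp only: M.W_E)
    show "W True (E2 \<N>) = scale (1 / 2) ((W True (plain \<N>))\<^sup>2 + dilate 2 (W False (plain \<N>)))"
      by (rule M.W_E2)
  qed
  show ?thesis unfolding plus minus using 1 2 3 P.W_E2 by blast
qed

end
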